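(* Let $\Phi$ be an interaction on $\mathbb Z^d$ satisfying $p_\Phi(x):=\sum_{\Lambda\ni x}\|\Phi(\Lambda)\|<\infty$ for all $x\in\mathbb Z^d$, and let $\beta_\bullet$ be a net of boundary conditions. Then: (1) $(\delta_\Lambda+\beta_\Lambda)(a)\to\delta(a)$ in $\mathcal A_\infty$ for all $a\in\mathcal D$; (2) the limit $\delta_\infty$ of the net $(\delta_\Lambda+\beta_\Lambda)_\Lambda$ is well-defined and is a closed operator with $\delta\subseteq\delta_\infty$. If moreover, for some $\lambda>0$, $$\sum_{n=0}^\infty e^{n\lambda}\sup_{x\in\mathbb Z^d}\sum_{\Lambda\ni x,\ |\Lambda|=n+1}\|\Phi(\Lambda)\|<\infty,$$ then (3) the net of dynamics $(e^{t(\delta_\Lambda+\beta_\Lambda)})_\Lambda$ satisfies the equivalent conditions of the evolution theorem, $\mathcal D$ is a core for $\delta_\infty$ (i.e. $\delta_\infty=\overline\delta$), and in particular the limit dynamics $e^{t\delta_\infty}$ does not depend on the net of boundary conditions $\beta_\bullet$.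
   Context: Let $\mathcal A_{*}$ be a unital C*-algebra. The directed set is the set of finite subsets $\Lambda\subset\mathbb Z^d$ ordered by inclusion; $\mathcal A_\Lambda:=\bigotimes_{i\in\Lambda}\mathcal A_*$ (minimal tensor product), with connecting maps the natural inclusions $\mathcal A_\Lambda\to\mathcal A_{\Lambda'}$, $a\mapsto a\otimes\mathbf 1$, for $\Lambda\subset\Lambda'$. The limit $\mathcal A_\infty$ is the quasi-local algebra (norm completion of $\mathcal D:=\bigcup_\Lambda\mathcal A_\Lambda$); a net $(a_\Lambda)$, $a_\Lambda\in\mathcal A_\Lambda$, is convergent iff $\lim_\Lambda a_\Lambda$ exists in $\mathcal A_\infty$, and its limit is that norm limit. An interaction is a map $\Phi$ assigning to each finite $\Lambda$ a self-adjoint $\Phi(\Lambda)\in\mathcal A_\Lambda$. Set $H_\Lambda=\sum_{\Lambda'\subseteq\Lambda}\Phi(\Lambda')$ and $\delta_\Lambda=i[H_\Lambda,\cdot\,]$ on $\mathcal A_\Lambda$, and define $\delta$ on $\mathcal D$ by $\delta(a)=i\sum_{\Lambda'\cap\Lambda\neq\emptyset}[\Phi(\Lambda'),a]$ for $a\in\mathcal A_\Lambda$. A net of boundary conditions is a net $(\beta_\Lambda)$ of *-derivations $\beta_\Lambda:\mathcal A_\Lambda\to\mathcal A_\Lambda$ such that $\beta_\Lambda(a)\to0$ for every $a\in\mathcal D$. For a net of operators $A_\Lambda$ on $\mathcal A_\Lambda$: its net domain is the set of convergent nets $(a_\Lambda)$ with $a_\Lambda\in D(A_\Lambda)$ and $(A_\Lambda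 a_\Lambda)$ convergent; $A_\infty$ is well-defined if $\lim_\Lambda A_\Lambda a_\Lambda$ depends only on $\lim_\Lambda a_\Lambda$ on the net domain, in which case $A_\infty(\lim a_\Lambda):=\lim A_\Lambda a_\Lambda$. The evolution theorem's equivalent conditions for a net of contraction semigroups $T_\Lambda(t)$ with generators $A_\Lambda$ include: $T_\bullet(t)$ maps convergent nets to convergent nets for all $t\ge0$ with strongly continuous limit $T_\infty(t)$; equivalently $A_\infty$ is well-defined and generates a strongly continuous contraction semigroup (which is then $T_\infty(t)$). *)

theory Defs
  imports "HOL-Analysis.Analysis"
begin

text \<open>Abstract quasi-local C*-algebra over the lattice int^'d.
  The ambient type 'a is a real Banach algebra with unit; complex scalars are
  encoded through a central element ii with ii*ii = -1 (so 'a is a complex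
  Banach algebra).  alg L is the local algebra of the finite region L.\<close>

definition cs :: "'a::real_normed_algebra_1 \<Rightarrow> complex \<Rightarrow> 'a \<Rightarrow> 'a" where
  "cs ii c x = Re c *\<^sub>R x + Im c *\<^sub>R (ii * x)"

definition cstar_structure :: "('a::{real_normed_algebra_1,banach} \<Rightarrow> 'a) \<Rightarrow> 'a \<Rightarrow> bool" where
  "cstar_structure star ii \<longleftrightarrow>
     (\<forall>x. ii * x = x * ii) \<and> ii * ii = - 1 \<and>
     (\<forall>c x. norm (cs ii c x) = cmod c * norm x) \<and>
     (\<forall>x. star (star x) = x) \<and>
     (\<forall>x y. star (x + y) = star x + star y) \<and>
     (\<forall>r x. star (r *\<^sub>R x) = r *\<^sub>R star x) \<and>
     star ii = - ii \<and>
     (\<forall>x y. star (x * y) = star y * star x) \<and>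
     (\<forall>x. norm (star x * x) = (norm x)\<^sup>2)"

definition unital_star_subalgebra ::
  "('a::{real_normed_algebra_1,banach} \<Rightarrow> 'a) \<Rightarrow> 'a \<Rightarrow> 'a set \<Rightarrow> bool" where
  "unital_star_subalgebra star ii S \<longleftrightarrow> closed S \<and> 1 \<in> S \<and>
     (\<forall>x\<in>S. \<forall>y\<in>S. x + y \<in> S \<and> x * y \<in> S) \<and>
     (\<forall>c. \<forall>x\<in>S. cs ii c x \<in> S) \<and> (\<forall>x\<in>S. star x \<in> S)"

text \<open>Quasi-local structure (isotony, locality, intersection property),
  satisfied by the minimal tensor products A_L inside the quasi-local algebra.\<close>
definition quasi_local ::
  "('a::{real_normed_algebra_1,banach} \<Rightarrow> 'a) \<Rightarrow> 'a \<Rightarrow> ((int^'d) set \<Rightarrow> 'a set) \<Rightarrow> bool" where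
  "quasi_local star ii alg \<longleftrightarrow> cstar_structure star ii \<and>
     (\<forall>L. finite L \<longrightarrow> unital_star_subalgebra star ii (alg L)) \<and>
     (\<forall>L L'. finite L' \<and> L \<subseteq> L' \<longrightarrow> alg L \<subseteq> alg L') \<and>
     (\<forall>L L'. finite L \<and> finite L' \<longrightarrow> alg L \<inter> alg L' = alg (L \<inter> L')) \<and>
     (\<forall>L L' x y. finite L \<and> finite L' \<and> L \<inter> L' = {} \<and> x \<in> alg L \<and> y \<in> alg L'
        \<longrightarrow> x * y = y * x)"

definition qlD :: "((int^'d) set \<Rightarrow> 'a set) \<Rightarrow> 'a set" where
  "qlD alg = (\<Union>L\<in>{L. finite L}. alg L)"

definition qlA :: "((int^'d) set \<Rightarrow> 'a::topological_space set) \<Rightarrow> 'a set" where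
  "qlA alg = closure (qlD alg)"

abbreviation netF :: "(int^'d) set filter" where
  "netF \<equiv> finite_subsets_at_top UNIV"

definition conv_net :: "((int^'d) set \<Rightarrow> 'a::topological_space) \<Rightarrow> bool" where
  "conv_net a \<longleftrightarrow> (\<exists>l. (a \<longlongrightarrow> l) netF)"

definition netlim :: "((int^'d) set \<Rightarrow> 'a::t2_space) \<Rightarrow> 'a" where
  "netlim a = Lim netF a"

definition limit_graph ::
  "((int^'d) set \<Rightarrow> 'a set) \<Rightarrow> ((int^'d) set \<Rightarrow> 'a \<Rightarrow> 'a::t2_space) \<Rightarrow> ('a \<times> 'a) set" where
  "limit_graph Dom A = {(netlim a, netlim (\<lambda>L. A L (a L))) | a.
      (\<forall>L. finite L \<longrightarrow> a L \<in> Dom L) \<and> conv_net a \<and> conv_net (\<lambda>L. A L (a L))}"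

definition well_defined :: "('a \<times> 'b) set \<Rightarrow> bool" where
  "well_defined G \<longleftrightarrow> (\<forall>x y z. (x, y) \<in> G \<longrightarrow> (x, z) \<in> G \<longrightarrow> y = z)"

definition interaction ::
  "('a \<Rightarrow> 'a) \<Rightarrow> ((int^'d) set \<Rightarrow> 'a set) \<Rightarrow> ((int^'d) set \<Rightarrow> 'a) \<Rightarrow> bool" where
  "interaction star alg Phi \<longleftrightarrow> (\<forall>L. finite L \<longrightarrow> Phi L \<in> alg L \<and> star (Phi L) = Phi L)"

definition comm :: "'a::ring \<Rightarrow> 'a \<Rightarrow> 'a" where
  "comm x y = x * y - y * x"

definition Hloc :: "((int^'d) set \<Rightarrow> 'a::real_normed_algebra_1) \<Rightarrow> (int^'d) set \<Rightarrow> 'a" where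
  "Hloc Phi L = (\<Sum>L'\<in>Pow L. Phi L')"

definition dloc :: "'a::real_normed_algebra_1 \<Rightarrow> ((int^'d) set \<Rightarrow> 'a) \<Rightarrow> (int^'d) set \<Rightarrow> 'a \<Rightarrow> 'a" where
  "dloc ii Phi L a = cs ii \<i> (comm (Hloc Phi L) a)"

definition delta_graph ::
  "'a::{real_normed_algebra_1,banach} \<Rightarrow> ((int^'d) set \<Rightarrow> 'a set) \<Rightarrow> ((int^'d) set \<Rightarrow> 'a) \<Rightarrow> ('a \<times> 'a) set" where
  "delta_graph ii alg Phi = {(a, cs ii \<i> (infsum (\<lambda>L'. comm (Phi L') a) {L'. finite L' \<and> L' \<inter> L \<noteq> {}})) | a L.
      finite L \<and> a \<in> alg L}"

definition star_derivation :: "('a::real_normed_algebra_1 \<Rightarrow> 'a) \<Rightarrow> 'a \<Rightarrow> 'a set \<Rightarrow> ('a \<Rightarrow> 'a) \<Rightarrow> bool" where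
  "star_derivation star ii S b \<longleftrightarrow> (\<forall>x\<in>S. b x \<in> S) \<and>
     (\<forall>x\<in>S. \<forall>y\<in>S. b (x + y) = b x + b y \<and> b (x * y) = b x * y + x * b y) \<and>
     (\<forall>c. \<forall>x\<in>S. b (cs ii c x) = cs ii c (b x)) \<and>
     (\<forall>x\<in>S. b (star x) = star (b x))"

definition boundary_net ::
  "('a::real_normed_algebra_1 \<Rightarrow> 'a) \<Rightarrow> 'a \<Rightarrow> ((int^'d) set \<Rightarrow> 'a set) \<Rightarrow> ((int^'d) set \<Rightarrow> 'a \<Rightarrow> 'a) \<Rightarrow> bool" where
  "boundary_net star ii alg beta \<longleftrightarrow>
     (\<forall>L. finite L \<longrightarrow> star_derivation star ii (alg L) (beta L)) \<and>
     (\<forall>a \<in> qlD alg. ((\<lambda>L. beta L a) \<longlongrightarrow> 0) netF)"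

definition delta_inf ::
  "'a::{real_normed_algebra_1,banach} \<Rightarrow> ((int^'d) set \<Rightarrow> 'a set) \<Rightarrow> ((int^'d) set \<Rightarrow> 'a) \<Rightarrow>
     ((int^'d) set \<Rightarrow> 'a \<Rightarrow> 'a) \<Rightarrow> ('a \<times> 'a) set" where
  "delta_inf ii alg Phi beta = limit_graph alg (\<lambda>L a. dloc ii Phi L a + beta L a)"

definition dyn ::
  "'a::{real_normed_algebra_1,banach} \<Rightarrow> ((int^'d) set \<Rightarrow> 'a) \<Rightarrow> ((int^'d) set \<Rightarrow> 'a \<Rightarrow> 'a) \<Rightarrow>
     (int^'d) set \<Rightarrow> real \<Rightarrow> 'a \<Rightarrow> 'a" where
  "dyn ii Phi beta L t a = (\<Sum>n. (t ^ n / fact n) *\<^sub>R (((\<lambda>b. dloc ii Phi L b + beta L b) ^^ n) a))"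

definition c0_contraction :: "'a::{real_normed_algebra_1,banach} \<Rightarrow> 'a set \<Rightarrow> (real \<Rightarrow> 'a \<Rightarrow> 'a) \<Rightarrow> bool" where
  "c0_contraction ii X T \<longleftrightarrow>
     (\<forall>t\<ge>0. \<forall>x\<in>X. T t x \<in> X \<and> norm (T t x) \<le> norm x) \<and>
     (\<forall>t\<ge>0. \<forall>x\<in>X. \<forall>y\<in>X. T t (x + y) = T t x + T t y) \<and>
     (\<forall>t\<ge>0. \<forall>c. \<forall>x\<in>X. T t (cs ii c x) = cs ii c (T t x)) \<and>
     (\<forall>x\<in>X. T 0 x = x) \<and>
     (\<forall>s\<ge>0. \<forall>t\<ge>0. \<forall>x\<in>X. T (s + t) x = T s (T t x)) \<and>
     (\<forall>x\<in>X. continuous_on {0..} (\<lambda>t. T t x))"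

definition generator :: "'a::real_normed_vector set \<Rightarrow> (real \<Rightarrow> 'a \<Rightarrow> 'a) \<Rightarrow> ('a \<times> 'a) set" where
  "generator X T = {(x, y). x \<in> X \<and> ((\<lambda>h. (1 / h) *\<^sub>R (T h x - x)) \<longlongrightarrow> y) (at_right 0)}"

definition evolution_conditions ::
  "'a::{real_normed_algebra_1,banach} \<Rightarrow> ((int^'d) set \<Rightarrow> 'a set) \<Rightarrow> ((int^'d) set \<Rightarrow> 'a) \<Rightarrow>
     ((int^'d) set \<Rightarrow> 'a \<Rightarrow> 'a) \<Rightarrow> bool" where
  "evolution_conditions ii alg Phi beta \<longleftrightarrow>
     (\<forall>t\<ge>0. \<forall>a. (\<forall>L. finite L \<longrightarrow> a L \<in> alg L) \<and> conv_net a
        \<longrightarrow> conv_net (\<lambda>L. dyn ii Phi beta L t (a L))) \<and>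
     (\<exists>T. c0_contraction ii (qlA alg) T \<and>
        (\<forall>t\<ge>0. \<forall>a. (\<forall>L. finite L \<longrightarrow> a L \<in> alg L) \<and> conv_net a
           \<longrightarrow> netlim (\<lambda>L. dyn ii Phi beta L t (a L)) = T t (netlim a)) \<and>
        well_defined (delta_inf ii alg Phi beta) \<and>
        delta_inf ii alg Phi beta = generator (qlA alg) T)"

end

theory Submission
  imports Defs
begin

text \<open>
  Every everywhere defined *-derivation \<open>D\<close> of a C*-algebra satisfies \<open>\<parallel>x\<parallel> \<le> \<parallel>x + t D x\<parallel>\<close> for all
  real \<open>t\<close>. For a unitary \<open>u\<close> the C*-identity gives \<open>\<parallel>u + t D u\<parallel> \<le> 1 + O(t\<^sup>2)\<close>, since
  \<open>D (u* u) = 0\<close>; self-adjoint contractions are real parts of unitaries, convexity of the norm turns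
  the upper bound into the lower one, and \<open>\<parallel>x\<parallel>\<^sup>2 = \<parallel>x* x\<parallel>\<close> reduces the general case to self-adjoint
  elements. Such dissipative operators are bounded by the closed graph theorem, and their exponentials
  are contractions. Dissipativity passes to the limit of the net and makes it well-defined.

  Under the exponential bound, in a scale of norms weighting a local element by
  \<open>e\<^bsup>\<sigma>|L|\<^esup>\<close>, the iterated commutators \<open>\<delta>\<^sub>L\<^sup>n a\<close> are bounded by \<open>C K\<^sup>n n!\<close> and converge along the net
  to vectors \<open>a\<^sub>n\<close> with \<open>a\<^sub>n\<^sub>+\<^sub>1 = \<delta> a\<^sub>n\<close> for the closure of \<open>\<delta>\<close>. Truncated exponential
  series of these vectors are approximate solutions of the finite volume evolution equations for
  arbitrary boundary conditions, hence the dynamics converge for small and by iteration for all times.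
  Averages over short pieces of orbits show that local elements form a core.
\<close>

section \<open>Derivations of C*-algebras are dissipative\<close>

text \<open>The obstacle is that boundary derivations tend to zero only pointwise on local elements.
  Nothing is known about their norms, so powers of \<open>gen L\<close> admit no estimate uniform in
  \<open>L\<close> and cannot be compared with powers of \<open>dloc ii Phi L\<close>. All
  quantitative work is therefore done for the interaction alone and ends in a statement about the
  closure of \<open>delta_graph\<close>. The limit graph of every net of boundary conditions is
  closed and contains \<open>delta_graph\<close>, hence contains that closure; boundary terms
  re-enter only through nets representing the analytic vectors. Such nets solve the finite volume
  equations up to small defects, and dissipativity bounds the resulting error by defect times time,
  with no constant depending on \<open>L\<close>. This replaces any uniform bound on the generators.
  Independence of the boundary conditions is obtained last: each limit graph lies between the
  closure of \<open>delta_graph\<close> and the generator of the limit semigroup, and the core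
  argument shows that these two coincide.\<close>

definition binom_half :: "nat \<Rightarrow> real" where
  "binom_half n = (-1) ^ n * ((1/2) gchoose n)"

text \<open>The numbers \<open>binom_half n\<close> are the Taylor coefficients of
  \<open>sqrt (1 - x)\<close>, and \<open>d n\<close> below are those of its reciprocal. Pascal's
  rule gives \<open>\<bar>binom_half (Suc n)\<bar> = d n - d (Suc n)\<close> with \<open>d\<close>
  nonnegative and decreasing, so the series telescopes. Convergence is needed up to norm exactly 1,
  since normalised elements are inserted.\<close>

lemma summable_norm_binom_half: "summable (\<lambda>n. \<bar>binom_half n\<bar>)"
proof -
  define d where "d n = (-1) ^ n * ((-1/2::real) gchoose n)" for n
  have d_Suc: "d (Suc n) = (1 - 1 / (2 * (real n + 1))) * d n" for n
  proof -
    have "(real n + 1) * ((-1/2::real) gchoose Suc n) = - (real n + 1/2) * ((-1/2) gchoose n)"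
      using gbinomial_mult_1[of "-1/2::real" n] by (simp add: algebra_simps)
    then have "((-1/2::real) gchoose Suc n) = - ((1 - 1 / (2 * (real n + 1))) * ((-1/2) gchoose n))"
      by (simp add: field_simps)
    then show ?thesis unfolding d_def by simp
  qed
  have d_nonneg: "0 \<le> d n" for n
  proof (induction n)
    case (Suc n)
    then show ?case unfolding d_Suc by (intro mult_nonneg_nonneg divide_nonneg_nonneg) auto
  qed (simp add: d_def)
  have d_decr: "d (Suc n) \<le> d n" for n
    unfolding d_Suc using mult_right_mono[OF _ d_nonneg, of "1 - 1 / (2 * (real n + 1))" 1 n] by simp
  have b: "\<bar>binom_half (Suc n)\<bar> = d n - d (Suc n)" for n
  proof -
    have "((1/2::real) gchoose (Suc n)) = ((-1/2) gchoose Suc n) + ((-1/2) gchoose n)"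
      using gbinomial_addition_formula[of "1/2::real" n] by simp
    then have "binom_half (Suc n) = d (Suc n) - d n"
      unfolding binom_half_def d_def by (simp add: algebra_simps)
    then show ?thesis using d_decr[of n] by simp
  qed
  have "summable (\<lambda>n. \<bar>binom_half (Suc n)\<bar>)"
  proof (rule summableI_nonneg_bounded)
    show "(\<Sum>i<n. \<bar>binom_half (Suc i)\<bar>) \<le> d 0" for n
      unfolding b sum_lessThan_telescope' using d_nonneg[of n] by simp
  qed simp
  then show ?thesis by (subst (asm) summable_Suc_iff)
qed

text \<open>Vandermonde's identity with both upper arguments 1/2 gives \<open>1 gchoose n\<close>:
  the formal square of the series is \<open>1 - x\<close>.\<close>

lemma binom_half_convolution:
  "(\<Sum>i\<le>n. binom_half i * binom_half (n - i)) = (if n = 0 then 1 else if n = 1 then -1 else 0)"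
proof -
  have "(\<Sum>i\<le>n. binom_half i * binom_half (n - i))
      = (\<Sum>i\<le>n. (-1)^n * (((1/2) gchoose i) * ((1/2) gchoose (n - i))))"
  proof (rule sum.cong, simp)
    fix i assume "i \<in> {..n}"
    then have "(-1::real)^n = (-1)^i * (-1)^(n-i)" by (simp flip: power_add)
    then show "binom_half i * binom_half (n - i) = (-1)^n * (((1/2) gchoose i) * ((1/2) gchoose (n - i)))"
      by (simp add: binom_half_def)
  qed
  also have "\<dots> = (-1)^n * ((1::real) gchoose n)"
    using gbinomial_Vandermonde[of "1/2::real" "1/2" n] by (simp add: atLeast0AtMost flip: sum_distrib_left)
  also have "((1::real) gchoose n) = of_nat (1 choose n)"
    by (metis binomial_gbinomial of_nat_1)
  finally show ?thesis
    by (auto simp: binomial_eq_0)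
qed

context
  fixes x :: "'a::{real_normed_algebra_1,banach}"
  assumes norm_x: "norm x \<le> 1"
begin

lemma summable_sqrt_series: "summable (\<lambda>n. norm (binom_half n *\<^sub>R x ^ n))"
proof (rule summable_comparison_test'[OF summable_norm_binom_half])
  show "norm (norm (binom_half n *\<^sub>R x ^ n)) \<le> \<bar>binom_half n\<bar>" for n
    using order_trans[OF norm_power_ineq power_le_one[OF norm_ge_zero norm_x], of n]
    by (simp add: mult_left_le)
qed

lemma sqrt_series_square:
  "(\<Sum>n. binom_half n *\<^sub>R x ^ n) * (\<Sum>n. binom_half n *\<^sub>R x ^ n) = 1 - x"
proof -
  have "(\<lambda>n. \<Sum>i\<le>n. (binom_half i *\<^sub>R x ^ i) * (binom_half (n - i) *\<^sub>R x ^ (n - i)))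
     sums ((\<Sum>n. binom_half n *\<^sub>R x ^ n) * (\<Sum>n. binom_half n *\<^sub>R x ^ n))"
    by (rule Cauchy_product_sums[OF summable_sqrt_series summable_sqrt_series])
  moreover have "(\<Sum>i\<le>n. (binom_half i *\<^sub>R x ^ i) * (binom_half (n - i) *\<^sub>R x ^ (n - i)))
     = (if n = 0 then 1 else if n = 1 then -x else 0)" for n
  proof -
    have "(\<Sum>i\<le>n. (binom_half i *\<^sub>R x ^ i) * (binom_half (n - i) *\<^sub>R x ^ (n - i)))
        = (\<Sum>i\<le>n. binom_half i * binom_half (n - i)) *\<^sub>R x ^ n"
      unfolding scaleR_sum_left by (rule sum.cong) (simp_all flip: power_add)
    then show ?thesis unfolding binom_half_convolution by simp
  qed
  moreover have "(\<lambda>n. if n = 0 then 1 else if n = 1 then -x else 0) sums (1 - x)"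
    using sums_finite[of "{0,1::nat}" "\<lambda>n. if n = 0 then 1 else if n = 1 then -x else 0"] by auto
  ultimately show ?thesis using sums_unique2 by auto
qed

end

text \<open>The function \<open>h \<mapsto> norm (x + h *\<^sub>R y)\<close> is convex. A lower
  bound with quadratic defect says that its right derivative at 0 is nonnegative, and convexity
  propagates this to every \<open>t\<close>: the defect, divided by \<open>h\<close>, vanishes as
  \<open>h\<close> tends to 0.\<close>

lemma norm_le_norm_add_scaleR:
  fixes x y :: "'a::real_normed_vector"
  assumes lower: "\<And>h. 0 < h \<Longrightarrow> h \<le> 1 \<Longrightarrow> norm x - C * h\<^sup>2 \<le> norm (x + h *\<^sub>R y)" and "0 \<le> t"
  shows "norm x \<le> norm (x + t *\<^sub>R y)"
proof (cases "t = 0")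
  case False
  then have t: "0 < t" using \<open>0 \<le> t\<close> by simp
  have *: "norm x - norm (x + t *\<^sub>R y) \<le> (C * t) * h" if h: "0 < h" "h \<le> min 1 t" for h
  proof -
    have "x + h *\<^sub>R y = (1 - h/t) *\<^sub>R x + (h/t) *\<^sub>R (x + t *\<^sub>R y)"
      using t by (simp add: algebra_simps)
    then have "norm (x + h *\<^sub>R y) \<le> (1 - h/t) * norm x + (h/t) * norm (x + t *\<^sub>R y)"
      using norm_triangle_ineq[of "(1 - h/t) *\<^sub>R x" "(h/t) *\<^sub>R (x + t *\<^sub>R y)"] h t by simp
    with lower[of h] h have "(h/t) * (norm x - norm (x + t *\<^sub>R y)) \<le> C * h\<^sup>2"
      by (simp add: algebra_simps)
    then have "(norm x - norm (x + t *\<^sub>R y)) \<le> C * h\<^sup>2 * (t / h)"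
      using h t by (simp add: field_simps)
    also have "\<dots> = (C * t) * h" using h by (simp add: power2_eq_square)
    finally show ?thesis .
  qed
  have "((\<lambda>h. (C * t) * h) \<longlongrightarrow> (C * t) * 0) (at_right 0)"
    by (intro tendsto_intros)
  moreover have "\<forall>\<^sub>F h in at_right 0. norm x - norm (x + t *\<^sub>R y) \<le> (C * t) * h"
    unfolding eventually_at_right_field using * t by (intro exI[of _ "min 1 t"]) auto
  ultimately have "norm x - norm (x + t *\<^sub>R y) \<le> (C * t) * 0"
    by (intro tendsto_lowerbound[where F="at_right 0"]) auto
  then show ?thesis by simp
qed simp

section \<open>C*-algebras and their closed unital *-subalgebras\<close>

locale cstar_algebra =
  fixes star :: "'a::{real_normed_algebra_1,banach} \<Rightarrow> 'a" and ii :: 'a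
  assumes cstar_structure: "cstar_structure star ii"
begin

lemma ii_central: "ii * x = x * ii" and ii_square: "ii * ii = -1"
  and norm_cs: "norm (cs ii c x) = cmod c * norm x"
  and star_star [simp]: "star (star x) = x"
  and star_add: "star (x + y) = star x + star y"
  and star_scaleR: "star (r *\<^sub>R x) = r *\<^sub>R star x"
  and star_ii: "star ii = - ii"
  and star_mult: "star (x * y) = star y * star x"
  and norm_star_mult: "norm (star x * x) = (norm x)\<^sup>2"
  using cstar_structure unfolding cstar_structure_def by iprover+

lemma norm_star [simp]: "norm (star x) = norm x"
proof -
  have *: "norm y \<le> norm (star y)" for y
  proof (cases "y = 0")
    case False
    have "norm y * norm y \<le> norm (star y) * norm y"
      using norm_mult_ineq[of "star y" y] by (simp add: norm_star_mult power2_eq_square)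
    with False show ?thesis by simp
  qed simp
  show ?thesis using *[of x] *[of "star x"] by simp
qed

lemma bounded_linear_star: "bounded_linear star"
  by (rule bounded_linear_intro[where K=1]) (auto simp: star_add star_scaleR)

lemma star_diff: "star (x - y) = star x - star y"
  by (rule linear_diff[OF bounded_linear.linear[OF bounded_linear_star]])

lemma star_1 [simp]: "star 1 = 1"
  by (metis mult_1 star_mult star_star)

lemma star_power: "star (x ^ n) = star x ^ n"
  by (induction n) (auto simp: star_mult power_commutes)

lemma cs_i: "cs ii \<i> x = ii * x"
  by (simp add: cs_def)

lemma cs_of_real: "cs ii (of_real r) x = r *\<^sub>R x"
  by (simp add: cs_def)

end

locale cstar_subalgebra = cstar_algebra +
  fixes S
  assumes subalgebra: "unital_star_subalgebra star ii S"
begin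

lemma closed_S: "closed S" and one_S: "1 \<in> S" and add_S: "x \<in> S \<Longrightarrow> y \<in> S \<Longrightarrow> x + y \<in> S"
  and mult_S: "x \<in> S \<Longrightarrow> y \<in> S \<Longrightarrow> x * y \<in> S"
  and cs_S: "x \<in> S \<Longrightarrow> cs ii c x \<in> S" and star_S: "x \<in> S \<Longrightarrow> star x \<in> S"
  using subalgebra unfolding unital_star_subalgebra_def by auto

lemma scaleR_S: "x \<in> S \<Longrightarrow> r *\<^sub>R x \<in> S"
  using cs_S[of x "of_real r"] by (simp add: cs_of_real)

lemma subspace_S: "subspace S"
  unfolding subspace_def using add_S scaleR_S scaleR_S[OF one_S, of 0] by auto

lemma power_S: "x \<in> S \<Longrightarrow> x ^ n \<in> S"
  by (induction n) (auto simp: one_S mult_S)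

text \<open>A self-adjoint contraction \<open>a\<close> is the real part of the unitary \<open>a + \<i> (1 - a\<^sup>2)\<^sup>\<half>\<close>.\<close>
lemma unitary_dilation:
  assumes "a \<in> S" "star a = a" "norm a \<le> 1"
  obtains u where "u \<in> S" "star u * u = 1" "a = (1/2) *\<^sub>R (u + star u)"
proof -
  have a2: "norm (a * a) \<le> 1"
    using norm_mult_ineq[of a a] mult_le_one[OF assms(3) norm_ge_zero assms(3)] by linarith
  define q where "q = (\<Sum>n. binom_half n *\<^sub>R (a * a) ^ n)"
  have summ: "summable (\<lambda>n. binom_half n *\<^sub>R (a * a) ^ n)"
    by (rule summable_norm_cancel[OF summable_sqrt_series[OF a2]])
  \<comment> \<open>\<open>q\<close> is the square root of \<open>1 - a * a\<close>. Being a limit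
    of real polynomials in \<open>a\<close>, it stays in the closed set \<open>S\<close>, is
    self-adjoint and commutes with \<open>a\<close>.\<close>
  have q_S: "q \<in> S" unfolding q_def suminf_eq_lim
  proof (rule Lim_in_closed_set[OF closed_S])
    show "((\<lambda>n. \<Sum>i<n. binom_half i *\<^sub>R (a * a) ^ i) \<longlongrightarrow> lim (\<lambda>n. \<Sum>i<n. binom_half i *\<^sub>R (a * a) ^ i)) sequentially"
      using summ summable_LIMSEQ suminf_eq_lim by metis
    show "\<forall>\<^sub>F n in sequentially. (\<Sum>i<n. binom_half i *\<^sub>R (a * a) ^ i) \<in> S"
      by (intro always_eventually allI subspace_sum[OF subspace_S] scaleR_S power_S mult_S assms)
  qed simp
  have q_star: "star q = q"
    unfolding q_def bounded_linear.suminf[OF bounded_linear_star summ]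
    by (simp add: star_scaleR star_power star_mult assms)
  have q2: "q * q = 1 - a * a"
    unfolding q_def by (rule sqrt_series_square[OF a2])
  have qa: "q * a = a * q"
  proof -
    have "a * (a * a) ^ n = (a * a) ^ n * a" for n
      by (metis mult.assoc power_commuting_commutes)
    then show ?thesis unfolding q_def
      by (simp add: suminf_mult[OF summ, symmetric] suminf_mult2[OF summ])
  qed
  define u where "u = a + ii * q"
  have star_u: "star u = a - ii * q"
    unfolding u_def by (simp add: star_add star_mult star_ii assms q_star ii_central)
  have "u \<in> S" unfolding u_def using add_S[OF assms(1) cs_S[OF q_S, of \<i>]] by (simp add: cs_i)
  moreover have "star u * u = 1"
  proof -
    have 1: "ii * q * a = a * (ii * q)" by (metis ii_central mult.assoc qa)
    have "ii * q * (ii * q) = ii * ii * (q * q)" by (metis ii_central mult.assoc)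
    then have 2: "ii * q * (ii * q) = - (q * q)" by (simp add: ii_square)
    show ?thesis unfolding star_u unfolding u_def
      by (simp add: left_diff_distrib distrib_left 1 2 q2)
  qed
  moreover have "a = (1/2) *\<^sub>R (u + star u)"
    unfolding star_u unfolding u_def by simp
  ultimately show ?thesis by (rule that)
qed

end

section \<open>Dissipativity of *-derivations\<close>

locale cstar_derivation = cstar_subalgebra +
  fixes D
  assumes derivation: "star_derivation star ii S D"
begin

lemma D_S: "x \<in> S \<Longrightarrow> D x \<in> S" 
  and D_add: "x \<in> S \<Longrightarrow> y \<in> S \<Longrightarrow> D (x + y) = D x + D y"
  and D_mult: "x \<in> S \<Longrightarrow> y \<in> S \<Longrightarrow> D (x * y) = D x * y + x * D y"
  and D_cs: "x \<in> S \<Longrightarrow> D (cs ii c x) = cs ii c (D x)"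
  and D_star: "x \<in> S \<Longrightarrow> D (star x) = star (D x)"
  using derivation unfolding star_derivation_def by auto

lemma D_scaleR: "x \<in> S \<Longrightarrow> D (r *\<^sub>R x) = r *\<^sub>R D x"
  using D_cs[of x "of_real r"] by (simp add: cs_of_real)

lemma D_1: "D 1 = 0"
  using D_mult[OF one_S one_S] by simp

text \<open>By the Leibniz rule the first-order part of the product is \<open>D\<close> applied to
  \<open>star x * x\<close>. It vanishes when \<open>star x * x = 1\<close>; in general it is the
  expression to which the self-adjoint case applies.\<close>

lemma norm_add_D_square:
  assumes "x \<in> S"
  shows "star (x + t *\<^sub>R D x) * (x + t *\<^sub>R D x) =
    star x * x + t *\<^sub>R D (star x * x) + t\<^sup>2 *\<^sub>R (star (D x) * D x)"
proof -
  have 1: "D (star x * x) = star (D x) * x + star x * D x"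
    using assms by (simp add: D_mult star_S D_star)
  show ?thesis unfolding 1 star_add star_scaleR
    by (simp add: distrib_left distrib_right scaleR_add_right power2_eq_square)
qed

lemma self_adjoint_upper:
  assumes "a \<in> S" "star a = a" "norm a \<le> 1"
  shows "\<exists>C. \<forall>t. norm (a + t *\<^sub>R D a) \<le> 1 + C * t\<^sup>2"
proof -
  obtain u where u: "u \<in> S" "star u * u = 1" "a = (1/2) *\<^sub>R (u + star u)"
    using unitary_dilation[OF assms] .
  define C where "C = (norm (D u))\<^sup>2"
  have bound: "norm (u + t *\<^sub>R D u) \<le> 1 + C * t\<^sup>2" for t
  proof -
    have "(norm (u + t *\<^sub>R D u))\<^sup>2 = norm (1 + t\<^sup>2 *\<^sub>R (star (D u) * D u))"
      by (simp add: norm_star_mult[symmetric] norm_add_D_square u D_1)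
    also have "\<dots> \<le> 1 + t\<^sup>2 * C"
      using norm_triangle_ineq[of 1 "t\<^sup>2 *\<^sub>R (star (D u) * D u)"] by (simp add: norm_star_mult C_def)
    \<comment> \<open>A generous square on the right avoids a square root; only the order
      \<open>t\<^sup>2\<close> matters.\<close>
    also have "\<dots> \<le> (1 + C * t\<^sup>2)\<^sup>2"
      by (simp add: power2_sum C_def field_simps)
    finally show ?thesis by (rule power2_le_imp_le) (simp add: C_def)
  qed
  have "norm (a + t *\<^sub>R D a) \<le> 1 + C * t\<^sup>2" for t
  proof -
    have "a + t *\<^sub>R D a = (1/2) *\<^sub>R ((u + t *\<^sub>R D u) + star (u + t *\<^sub>R D u))"
      unfolding u(3) using u(1) by (simp add: D_scaleR D_add D_star add_S star_S scaleR_S star_add star_scaleR algebra_simps)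
    then have "norm (a + t *\<^sub>R D a) \<le> (1/2) * (norm (u + t *\<^sub>R D u) + norm (star (u + t *\<^sub>R D u)))"
      using norm_triangle_ineq[of "u + t *\<^sub>R D u" "star (u + t *\<^sub>R D u)"] by simp
    then show ?thesis using bound[of t] by simp
  qed
  then show ?thesis by blast
qed

lemma self_adjoint_lower:
  assumes "a \<in> S" "star a = a" "0 \<le> t"
  shows "norm a \<le> norm (a + t *\<^sub>R D a)"
proof (cases "a = 0")
  case False
  define b where "b = (1 / norm a) *\<^sub>R a"
  have b: "b \<in> S" "star b = b" "norm b = 1"
    using assms False by (auto simp: b_def scaleR_S star_scaleR)
  obtain C where C: "\<And>h. norm (b + h *\<^sub>R D b) \<le> 1 + C * h\<^sup>2"
    using self_adjoint_upper[OF b(1,2)] b(3) by auto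
  have "norm b - C * h\<^sup>2 \<le> norm (b + h *\<^sub>R D b)" for h
  proof -
    \<comment> \<open>\<open>b\<close> is the midpoint of the two perturbed points, so the upper
      bound at \<open>-h\<close> becomes a lower bound at \<open>h\<close>. The normalisation
      \<open>norm b = 1\<close> makes the constant terms match.\<close>
    have "2 * norm b \<le> norm (b + h *\<^sub>R D b) + norm (b + (-h) *\<^sub>R D b)"
    proof -
      have "(b + h *\<^sub>R D b) + (b + (-h) *\<^sub>R D b) = 2 *\<^sub>R b" by (simp add: scaleR_2)
      then show ?thesis
        using norm_triangle_ineq[of "b + h *\<^sub>R D b" "b + (-h) *\<^sub>R D b"] by simp
    qed
    then show ?thesis using C[of "-h"] b(3) by simp
  qed
  from norm_le_norm_add_scaleR[OF this assms(3)]
  have "norm a * norm b \<le> norm a * norm (b + t *\<^sub>R D b)"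
    by (intro mult_left_mono) auto
  also have "\<dots> = norm (norm a *\<^sub>R (b + t *\<^sub>R D b))" by simp
  also have "norm a *\<^sub>R (b + t *\<^sub>R D b) = a + t *\<^sub>R D a"
    using False assms by (simp add: b_def D_scaleR algebra_simps)
  finally show ?thesis using b by simp
qed simp

lemma dissipative_nonneg:
  assumes "x \<in> S" "0 \<le> t"
  shows "norm x \<le> norm (x + t *\<^sub>R D x)"
proof (cases "x = 0")
  case False
  define C where "C = (norm (D x))\<^sup>2 / norm x"
  have "norm x - C * h\<^sup>2 \<le> norm (x + h *\<^sub>R D x)" if "0 < h" for h
  proof (cases "norm x \<le> norm (x + h *\<^sub>R D x)")
    case True
    have "0 \<le> C * h\<^sup>2" by (simp add: C_def)
    with True show ?thesis by linarith
  next
    \<comment> \<open>Here \<open>?n < ?m\<close>, so the difference of squares dominates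
      \<open>(?m - ?n) * ?m\<close>. Division by \<open>?m\<close> then gives the constant
      \<open>C\<close>.\<close>
    case less: False
    let ?n = "norm (x + h *\<^sub>R D x)" and ?m = "norm x"
    let ?p = "star x * x"
    have "?m\<^sup>2 = norm ?p" by (simp add: norm_star_mult)
    also have "\<dots> \<le> norm (?p + h *\<^sub>R D ?p)"
      using assms that by (intro self_adjoint_lower) (auto simp: mult_S star_S star_mult)
    also have "?p + h *\<^sub>R D ?p = star (x + h *\<^sub>R D x) * (x + h *\<^sub>R D x) - h\<^sup>2 *\<^sub>R (star (D x) * D x)"
      using assms by (simp add: norm_add_D_square)
    also have "norm \<dots> \<le> ?n\<^sup>2 + h\<^sup>2 * (norm (D x))\<^sup>2"
      by (rule order_trans[OF norm_triangle_ineq4]) (simp add: norm_star_mult)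
    finally have "(?m - ?n) * (?m + ?n) \<le> h\<^sup>2 * (norm (D x))\<^sup>2"
      by (simp add: algebra_simps power2_eq_square)
    moreover have "(?m - ?n) * ?m \<le> (?m - ?n) * (?m + ?n)"
      using less by (intro mult_left_mono) auto
    ultimately have "(?m - ?n) * ?m \<le> h\<^sup>2 * (norm (D x))\<^sup>2" by linarith
    then have "?m - ?n \<le> C * h\<^sup>2" using False by (simp add: C_def field_simps)
    then show ?thesis by simp
  qed
  from norm_le_norm_add_scaleR[OF this assms(2)] show ?thesis by simp
qed simp

text \<open>Supplies negative \<open>t\<close>: dissipativity for both signs is what makes the
  evolutions and later perturbation arguments work with \<open>-h\<close>.\<close>

lemma derivation_minus: "cstar_derivation star ii S (\<lambda>x. - D x)"
proof
  have "star (- x) = - star x" for x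
    using star_scaleR[of "-1" x] by simp
  then show "star_derivation star ii S (\<lambda>x. - D x)"
    unfolding star_derivation_def
    by (auto simp: D_S D_add D_mult D_cs[unfolded cs_def] D_star cs_def intro!: subspace_neg[OF subspace_S])
qed

theorem dissipative:
  assumes "x \<in> S"
  shows "norm x \<le> norm (x + t *\<^sub>R D x)"
  using dissipative_nonneg[OF assms, of t]
    cstar_derivation.dissipative_nonneg[OF derivation_minus assms, of "-t"] by (cases "0 \<le> t") auto

end

section \<open>Everywhere defined dissipative operators\<close>

text \<open>The two summability hypotheses at \<open>R\<close> dominate the series and its termwise
  derivative on the whole closed interval, so the Weierstrass M-test gives the uniform convergence
  needed to differentiate term by term.\<close>

lemma vector_power_series_has_vector_derivative:
  fixes v :: "nat \<Rightarrow> 'a::banach"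
  assumes R: "0 \<le> R" and sv: "summable (\<lambda>n. R ^ n / fact n * norm (v n))"
    and sv': "summable (\<lambda>n. R ^ n / fact n * norm (v (Suc n)))" and t: "t \<in> {-R..R}"
  shows "((\<lambda>s. \<Sum>n. (s ^ n / fact n) *\<^sub>R v n) has_vector_derivative
    (\<Sum>n. (t ^ n / fact n) *\<^sub>R v (Suc n))) (at t within {-R..R})"
proof -
  let ?S = "{-R..R}"
  define f where "f n s = (s ^ n / fact n) *\<^sub>R v n" for n s
  define f' where "f' n s h = h *\<^sub>R ((real n * s ^ (n - 1) / fact n) *\<^sub>R v n)" for n s and h :: real
  define w where "w n s = (s ^ n / fact n) *\<^sub>R v (Suc n)" for n s
  have bound: "norm ((s ^ n / fact n) *\<^sub>R x) \<le> R ^ n / fact n * norm x" if "s \<in> ?S" for s n and x :: 'a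
    using that power_mono[of "\<bar>s\<bar>" R n] by (auto simp: power_abs intro!: mult_right_mono divide_right_mono)
  have unif: "uniform_limit ?S (\<lambda>n s. \<Sum>i<n. w i s) (\<lambda>s. suminf (\<lambda>i. w i s)) sequentially"
    unfolding w_def by (rule Weierstrass_m_test[OF _ sv']) (rule bound)
  \<comment> \<open>The constant term has derivative 0, hence the offset: \<open>Suc n\<close>
    differentiated terms equal \<open>n\<close> terms of the shifted series.\<close>
  have f'_sum: "(\<Sum>i<Suc n. f' i s h) = h *\<^sub>R (\<Sum>i<n. w i s)" for n s h
    by (simp add: sum.lessThan_Suc_shift f'_def w_def scaleR_sum_right del: sum.lessThan_Suc)
  have "\<exists>g. \<forall>s\<in>?S. (\<lambda>n. f n s) sums (g s) \<and> (g has_derivative (\<lambda>h. h *\<^sub>R (\<Sum>i. w i s))) (at s within ?S)"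
  proof (rule has_derivative_series)
    show "convex ?S" by simp
    show "(f n has_derivative f' n s) (at s within ?S)" for n s
      unfolding f_def f'_def by (auto intro!: derivative_eq_intros simp: field_simps)
    show "\<forall>\<^sub>F n in sequentially. \<forall>s\<in>?S. \<forall>h. norm ((\<Sum>i<n. f' i s h) - h *\<^sub>R (\<Sum>i. w i s)) \<le> e * norm h"
      if "0 < e" for e
    proof -
      have "\<forall>\<^sub>F n in sequentially. \<forall>s\<in>?S. dist (\<Sum>i<n. w i s) (\<Sum>i. w i s) < e"
        using unif that unfolding uniform_limit_iff by blast
      then have "\<forall>\<^sub>F n in sequentially. \<forall>s\<in>?S. \<forall>h. norm ((\<Sum>i<Suc n. f' i s h) - h *\<^sub>R (\<Sum>i. w i s)) \<le> e * norm h"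
      proof eventually_elim
        case (elim n)
        show ?case
        proof (intro ballI allI)
          fix s h assume "s \<in> ?S"
          with elim have "norm ((\<Sum>i<n. w i s) - (\<Sum>i. w i s)) \<le> e" by (simp add: dist_norm less_imp_le)
          then have "\<bar>h\<bar> * norm ((\<Sum>i<n. w i s) - (\<Sum>i. w i s)) \<le> \<bar>h\<bar> * e"
            by (intro mult_left_mono) auto
          then show "norm ((\<Sum>i<Suc n. f' i s h) - h *\<^sub>R (\<Sum>i. w i s)) \<le> e * norm h"
            unfolding f'_sum by (simp add: mult.commute flip: scaleR_diff_right)
        qed
      qed
      then show ?thesis by (subst (asm) eventually_sequentially_Suc)
    qed
    show "t \<in> ?S" by fact
    show "(\<lambda>n. f n t) sums suminf (\<lambda>n. f n t)" unfolding f_def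
      by (intro summable_sums summable_comparison_test'[OF sv, of 0]) (rule bound[OF t])
  qed
  then obtain g where g: "\<And>s. s \<in> ?S \<Longrightarrow> (\<lambda>n. f n s) sums (g s)"
      "\<And>s. s \<in> ?S \<Longrightarrow> (g has_derivative (\<lambda>h. h *\<^sub>R (\<Sum>i. w i s))) (at s within ?S)" by blast
  have "((\<lambda>s. \<Sum>n. f n s) has_derivative (\<lambda>h. h *\<^sub>R (\<Sum>i. w i t))) (at t within ?S)"
    by (rule has_derivative_transform[OF t _ g(2)[OF t]]) (use g(1) in \<open>auto simp: sums_iff\<close>)
  then show ?thesis unfolding has_vector_derivative_def f_def w_def .
qed

text \<open>A mean value inequality for functions that need not be differentiable, such as norms of
  curves. \<open>A\<close> collects the points where the line of slope \<open>c\<close> through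
  \<open>(t, g t)\<close> lies at or below the graph of \<open>g\<close>; it is compact, and at a
  positive least element the hypothesis produces a smaller one.\<close>

lemma le_add_of_left_dini:
  fixes g :: "real \<Rightarrow> real"
  assumes cont: "continuous_on {0..t} g" and t: "0 \<le> t"
    and dini: "\<And>u. 0 < u \<Longrightarrow> u \<le> t \<Longrightarrow> \<exists>d>0. \<forall>h. 0 < h \<and> h < d \<and> h \<le> u \<longrightarrow> g u \<le> g (u - h) + c * h"
  shows "g t \<le> g 0 + c * t"
proof -
  define A where "A = {0..t} \<inter> (\<lambda>s. g s + c * (t - s)) -` {g t..}"
  have "closed A" unfolding A_def
    by (intro continuous_closed_preimage continuous_intros cont)
  then have "compact A" unfolding A_def by (metis compact_Icc compact_Int_closed inf.idem inf_assoc)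
  moreover have "t \<in> A" using t by (simp add: A_def)
  ultimately obtain s where s: "s \<in> A" "\<And>u. u \<in> A \<Longrightarrow> s \<le> u"
    using compact_attains_inf[of A] by blast
  have "s = 0"
  proof (rule ccontr)
    assume "s \<noteq> 0"
    then have s0: "0 < s" "s \<le> t" using s(1) by (auto simp: A_def)
    from dini[OF this] obtain d where d: "d > 0" "\<And>h. 0 < h \<and> h < d \<and> h \<le> s \<Longrightarrow> g s \<le> g (s - h) + c * h"
      by blast
    define h where "h = min (d/2) s"
    have h: "0 < h \<and> h < d \<and> h \<le> s" using d s0 by (auto simp: h_def)
    have "s - h \<in> A" using d(2)[OF h] s(1) h s0 by (auto simp: A_def algebra_simps)
    from s(2)[OF this] h show False by simp
  qed
  with s(1) show ?thesis by (simp add: A_def)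
qed

text \<open>Going back by \<open>h\<close> along the curve changes \<open>p u\<close> by
  \<open>- h *\<^sub>R p' u\<close> up to \<open>o(h)\<close>. Replacing \<open>p' u\<close> by
  \<open>z u\<close> costs at most \<open>e * h\<close>, and the dissipative direction
  \<open>z u\<close> cannot decrease the norm when followed backwards. So the norm of
  \<open>p\<close> has left Dini slope at most \<open>e\<close>.\<close>

lemma norm_le_of_vector_derivative:
  fixes p p' z :: "real \<Rightarrow> 'a::real_normed_vector"
  assumes t: "0 \<le> t"
    and deriv: "\<And>s. 0 \<le> s \<Longrightarrow> s \<le> t \<Longrightarrow> (p has_vector_derivative p' s) (at s within {0..t})"
    and diss: "\<And>s h. 0 \<le> s \<Longrightarrow> s \<le> t \<Longrightarrow> 0 < h \<Longrightarrow> norm (p s) \<le> norm (p s - h *\<^sub>R z s)"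
    and close: "\<And>s. 0 \<le> s \<Longrightarrow> s \<le> t \<Longrightarrow> norm (p' s - z s) \<le> e"
  shows "norm (p t) \<le> norm (p 0) + e * t"
proof -
  \<comment> \<open>The slack \<open>\<eta>\<close> absorbs the remainder in the definition of the
    derivative and is removed at the end.\<close>
  have "norm (p t) \<le> norm (p 0) + (e + \<eta>) * t" if \<eta>: "0 < \<eta>" for \<eta>
  proof (rule le_add_of_left_dini[where g="\<lambda>s. norm (p s)"])
    show "continuous_on {0..t} (\<lambda>s. norm (p s))"
      by (intro continuous_on_norm continuous_on_vector_derivative[where f'=p'] deriv) auto
    show "0 \<le> t" by fact
    fix u assume u: "0 < u" "u \<le> t"
    then have "(p has_derivative (\<lambda>h. h *\<^sub>R p' u)) (at u within {0..t})"
      using deriv[of u] unfolding has_vector_derivative_def by simp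
    then obtain d where d: "d > 0" 
        "\<And>y. y \<in> {0..t} \<Longrightarrow> norm (y - u) < d \<Longrightarrow> norm (p y - p u - (y - u) *\<^sub>R p' u) \<le> \<eta> * norm (y - u)"
      using \<eta> unfolding has_derivative_within_alt by metis
    show "\<exists>d>0. \<forall>h. 0 < h \<and> h < d \<and> h \<le> u \<longrightarrow> norm (p u) \<le> norm (p (u - h)) + (e + \<eta>) * h"
    proof (intro exI[of _ d] conjI allI impI d)
      fix h assume h: "0 < h \<and> h < d \<and> h \<le> u"
      have "norm (p (u - h) - p u + h *\<^sub>R p' u) \<le> \<eta> * h"
        using d(2)[of "u - h"] h u by simp
      moreover have "norm (h *\<^sub>R (p' u - z u)) \<le> e * h"
        using close[of u] h u by (simp add: mult.commute)
      moreover have "norm (p u) \<le> norm (p u - h *\<^sub>R z u)"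
        using diss h u by simp
      moreover have "p u - h *\<^sub>R z u = p (u - h) - (p (u - h) - p u + h *\<^sub>R p' u) + h *\<^sub>R (p' u - z u)"
        by (simp add: algebra_simps)
      then have "norm (p u - h *\<^sub>R z u) \<le> norm (p (u - h)) + norm (p (u - h) - p u + h *\<^sub>R p' u) + norm (h *\<^sub>R (p' u - z u))"
        by (metis norm_triangle_ineq norm_triangle_ineq4 add_right_mono order_trans)
      ultimately show "norm (p u) \<le> norm (p (u - h)) + (e + \<eta>) * h"
        by (simp add: algebra_simps)
    qed
  qed
  note * = this
  have "norm (p t) - norm (p 0) - e * t \<le> 0 + \<epsilon>" if "0 < \<epsilon>" for \<epsilon>
  proof -
    have "\<epsilon> / (t + 1) * t \<le> \<epsilon>" using t that by (simp add: field_simps)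
    with *[of "\<epsilon> / (t + 1)"] t that show ?thesis by (simp add: algebra_simps)
  qed
  then show ?thesis using field_le_epsilon[of "norm (p t) - norm (p 0) - e * t" 0] by simp
qed

section \<open>Automatic boundedness of dissipative operators\<close>

locale dissipative_operator =
  fixes S :: "'a::banach set" and D :: "'a \<Rightarrow> 'a"
  assumes closed_S: "closed S" and subspace_S: "subspace S"
    and D_S: "x \<in> S \<Longrightarrow> D x \<in> S"
    and D_add: "x \<in> S \<Longrightarrow> y \<in> S \<Longrightarrow> D (x + y) = D x + D y"
    and D_scaleR: "x \<in> S \<Longrightarrow> D (r *\<^sub>R x) = r *\<^sub>R D x"
    and dissipative: "x \<in> S \<Longrightarrow> norm x \<le> norm (x + t *\<^sub>R D x)"
begin

lemmas S_intros = subspace_add[OF subspace_S] subspace_diff[OF subspace_S]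
  subspace_scale[OF subspace_S] subspace_sum[OF subspace_S] D_S subspace_0[OF subspace_S]

lemma D_0: "D 0 = 0"
  using D_scaleR[of 0 0] subspace_0[OF subspace_S] by simp

lemma D_diff: "x \<in> S \<Longrightarrow> y \<in> S \<Longrightarrow> D (x - y) = D x - D y"
  using D_add[of x "(-1) *\<^sub>R y"] by (simp only: D_scaleR S_intros) simp

lemma D_sum: "(\<And>i. i \<in> I \<Longrightarrow> f i \<in> S) \<Longrightarrow> D (\<Sum>i\<in>I. f i) = (\<Sum>i\<in>I. D (f i))"
  by (induction I rule: infinite_finite_induct) (auto simp: D_0 D_add S_intros)

text \<open>Dissipativity with parameter \<open>-r\<close> is tested on
  \<open>x n - l + r *\<^sub>R w\<close> with \<open>w = y - D l\<close>. In the limit the two terms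
  \<open>r *\<^sub>R w\<close> cancel, leaving \<open>norm w \<le> r * norm (D w)\<close> for every
  positive \<open>r\<close>, where \<open>D w\<close> is a fixed vector.\<close>

lemma closed_graph:
  fixes x :: "nat \<Rightarrow> 'a"
  assumes x: "x \<longlonglongrightarrow> l" "\<And>n. x n \<in> S" and Dx: "(\<lambda>n. D (x n)) \<longlonglongrightarrow> y"
  shows "D l = y"
proof -
  have l: "l \<in> S" using closed_sequentially[OF closed_S x(2) x(1)] .
  have y: "y \<in> S" using closed_sequentially[OF closed_S _ Dx] x(2) D_S by blast
  define w where "w = y - D l"
  have w: "w \<in> S" unfolding w_def by (intro S_intros l y)
  have *: "norm w \<le> norm (r *\<^sub>R D w)" if r: "0 < r" for r
  proof -
    have eq: "x n - l + r *\<^sub>R w + (-r) *\<^sub>R D (x n - l + r *\<^sub>R w)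
       = x n - l + r *\<^sub>R w - r *\<^sub>R (D (x n) - D l + r *\<^sub>R D w)" for n
      using x(2)[of n] l w by (simp add: D_add D_diff D_scaleR S_intros)
    have "norm (x n - l + r *\<^sub>R w) \<le> norm (x n - l + r *\<^sub>R w - r *\<^sub>R (D (x n) - D l + r *\<^sub>R D w))" for n
      unfolding eq[symmetric] by (rule dissipative) (intro S_intros x(2) l w)
    moreover have "(\<lambda>n. norm (x n - l + r *\<^sub>R w)) \<longlonglongrightarrow> norm (l - l + r *\<^sub>R w)"
      by (intro tendsto_intros x)
    moreover have "(\<lambda>n. norm (x n - l + r *\<^sub>R w - r *\<^sub>R (D (x n) - D l + r *\<^sub>R D w)))
        \<longlonglongrightarrow> norm (l - l + r *\<^sub>R w - r *\<^sub>R (y - D l + r *\<^sub>R D w))"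
      by (intro tendsto_intros x Dx)
    ultimately have "norm (r *\<^sub>R w) \<le> norm (r *\<^sub>R w - r *\<^sub>R (w + r *\<^sub>R D w))"
      by (auto intro!: LIMSEQ_le simp: w_def)
    also have "r *\<^sub>R w - r *\<^sub>R (w + r *\<^sub>R D w) = - (r *\<^sub>R (r *\<^sub>R D w))"
      by (simp add: scaleR_add_right)
    finally show ?thesis using r by simp
  qed
  have "norm w \<le> 0"
  proof (rule tendsto_lowerbound)
    show "((\<lambda>r. norm (r *\<^sub>R D w)) \<longlongrightarrow> 0) (at_right 0)"
      by (rule tendsto_eq_intros refl | simp)+
    show "\<forall>\<^sub>F r in at_right 0. norm w \<le> norm (r *\<^sub>R D w)"
      using * by (simp add: eventually_at_right_less eventually_mono[OF eventually_at_right_less])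
  qed simp
  then show ?thesis by (simp add: w_def)
qed

text \<open>The approximate half of the closed graph theorem. The sets \<open>E n\<close> cover the
  complete space \<open>S\<close>, so the closure of one of them contains a relative ball around
  some \<open>x0\<close>. Writing \<open>z\<close> as half the difference of \<open>x0 + z\<close>
  and \<open>x0 - z\<close> moves this ball to the origin, and scaling treats all vectors.\<close>

lemma baire_step:
  "\<exists>K\<ge>0. \<forall>z\<in>S. \<forall>\<epsilon>>0. \<exists>a\<in>S. norm (D a) \<le> K * norm z \<and> norm (z - a) < \<epsilon>"
proof -
  define E where "E n = {x \<in> S. norm (D x) \<le> real n}" for n
  have E_S: "closure (E n) \<subseteq> S" for n
    by (rule closure_minimal[OF _ closed_S]) (auto simp: E_def)
  have cm: "completely_metrizable_space (top_of_set S)"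
    using closed_S completely_metrizable_space_closedin completely_metrizable_space_euclidean closed_closedin by metis
  have "\<exists>n. (top_of_set S) interior_of (closure (E n)) \<noteq> {}"
  proof (rule ccontr)
    assume "\<not> ?thesis"
    then have "(top_of_set S) interior_of \<Union>(range (\<lambda>n. closure (E n))) = {}"
      by (intro Baire_category_alt) (use cm E_S in \<open>auto simp: closedin_closed_eq closed_S\<close>)
    moreover have "\<Union>(range (\<lambda>n. closure (E n))) = S"
    proof
      show "S \<subseteq> \<Union>(range (\<lambda>n. closure (E n)))"
      proof
        fix x assume x: "x \<in> S"
        obtain n where "norm (D x) \<le> real n" using real_arch_simple by blast
        with x have "x \<in> E n" by (simp add: E_def)
        then have "x \<in> closure (E n)" using closure_subset by blast
        then show "x \<in> \<Union>(range (\<lambda>n. closure (E n)))" by blast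
      qed
    qed (use E_S in auto)
    ultimately have "S = {}" using interior_of_topspace[of "top_of_set S"] by simp
    then show False using subspace_0[OF subspace_S] by simp
  qed
  then obtain n x0 where "x0 \<in> (top_of_set S) interior_of (closure (E n))" by blast
  then obtain U where U: "open U" "x0 \<in> S \<inter> U" "S \<inter> U \<subseteq> closure (E n)"
    unfolding interior_of_def openin_open by blast
  then obtain r where r: "r > 0" "ball x0 r \<subseteq> U" using openE by blast
  have 1: "\<exists>a\<in>S. norm (D a) \<le> real n \<and> norm (z - a) < \<epsilon>" if z: "z \<in> S" "norm z < r" and \<epsilon>: "0 < \<epsilon>" for z \<epsilon>
  proof -
    have "x0 + z \<in> closure (E n)" "x0 - z \<in> closure (E n)"
      using U r z by (auto simp: dist_norm subset_iff S_intros)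
    then obtain a b where ab: "a \<in> E n" "dist a (x0 + z) < \<epsilon>" "b \<in> E n" "dist b (x0 - z) < \<epsilon>"
      using \<epsilon> unfolding closure_approachable by metis
    then have S: "a \<in> S" "b \<in> S" by (auto simp: E_def)
    show ?thesis
    proof (intro bexI[of _ "(1/2) *\<^sub>R (a - b)"] conjI)
      show "(1/2) *\<^sub>R (a - b) \<in> S" using S by (intro S_intros)
      have "norm (D a - D b) \<le> real n + real n"
        using ab norm_triangle_ineq4[of "D a" "D b"] by (auto simp: E_def)
      then show "norm (D ((1/2) *\<^sub>R (a - b))) \<le> real n"
        using S by (simp add: D_scaleR D_diff S_intros)
      have "z - (1/2) *\<^sub>R (a - b) = (1/2) *\<^sub>R (((x0 + z) - a) - ((x0 - z) - b))"
        by (simp add: algebra_simps flip: scaleR_add_left)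
      also have "norm \<dots> < \<epsilon>"
        using ab norm_triangle_ineq4[of "(x0 + z) - a" "(x0 - z) - b"] by (simp add: dist_norm norm_minus_commute)
      finally show "norm (z - (1/2) *\<^sub>R (a - b)) < \<epsilon>" .
    qed
  qed
  show ?thesis
  proof (intro exI[of _ "2 * real n / r"] conjI ballI allI impI)
    show "0 \<le> 2 * real n / r" using r by simp
    fix z and \<epsilon> :: real assume z: "z \<in> S" and \<epsilon>: "0 < \<epsilon>"
    show "\<exists>a\<in>S. norm (D a) \<le> 2 * real n / r * norm z \<and> norm (z - a) < \<epsilon>"
    proof (cases "z = 0")
      case True
      then show ?thesis using \<epsilon> by (intro bexI[of _ 0]) (auto simp: D_0 S_intros)
    next
      case False
      \<comment> \<open>Chosen so that \<open>(1 / c) *\<^sub>R z\<close> has norm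
        \<open>r / 2\<close>, inside the ball.\<close>
      define c where "c = 2 * norm z / r"
      have c: "0 < c" using False r by (simp add: c_def)
      have "norm ((1 / c) *\<^sub>R z) < r" using c r False by (simp add: c_def)
      then obtain a where a: "a \<in> S" "norm (D a) \<le> real n" "norm ((1 / c) *\<^sub>R z - a) < \<epsilon> / c"
        using 1[of "(1/c) *\<^sub>R z" "\<epsilon> / c"] z \<epsilon> c by (auto simp: S_intros)
      show ?thesis
      proof (intro bexI[of _ "c *\<^sub>R a"] conjI)
        show "c *\<^sub>R a \<in> S" using a by (intro S_intros)
        have "norm (D (c *\<^sub>R a)) \<le> c * real n"
          using a c by (simp add: D_scaleR)
        then show "norm (D (c *\<^sub>R a)) \<le> 2 * real n / r * norm z"
          by (simp add: c_def mult_ac)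
        have "z - c *\<^sub>R a = c *\<^sub>R ((1 / c) *\<^sub>R z - a)" using c by (simp add: algebra_simps)
        then have "norm (z - c *\<^sub>R a) = c * norm ((1 / c) *\<^sub>R z - a)" using c by simp
        also have "\<dots> < \<epsilon>" using a(3) c by (simp add: field_simps)
        finally show "norm (z - c *\<^sub>R a) < \<epsilon>" .
      qed
    qed
  qed
qed

text \<open>Successive approximation writes \<open>z\<close> as a series of vectors
  \<open>a k\<close> whose images are bounded by \<open>K * norm z / 2 ^ k\<close>. The images are
  summable, and closedness of the graph identifies their sum with \<open>D z\<close>, with the bound
  \<open>2 * K\<close>.\<close>

theorem bounded_D: "\<exists>K\<ge>0. \<forall>x\<in>S. norm (D x) \<le> K * norm x"
proof -
  obtain K where K: "0 \<le> K" "\<And>z \<epsilon>. z \<in> S \<Longrightarrow> 0 < \<epsilon> \<Longrightarrow> \<exists>a\<in>S. norm (D a) \<le> K * norm z \<and> norm (z - a) < \<epsilon>"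
    using baire_step by blast
  then have "\<exists>f. \<forall>z \<epsilon>. z \<in> S \<longrightarrow> 0 < \<epsilon> \<longrightarrow> f z \<epsilon> \<in> S \<and> norm (D (f z \<epsilon>)) \<le> K * norm z \<and> norm (z - f z \<epsilon>) < \<epsilon>"
    by metis
  then obtain f where f: "\<And>z \<epsilon>. z \<in> S \<Longrightarrow> 0 < \<epsilon> \<Longrightarrow> f z \<epsilon> \<in> S"
     "\<And>z \<epsilon>. z \<in> S \<Longrightarrow> 0 < \<epsilon> \<Longrightarrow> norm (D (f z \<epsilon>)) \<le> K * norm z"
     "\<And>z \<epsilon>. z \<in> S \<Longrightarrow> 0 < \<epsilon> \<Longrightarrow> norm (z - f z \<epsilon>) < \<epsilon>" by blast
  have "norm (D z) \<le> (2 * K) * norm z" if z: "z \<in> S" for z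
  proof (cases "z = 0")
    case False
    define \<epsilon> where "\<epsilon> k = norm z * (1/2) ^ k" for k
    have \<epsilon>: "0 < \<epsilon> k" for k using False by (simp add: \<epsilon>_def)
    \<comment> \<open>\<open>v k\<close> is the remainder after subtracting the first
      \<open>k\<close> approximants; its norm is at most \<open>\<epsilon> k\<close>.\<close>
    define v where "v = rec_nat z (\<lambda>k u. u - f u (\<epsilon> (Suc k)))"
    define a where "a k = f (v k) (\<epsilon> (Suc k))" for k
    have v_Suc: "v (Suc k) = v k - a k" for k by (simp add: v_def a_def)
    have v_S: "v k \<in> S" for k
    proof (induction k)
      case 0 then show ?case using z by (simp add: v_def)
    next
      case (Suc k) then show ?case unfolding v_Suc a_def by (intro S_intros f \<epsilon>)
    qed
    have a_S: "a k \<in> S" for k unfolding a_def by (intro f v_S \<epsilon>)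
    have norm_v: "norm (v k) \<le> \<epsilon> k" for k
    proof (cases k)
      case 0 then show ?thesis by (simp add: v_def \<epsilon>_def)
    next
      case (Suc j) then show ?thesis using f(3)[OF v_S \<epsilon>, of j "Suc j"] by (simp add: v_Suc a_def)
    qed
    have norm_Da: "norm (D (a k)) \<le> K * \<epsilon> k" for k
      using f(2)[OF v_S \<epsilon>, of k "Suc k"] mult_left_mono[OF norm_v[of k] K(1)] by (simp add: a_def)
    have \<epsilon>_sums: "(\<lambda>k. K * \<epsilon> k) sums (K * (norm z * 2))"
      unfolding \<epsilon>_def using geometric_sums[of "1/2::real"] by (intro sums_mult) auto
    have summ: "summable (\<lambda>k. norm (D (a k)))"
      by (rule summable_comparison_test'[OF sums_summable[OF \<epsilon>_sums], of 0]) (simp add: norm_Da)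
    have sum_a: "(\<Sum>k<m. a k) = z - v m" for m
      by (induction m) (simp_all add: v_Suc, simp add: v_def)
    have "v \<longlonglongrightarrow> 0"
    proof (rule tendsto_0_le[where K=1 and f=\<epsilon>])
      show "\<epsilon> \<longlonglongrightarrow> 0" unfolding \<epsilon>_def by (intro tendsto_mult_right_zero LIMSEQ_realpow_zero) auto
      show "\<forall>\<^sub>F k in sequentially. norm (v k) \<le> norm (\<epsilon> k) * 1"
        using norm_v by (intro always_eventually) (smt (verit) \<epsilon> mult_1_right real_norm_def)
    qed
    then have "(\<lambda>m. \<Sum>k<m. a k) \<longlonglongrightarrow> z - 0" unfolding sum_a by (intro tendsto_intros)
    moreover have "(\<lambda>m. D (\<Sum>k<m. a k)) \<longlonglongrightarrow> (\<Sum>k. D (a k))"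
      using summable_LIMSEQ[OF summable_norm_cancel[OF summ]] by (simp add: D_sum a_S)
    ultimately have "D z = (\<Sum>k. D (a k))"
      using closed_graph[of "\<lambda>m. \<Sum>k<m. a k" z] by (simp add: S_intros a_S)
    also have "norm \<dots> \<le> (\<Sum>k. K * \<epsilon> k)"
      by (rule order_trans[OF summable_norm[OF summ]])
         (intro suminf_le norm_Da summ sums_summable[OF \<epsilon>_sums])
    also have "\<dots> = K * (norm z * 2)" using sums_unique[OF \<epsilon>_sums] by simp
    finally show ?thesis by (simp add: mult_ac)
  qed (simp add: D_0)
  then show ?thesis using K(1) by (intro exI[of _ "2 * K"]) auto
qed

section \<open>Exponentials and stability of the evolution equation\<close>

definition exp_op :: "real \<Rightarrow> 'a \<Rightarrow> 'a" where
  "exp_op t x = (\<Sum>n. (t ^ n / fact n) *\<^sub>R ((D ^^ n) x))"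

lemma pow_S: "x \<in> S \<Longrightarrow> (D ^^ n) x \<in> S"
  by (induction n) (auto intro: D_S)

lemma pow_add: "x \<in> S \<Longrightarrow> y \<in> S \<Longrightarrow> (D ^^ n) (x + y) = (D ^^ n) x + (D ^^ n) y"
  by (induction n) (auto simp: D_add pow_S)

lemma pow_diff: "x \<in> S \<Longrightarrow> y \<in> S \<Longrightarrow> (D ^^ n) (x - y) = (D ^^ n) x - (D ^^ n) y"
  by (induction n) (auto simp: D_diff pow_S)

lemma summable_pow:
  assumes "x \<in> S"
  shows "summable (\<lambda>n. \<bar>t\<bar> ^ n / fact n * norm ((D ^^ n) x))"
proof -
  obtain K where K: "0 \<le> K" "\<And>x. x \<in> S \<Longrightarrow> norm (D x) \<le> K * norm x" using bounded_D by blast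
  have pow: "norm ((D ^^ n) x) \<le> K ^ n * norm x" for n
  proof (induction n)
    case (Suc n)
    have "norm ((D ^^ Suc n) x) \<le> K * norm ((D ^^ n) x)" using K(2) pow_S[OF assms] by simp
    with mult_left_mono[OF Suc K(1)] show ?case by (simp add: mult.assoc)
  qed simp
  have summ: "summable (\<lambda>n. inverse (fact n) * (\<bar>t\<bar> * K) ^ n * norm x)"
    by (intro summable_mult2 summable_exp)
  show ?thesis
    by (rule summable_comparison_test'[OF summ, of 0])
       (use mult_left_mono[OF pow, of "\<bar>t\<bar> ^ n / fact n" for n] in
         \<open>simp add: power_mult_distrib divide_inverse mult_ac\<close>)
qed

lemma summable_exp_op:
  assumes "x \<in> S"
  shows "summable (\<lambda>n. (t ^ n / fact n) *\<^sub>R ((D ^^ n) x))"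
  by (rule summable_norm_cancel) (use summable_pow[OF assms, of t] in \<open>simp add: power_abs\<close>)

lemma exp_op_S: "x \<in> S \<Longrightarrow> exp_op t x \<in> S"
  unfolding exp_op_def
  by (rule closed_sequentially[OF closed_S _ summable_LIMSEQ[OF summable_exp_op]])
     (auto intro!: S_intros pow_S)

lemma exp_op_D:
  assumes x: "x \<in> S"
  shows "D (exp_op t x) = exp_op t (D x)"
proof -
  have "(\<lambda>m. D (\<Sum>n<m. (t ^ n / fact n) *\<^sub>R ((D ^^ n) x))) = (\<lambda>m. \<Sum>n<m. (t ^ n / fact n) *\<^sub>R ((D ^^ n) (D x)))"
    using x by (simp add: D_sum D_scaleR pow_S S_intros) (simp add: funpow_swap1)
  moreover have "(\<lambda>m. \<Sum>n<m. (t ^ n / fact n) *\<^sub>R ((D ^^ n) (D x))) \<longlonglongrightarrow> exp_op t (D x)"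
    unfolding exp_op_def by (intro summable_LIMSEQ summable_exp_op D_S x)
  ultimately have "D (\<Sum>n. (t ^ n / fact n) *\<^sub>R ((D ^^ n) x)) = exp_op t (D x)"
    by (intro closed_graph[OF summable_LIMSEQ[OF summable_exp_op[OF x, of t]]])
       (auto simp: S_intros pow_S x)
  then show ?thesis unfolding exp_op_def[of t x] .
qed

lemma exp_op_has_vector_derivative:
  assumes "x \<in> S"
  shows "((\<lambda>t. exp_op t x) has_vector_derivative D (exp_op t x)) (at t within T)"
proof -
  \<comment> \<open>One more than \<open>\<bar>t\<bar>\<close>, so that \<open>t\<close> is an
    interior point of the interval.\<close>
  define R where "R = \<bar>t\<bar> + 1"
  have "((\<lambda>s. \<Sum>n. (s ^ n / fact n) *\<^sub>R (D ^^ n) x) has_vector_derivative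
    (\<Sum>n. (t ^ n / fact n) *\<^sub>R (D ^^ Suc n) x)) (at t within {-R..R})"
  proof (rule vector_power_series_has_vector_derivative)
    show "summable (\<lambda>n. R ^ n / fact n * norm ((D ^^ n) x))"
      using summable_pow[OF assms, of R] by (simp add: R_def)
    show "summable (\<lambda>n. R ^ n / fact n * norm ((D ^^ Suc n) x))"
      using summable_pow[OF D_S[OF assms], of R] by (simp add: R_def funpow_swap1)
  qed (auto simp: R_def)
  moreover have "(\<Sum>n. (t ^ n / fact n) *\<^sub>R (D ^^ Suc n) x) = D (exp_op t x)"
    by (subst exp_op_D[OF assms]) (simp add: exp_op_def funpow_swap1)
  moreover have "at t within {-R..R} = at t"
    by (rule at_within_interior) (auto simp: R_def interior_atLeastAtMost_real)
  ultimately show ?thesis unfolding exp_op_def[symmetric]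
    by (auto intro: has_vector_derivative_at_within)
qed

lemma exp_op_0 [simp]: "exp_op 0 x = x"
proof -
  have "exp_op 0 x = (\<Sum>n\<in>{0}. (0 ^ n / fact n) *\<^sub>R ((D ^^ n) x))"
    unfolding exp_op_def by (rule suminf_finite) auto
  then show ?thesis by simp
qed

lemma exp_op_add: "x \<in> S \<Longrightarrow> y \<in> S \<Longrightarrow> exp_op t (x + y) = exp_op t x + exp_op t y"
  unfolding exp_op_def by (simp add: pow_add scaleR_add_right suminf_add summable_exp_op)

lemma exp_op_diff: "x \<in> S \<Longrightarrow> y \<in> S \<Longrightarrow> exp_op t (x - y) = exp_op t x - exp_op t y"
  unfolding exp_op_def by (simp add: pow_diff scaleR_diff_right suminf_diff summable_exp_op)

lemma exp_op_commute:
  assumes "bounded_linear B" "\<And>y. y \<in> S \<Longrightarrow> D (B y) = B (D y)" "x \<in> S"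
  shows "exp_op t (B x) = B (exp_op t x)"
proof -
  have "(D ^^ n) (B x) = B ((D ^^ n) x)" for n
    by (induction n) (auto simp: assms pow_S)
  then show ?thesis unfolding exp_op_def
    by (simp add: bounded_linear.suminf[OF assms(1) summable_exp_op[OF assms(3)]]
        linear_scale[OF bounded_linear.linear[OF assms(1)]])
qed

text \<open>The difference between the exact and the approximate solution solves the equation up to
  the defect \<open>e\<close>. Dissipativity allows no growth, so the error is \<open>e * t\<close>,
  with no exponential of the norm of \<open>D\<close>. This is the estimate that is uniform over all
  volumes.\<close>

lemma approximate_solution:
  assumes t: "0 \<le> t"
    and p: "\<And>s. 0 \<le> s \<Longrightarrow> s \<le> t \<Longrightarrow> p s \<in> S"
    and deriv: "\<And>s. 0 \<le> s \<Longrightarrow> s \<le> t \<Longrightarrow> (p has_vector_derivative p' s) (at s within {0..t})"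
    and close: "\<And>s. 0 \<le> s \<Longrightarrow> s \<le> t \<Longrightarrow> norm (p' s - D (p s)) \<le> e"
  shows "norm (exp_op t (p 0) - p t) \<le> e * t"
proof -
  have p0: "p 0 \<in> S" using p t by simp
  have "norm (exp_op t (p 0) - p t) \<le> norm (exp_op 0 (p 0) - p 0) + e * t"
  proof (rule norm_le_of_vector_derivative[OF t])
    fix s assume s: "0 \<le> s" "s \<le> t"
    show "((\<lambda>s. exp_op s (p 0) - p s) has_vector_derivative (D (exp_op s (p 0)) - p' s)) (at s within {0..t})"
      by (intro has_vector_derivative_diff exp_op_has_vector_derivative p0 deriv s)
    have eq: "D (exp_op s (p 0) - p s) = D (exp_op s (p 0)) - D (p s)"
      by (intro D_diff exp_op_S p0 p s)
    show "norm (exp_op s (p 0) - p s) \<le> norm (exp_op s (p 0) - p s - h *\<^sub>R D (exp_op s (p 0) - p s))" for h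
      using dissipative[of "exp_op s (p 0) - p s" "-h"] by (simp add: S_intros exp_op_S p0 p s)
    show "norm (D (exp_op s (p 0)) - p' s - D (exp_op s (p 0) - p s)) \<le> e"
      unfolding eq using close[OF s] by (simp add: norm_minus_commute)
  qed
  then show ?thesis by simp
qed

lemma norm_exp_op_le: "x \<in> S \<Longrightarrow> 0 \<le> t \<Longrightarrow> norm (exp_op t x) \<le> norm x"
  using norm_le_of_vector_derivative[where p="\<lambda>t. exp_op t x" and z="\<lambda>t. D (exp_op t x)" and e=0,
      OF _ exp_op_has_vector_derivative] dissipative[OF exp_op_S, of x _ "- h" for h]
  by simp

lemma norm_exp_op_minus_id_le:
  assumes "x \<in> S" "0 \<le> t"
  shows "norm (exp_op t x - x) \<le> norm (D x) * t"
  by (rule approximate_solution[where p="\<lambda>_. x" and p'="\<lambda>_. 0"]) (use assms in auto)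

text \<open>Uniqueness instead of multiplying series: the shifted orbit is a solution with defect 0
  starting at \<open>exp_op t x\<close>.\<close>

lemma exp_op_plus:
  assumes "x \<in> S" "0 \<le> s" "0 \<le> t"
  shows "exp_op (s + t) x = exp_op s (exp_op t x)"
proof -
  have "norm (exp_op s (exp_op (0 + t) x) - exp_op (s + t) x) \<le> 0 * s"
  proof (rule approximate_solution[where p="\<lambda>u. exp_op (u + t) x" and p'="\<lambda>u. D (exp_op (u + t) x)"])
    fix u
    have "((\<lambda>u. exp_op u x) \<circ> (\<lambda>u. u + t) has_vector_derivative (1 *\<^sub>R D (exp_op (u + t) x))) (at u within {0..s})"
      by (rule vector_diff_chain_within)
         (auto intro!: derivative_eq_intros exp_op_has_vector_derivative assms)
    then show "((\<lambda>u. exp_op (u + t) x) has_vector_derivative D (exp_op (u + t) x)) (at u within {0..s})"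
      by (simp add: o_def)
  qed (use assms in \<open>auto intro: exp_op_S\<close>)
  then show ?thesis by simp
qed

lemma norm_exp_op_first_order:
  assumes "x \<in> S" "0 \<le> t" "\<And>s. 0 \<le> s \<Longrightarrow> s \<le> t \<Longrightarrow> norm (exp_op s (D x) - D x) \<le> e"
  shows "norm (exp_op t x - x - t *\<^sub>R D x) \<le> e * t"
proof -
  have "norm (exp_op t x - x - t *\<^sub>R D x) \<le> norm (exp_op 0 x - x - 0 *\<^sub>R D x) + e * t"
  proof (rule norm_le_of_vector_derivative[where z="\<lambda>_. 0", OF assms(2)])
    fix s assume s: "0 \<le> s" "s \<le> t"
    show "((\<lambda>s. exp_op s x - x - s *\<^sub>R D x) has_vector_derivative (D (exp_op s x) - D x)) (at s within {0..t})"
      by (auto intro!: derivative_eq_intros exp_op_has_vector_derivative assms)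
    show "norm (D (exp_op s x) - D x - 0) \<le> e"
      using assms(3)[OF s] by (simp add: exp_op_D assms)
  qed simp
  then show ?thesis by simp
qed

end

section \<open>Limits of nets of dissipative operators\<close>

lemma eventually_netF_finite: "\<forall>\<^sub>F L in netF. finite L"
  by (rule eventually_finite_subsets_at_top_weakI)

lemma eventually_netF_superset: "finite L0 \<Longrightarrow> \<forall>\<^sub>F L in netF. finite L \<and> L0 \<subseteq> L"
  unfolding eventually_finite_subsets_at_top by blast

lemma netlim_eqI: "(a \<longlongrightarrow> l) netF \<Longrightarrow> netlim a = l"
  unfolding netlim_def by (rule tendsto_Lim) auto

lemma conv_net_tendsto: "conv_net a \<Longrightarrow> (a \<longlongrightarrow> netlim a) netF"
  unfolding conv_net_def using netlim_eqI by blast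

text \<open>The comparison net and its limit may change with \<open>\<epsilon>\<close>, so only the
  Cauchy property follows; completeness supplies the limit.\<close>

lemma conv_net_approxI:
  fixes f :: "(int^'d) set \<Rightarrow> 'a::complete_space"
  assumes "\<And>\<epsilon>. 0 < \<epsilon> \<Longrightarrow> \<exists>b. conv_net b \<and> (\<forall>\<^sub>F L in netF. dist (f L) (b L) < \<epsilon>)"
  shows "conv_net f"
proof -
  have "cauchy_filter (filtermap f netF)"
    unfolding cauchy_filter_metric_filtermap
  proof (intro allI impI)
    fix \<epsilon> :: real assume "0 < \<epsilon>"
    then obtain b where b: "conv_net b" "\<forall>\<^sub>F L in netF. dist (f L) (b L) < \<epsilon> / 4"
      using assms[of "\<epsilon> / 4"] by auto
    have "\<forall>\<^sub>F L in netF. dist (b L) (netlim b) < \<epsilon> / 4"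
      using conv_net_tendsto[OF b(1)] \<open>0 < \<epsilon>\<close> by (intro tendstoD) auto
    with b(2) have "\<forall>\<^sub>F L in netF. dist (f L) (netlim b) < \<epsilon> / 2"
    proof eventually_elim
      case (elim L)
      then show ?case using dist_triangle[of "f L" "netlim b" "b L"] by linarith
    qed
    moreover have "dist (f L) (f M) < \<epsilon>" if "dist (f L) (netlim b) < \<epsilon> / 2" "dist (f M) (netlim b) < \<epsilon> / 2" for L M
      using that dist_triangle_half_l[of "f L" "netlim b" \<epsilon> "f M"] by blast
    ultimately show "\<exists>P. eventually P netF \<and> (\<forall>x y. P x \<and> P y \<longrightarrow> dist (f x) (f y) < \<epsilon>)"
      by (intro exI[of _ "\<lambda>L. dist (f L) (netlim b) < \<epsilon> / 2"]) auto
  qed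
  then have "\<exists>c. filtermap f netF \<le> nhds c"
    by (rule cauchy_filter_complete_converges[OF _ complete_UNIV]) (auto simp: filtermap_bot_iff)
  then show ?thesis unfolding conv_net_def filterlim_def .
qed

text \<open>Choosing at each \<open>L\<close> a point whose distance to \<open>q\<close> is minimal
  up to \<open>1 / (card L + 1)\<close> makes one selection serve all \<open>\<epsilon>\<close> at
  once. The slack vanishes along the net because \<open>L\<close> eventually contains a set of any
  prescribed cardinality.\<close>

lemma net_selection:
  fixes C :: "(int^'d) set \<Rightarrow> 'b::metric_space set"
  assumes near: "\<And>\<epsilon>. 0 < \<epsilon> \<Longrightarrow> \<forall>\<^sub>F L in netF. \<exists>p\<in>C L. dist q p < \<epsilon>"
    and nonempty: "\<And>L. finite L \<Longrightarrow> C L \<noteq> {}"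
  shows "\<exists>p. (\<forall>L. finite L \<longrightarrow> p L \<in> C L) \<and> (p \<longlongrightarrow> q) netF"
proof -
  have "\<exists>p\<in>C L. dist q p < infdist q (C L) + 1 / (real (card L) + 1)" if "finite L" for L
  proof -
    have "(INF p\<in>C L. dist q p) < infdist q (C L) + 1 / (real (card L) + 1)"
      using nonempty[OF that] by (simp add: infdist_def)
    then show ?thesis
      using nonempty[OF that] by (subst (asm) cINF_less_iff) (auto simp: bdd_below_def intro!: exI[of _ 0])
  qed
  then obtain p where p: "\<And>L. finite L \<Longrightarrow> p L \<in> C L"
      "\<And>L. finite L \<Longrightarrow> dist q (p L) < infdist q (C L) + 1 / (real (card L) + 1)"
    by metis
  have "(p \<longlongrightarrow> q) netF"
  proof (rule tendstoI)
    fix \<epsilon> :: real assume \<epsilon>: "0 < \<epsilon>"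
    obtain N where N: "inverse (of_nat (Suc N)) < \<epsilon> / 2" using reals_Archimedean[of "\<epsilon> / 2"] \<epsilon> by auto
    obtain L0 :: "(int^'d) set" where L0: "finite L0" "card L0 = N"
      using infinite_arbitrarily_large[OF infinite_UNIV_char_0] by blast
    have "\<forall>\<^sub>F L in netF. \<exists>p\<in>C L. dist q p < \<epsilon> / 2" using near[of "\<epsilon> / 2"] \<epsilon> by linarith
    with eventually_netF_superset[OF L0(1)] show "\<forall>\<^sub>F L in netF. dist (p L) q < \<epsilon>"
    proof eventually_elim
      case (elim L)
      then obtain p' where "p' \<in> C L" "dist q p' < \<epsilon> / 2" by blast
      then have "infdist q (C L) < \<epsilon> / 2" using infdist_le[of p' "C L" q] by simp
      moreover have "N \<le> card L" using elim L0 card_mono by metis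
      then have "1 / (real (card L) + 1) \<le> inverse (of_nat (Suc N))"
        by (simp add: field_simps)
      ultimately show ?case using p(2)[of L] elim N by (simp add: dist_commute)
    qed
  qed
  with p(1) show ?thesis by blast
qed

locale dissipative_net =
  fixes X :: "(int^'d) set \<Rightarrow> 'a::banach set" and A :: "(int^'d) set \<Rightarrow> 'a \<Rightarrow> 'a"
  assumes dissipative_operator: "finite L \<Longrightarrow> dissipative_operator (X L) (A L)"
    and X_mono: "finite L' \<Longrightarrow> L \<subseteq> L' \<Longrightarrow> X L \<subseteq> X L'"
    and conv_A: "a \<in> qlD X \<Longrightarrow> conv_net (\<lambda>L. A L a)"
begin

definition G0 :: "('a \<times> 'a) set" where
  "G0 = {(a, netlim (\<lambda>L. A L a)) | a. a \<in> qlD X}"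

abbreviation GI :: "('a \<times> 'a) set" where
  "GI \<equiv> limit_graph X A"

definition local_net :: "((int^'d) set \<Rightarrow> 'a) \<Rightarrow> bool" where
  "local_net a \<longleftrightarrow> (\<forall>L. finite L \<longrightarrow> a L \<in> X L)"

lemma GI_I: "local_net a \<Longrightarrow> (a \<longlongrightarrow> x) netF \<Longrightarrow> ((\<lambda>L. A L (a L)) \<longlongrightarrow> y) netF \<Longrightarrow> (x, y) \<in> GI"
  unfolding limit_graph_def local_net_def
  using netlim_eqI[of a x] netlim_eqI[of "\<lambda>L. A L (a L)" y] by (auto simp: conv_net_def)

lemma GI_E:
  assumes "(x, y) \<in> GI"
  obtains a where "local_net a" "(a \<longlongrightarrow> x) netF" "((\<lambda>L. A L (a L)) \<longlongrightarrow> y) netF"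
  using assms unfolding limit_graph_def local_net_def by (auto dest: conv_net_tendsto)

lemma eventually_local: "local_net a \<Longrightarrow> \<forall>\<^sub>F L in netF. finite L \<and> a L \<in> X L"
  using eventually_netF_finite unfolding local_net_def by (auto elim: eventually_mono)

lemma eventually_qlD: "a \<in> qlD X \<Longrightarrow> \<forall>\<^sub>F L in netF. finite L \<and> a \<in> X L"
  unfolding qlD_def by (auto elim!: eventually_mono[OF eventually_netF_superset] dest: X_mono)

lemma subspace_X: "finite L \<Longrightarrow> subspace (X L)"
  by (rule dissipative_operator.subspace_S[OF dissipative_operator])

lemma zero_X: "finite L \<Longrightarrow> 0 \<in> X L"
  by (rule subspace_0[OF subspace_X])

lemma subspace_qlD: "subspace (qlD X)"
proof (rule subspaceI)
  show "0 \<in> qlD X" using zero_X[of "{}"] by (auto simp: qlD_def)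
  fix x y assume "x \<in> qlD X" "y \<in> qlD X"
  then obtain L M where "finite L" "x \<in> X L" "finite M" "y \<in> X M" by (auto simp: qlD_def)
  moreover from this have "x \<in> X (L \<union> M)" "y \<in> X (L \<union> M)"
    using X_mono[of "L \<union> M" L] X_mono[of "L \<union> M" M] by auto
  ultimately show "x + y \<in> qlD X"
    by (auto simp: qlD_def intro!: exI[of _ "L \<union> M"] subspace_add[OF subspace_X])
next
  fix c x assume "x \<in> qlD X"
  then show "c *\<^sub>R x \<in> qlD X"
    by (auto simp: qlD_def intro: subspace_scale[OF subspace_X])
qed

lemma tendsto_netlim_A: "a \<in> qlD X \<Longrightarrow> ((\<lambda>L. A L a) \<longlongrightarrow> netlim (\<lambda>L. A L a)) netF"
  using conv_net_tendsto[OF conv_A] .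

text \<open>The constant net \<open>a\<close> need not lie in \<open>X L\<close> for small
  \<open>L\<close>. The default 0 belongs to every \<open>X L\<close> and is eventually replaced by
  \<open>a\<close>.\<close>

definition const_net :: "'a \<Rightarrow> (int^'d) set \<Rightarrow> 'a" where
  "const_net a L = (if a \<in> X L then a else 0)"

lemma local_const_net: "local_net (const_net a)"
  by (auto simp: local_net_def const_net_def zero_X)

lemma eventually_const_net: "a \<in> qlD X \<Longrightarrow> \<forall>\<^sub>F L in netF. const_net a L = a"
  by (drule eventually_qlD, erule eventually_mono) (simp add: const_net_def)

lemma const_net_tendsto: "a \<in> qlD X \<Longrightarrow> (const_net a \<longlongrightarrow> a) netF"
  by (rule tendsto_eventually[OF eventually_const_net])

lemma A_const_net_tendsto:
  "a \<in> qlD X \<Longrightarrow> ((\<lambda>L. A L (const_net a L)) \<longlongrightarrow> netlim (\<lambda>L. A L a)) netF"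
  by (rule Lim_transform_eventually[OF tendsto_netlim_A])
     (auto intro: eventually_mono[OF eventually_const_net])

lemma G0_GI: "G0 \<subseteq> GI"
  unfolding G0_def using GI_I[OF local_const_net const_net_tendsto A_const_net_tendsto] by auto

lemma local_net_add: "local_net a \<Longrightarrow> local_net b \<Longrightarrow> local_net (\<lambda>L. a L + b L)"
  and local_net_scaleR: "local_net a \<Longrightarrow> local_net (\<lambda>L. r *\<^sub>R a L)"
  unfolding local_net_def
  by (auto intro: subspace_add[OF subspace_X] subspace_scale[OF subspace_X])

lemma local_net_limit:
  assumes "local_net a" "(a \<longlongrightarrow> x) netF"
  shows "x \<in> qlA X"
  unfolding qlA_def
proof (rule Lim_in_closed_set[OF closed_closure _ _ assms(2)])
  show "\<forall>\<^sub>F L in netF. a L \<in> closure (qlD X)"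
    using eventually_local[OF assms(1)]
    by eventually_elim (auto simp: qlD_def intro!: subsetD[OF closure_subset])
qed simp

lemma qlA_local_net:
  assumes "x \<in> qlA X"
  obtains a where "local_net a" "(a \<longlongrightarrow> x) netF"
proof -
  have "\<exists>a. (\<forall>L. finite L \<longrightarrow> a L \<in> X L) \<and> (a \<longlongrightarrow> x) netF"
  proof (rule net_selection)
    fix \<epsilon> :: real assume "0 < \<epsilon>"
    then obtain d where d: "d \<in> qlD X" "dist d x < \<epsilon>"
      using assms unfolding qlA_def closure_approachable by blast
    from eventually_qlD[OF d(1)] show "\<forall>\<^sub>F L in netF. \<exists>p\<in>X L. dist x p < \<epsilon>"
      by eventually_elim (use d(2) in \<open>auto simp: dist_commute\<close>)
  qed (use zero_X in auto)
  then show ?thesis using that unfolding local_net_def by blast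
qed

lemma subspace_GI: "subspace GI"
proof (rule subspaceI)
  show "0 \<in> GI" unfolding zero_prod_def
    by (rule GI_I[of "\<lambda>_. 0"])
       (auto simp: local_net_def zero_X intro!: tendsto_eventually eventually_mono[OF eventually_netF_finite]
          dissipative_operator.D_0[OF dissipative_operator])
  fix p q assume "p \<in> GI" "q \<in> GI"
  then obtain x y x' y' where pq: "p = (x, y)" "q = (x', y')" "(x, y) \<in> GI" "(x', y') \<in> GI"
    by (metis surj_pair)
  obtain a where a: "local_net a" "(a \<longlongrightarrow> x) netF" "((\<lambda>L. A L (a L)) \<longlongrightarrow> y) netF" using GI_E[OF pq(3)] .
  obtain b where b: "local_net b" "(b \<longlongrightarrow> x') netF" "((\<lambda>L. A L (b L)) \<longlongrightarrow> y') netF" using GI_E[OF pq(4)] .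
  have "\<forall>\<^sub>F L in netF. A L (a L) + A L (b L) = A L (a L + b L)"
    using eventually_local[OF a(1)] eventually_local[OF b(1)]
    by eventually_elim (simp add: dissipative_operator.D_add[OF dissipative_operator])
  then have "((\<lambda>L. A L (a L + b L)) \<longlongrightarrow> y + y') netF"
    by (rule Lim_transform_eventually[OF tendsto_add[OF a(3) b(3)]])
  then show "p + q \<in> GI" unfolding pq add_Pair
    using GI_I[OF local_net_add[OF a(1) b(1)] tendsto_add[OF a(2) b(2)]] by blast
next
  fix c p assume "p \<in> GI"
  then obtain x y where p: "p = (x, y)" "(x, y) \<in> GI" by (metis surj_pair)
  obtain a where a: "local_net a" "(a \<longlongrightarrow> x) netF" "((\<lambda>L. A L (a L)) \<longlongrightarrow> y) netF" using GI_E[OF p(2)] .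
  have "\<forall>\<^sub>F L in netF. c *\<^sub>R A L (a L) = A L (c *\<^sub>R a L)"
    using eventually_local[OF a(1)]
    by eventually_elim (simp add: dissipative_operator.D_scaleR[OF dissipative_operator])
  then have "((\<lambda>L. A L (c *\<^sub>R a L)) \<longlongrightarrow> c *\<^sub>R y) netF"
    by (rule Lim_transform_eventually[OF tendsto_scaleR[OF tendsto_const a(3)]])
  then show "c *\<^sub>R p \<in> GI" unfolding p scaleR_Pair
    using GI_I[OF local_net_scaleR[OF a(1)] tendsto_scaleR[OF tendsto_const a(2)]] by blast
qed

text \<open>Perturbing a null sequence of the net by \<open>r v\<close> and letting first the net and then
  \<open>r\<close> converge turns dissipativity into \<open>\<parallel>v\<parallel> \<le> \<parallel>v - w\<parallel>\<close> for all \<open>v\<close> in a dense set.\<close>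
lemma GI_zero:
  assumes "(0, w) \<in> GI"
  shows "w = 0"
proof -
  obtain a where a: "local_net a" "(a \<longlongrightarrow> 0) netF" "((\<lambda>L. A L (a L)) \<longlongrightarrow> w) netF" using GI_E[OF assms] .
  have *: "norm v \<le> norm (v - w)" if v: "v \<in> qlD X" for v
  proof -
    define v' where "v' = netlim (\<lambda>L. A L v)"
    have v': "((\<lambda>L. A L v) \<longlongrightarrow> v') netF" unfolding v'_def using tendsto_netlim_A[OF v] .
    have "norm v \<le> norm (v - w - r *\<^sub>R v')" if r: "0 < r" for r
    proof -
      have "norm (0 + r *\<^sub>R v) \<le> norm (0 + r *\<^sub>R v - r *\<^sub>R (w + r *\<^sub>R v'))"
      proof (rule tendsto_le[of netF])
        show "((\<lambda>L. norm (a L + r *\<^sub>R v)) \<longlongrightarrow> norm (0 + r *\<^sub>R v)) netF"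
          by (intro tendsto_intros a)
        show "((\<lambda>L. norm (a L + r *\<^sub>R v - r *\<^sub>R (A L (a L) + r *\<^sub>R A L v))) \<longlongrightarrow>
            norm (0 + r *\<^sub>R v - r *\<^sub>R (w + r *\<^sub>R v'))) netF"
          by (intro tendsto_intros a v')
        show "\<forall>\<^sub>F L in netF. norm (a L + r *\<^sub>R v) \<le> norm (a L + r *\<^sub>R v - r *\<^sub>R (A L (a L) + r *\<^sub>R A L v))"
          using eventually_local[OF a(1)] eventually_qlD[OF v]
        proof eventually_elim
          case (elim L)
          interpret dissipative_operator "X L" "A L" using dissipative_operator elim by blast
          show ?case
            using dissipative[of "a L + r *\<^sub>R v" "-r"] elim by (simp add: D_add D_scaleR S_intros)
        qed
      qed simp
      also have "0 + r *\<^sub>R v - r *\<^sub>R (w + r *\<^sub>R v') = r *\<^sub>R (v - w - r *\<^sub>R v')"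
        by (simp add: algebra_simps)
      finally show ?thesis using r by simp
    qed
    then have "\<forall>\<^sub>F r in at_right 0. norm v \<le> norm (v - w - r *\<^sub>R v')"
      by (intro eventually_mono[OF eventually_at_right_less])
    moreover have "((\<lambda>r. norm (v - w - r *\<^sub>R v')) \<longlongrightarrow> norm (v - w - 0 *\<^sub>R v')) (at_right 0)"
      by (intro tendsto_intros)
    ultimately have "norm v \<le> norm (v - w - 0 *\<^sub>R v')"
      by (intro tendsto_lowerbound[where F="at_right 0"]) auto
    then show ?thesis by simp
  qed
  have "local_net (\<lambda>L. A L (a L))"
    using a(1) dissipative_operator.D_S[OF dissipative_operator] by (auto simp: local_net_def)
  then have w: "w \<in> closure (qlD X)" using local_net_limit[OF _ a(3)] by (simp add: qlA_def)
  \<comment> \<open>\<open>w\<close> is itself a limit of local elements, so \<open>v\<close> may be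
    taken close to \<open>w\<close>; then \<open>norm v \<le> norm (v - w)\<close> forces
    \<open>w\<close> to be small.\<close>
  have "norm w \<le> 0 + \<epsilon>" if \<epsilon>: "0 < \<epsilon>" for \<epsilon>
  proof -
    obtain v where "v \<in> qlD X" "dist v w < \<epsilon> / 2"
      using w \<epsilon> unfolding closure_approachable by (meson half_gt_zero)
    then show ?thesis using *[of v] norm_triangle_ineq2[of w v] by (simp add: dist_norm norm_minus_commute)
  qed
  then show ?thesis using field_le_epsilon[of "norm w" 0] by simp
qed

theorem well_defined_GI: "well_defined GI"
  unfolding well_defined_def
  using subspace_diff[OF subspace_GI] GI_zero by fastforce

text \<open>Here \<open>net_selection\<close> is applied in the product space to the finite volume
  graphs. A selected pair is automatically of the form \<open>(a, A L a)\<close>, so a net of pairs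
  converging to \<open>q\<close> is exactly a witness for membership in the limit graph.\<close>

theorem closed_GI: "closed GI"
proof -
  have "q \<in> GI" if q: "q \<in> closure GI" for q
  proof -
    have "\<exists>p. (\<forall>L. finite L \<longrightarrow> p L \<in> {(a, A L a) | a. a \<in> X L}) \<and> (p \<longlongrightarrow> q) netF"
    proof (rule net_selection)
      fix \<epsilon> :: real assume \<epsilon>: "0 < \<epsilon>"
      obtain x y where xy: "(x, y) \<in> GI" "dist (x, y) q < \<epsilon> / 2"
        using q \<epsilon> unfolding closure_approachable by (metis half_gt_zero surj_pair)
      obtain a where a: "local_net a" "(a \<longlongrightarrow> x) netF" "((\<lambda>L. A L (a L)) \<longlongrightarrow> y) netF" using GI_E[OF xy(1)] .
      have "\<forall>\<^sub>F L in netF. dist (a L, A L (a L)) (x, y) < \<epsilon> / 2"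
        using tendsto_Pair[OF a(2,3)] \<epsilon> by (intro tendstoD) auto
      with eventually_local[OF a(1)]
      show "\<forall>\<^sub>F L in netF. \<exists>p\<in>{(a, A L a) | a. a \<in> X L}. dist q p < \<epsilon>"
      proof eventually_elim
        case (elim L)
        then have "dist q (a L, A L (a L)) < \<epsilon>"
          using xy(2) dist_triangle_half_r[of "(x,y)" q \<epsilon> "(a L, A L (a L))"] by (simp add: dist_commute)
        with elim show ?case by blast
      qed
    qed (use zero_X in auto)
    then obtain p where p: "\<And>L. finite L \<Longrightarrow> \<exists>a\<in>X L. p L = (a, A L a)" "(p \<longlongrightarrow> q) netF" by fast
    have "((\<lambda>L. A L (fst (p L))) \<longlongrightarrow> snd q) netF"
      by (rule Lim_transform_eventually[OF tendsto_snd[OF p(2)]])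
         (auto intro!: eventually_mono[OF eventually_netF_finite] dest: p(1))
    then have "(fst q, snd q) \<in> GI"
      by (intro GI_I[of "\<lambda>L. fst (p L)"] tendsto_fst p(2)) (auto simp: local_net_def dest: p(1))
    then show ?thesis by simp
  qed
  then show ?thesis using closure_subset_eq by blast
qed

end

section \<open>Analytic vectors and the limit semigroup\<close>

lemma subspace_closure:
  fixes S :: "'a::real_normed_vector set"
  assumes "subspace S"
  shows "subspace (closure S)"
proof (rule subspaceI)
  show "0 \<in> closure S" using subspace_0[OF assms] closure_subset by blast
  fix x y assume "x \<in> closure S" "y \<in> closure S"
  then obtain f g where "\<And>n. f n \<in> S" "f \<longlonglongrightarrow> x" "\<And>n. g n \<in> S" "g \<longlonglongrightarrow> y"
    unfolding closure_sequential by blast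
  then show "x + y \<in> closure S" unfolding closure_sequential
    by (intro exI[of _ "\<lambda>n. f n + g n"] conjI allI subspace_add[OF assms] tendsto_add) auto
next
  fix c x assume "x \<in> closure S"
  then obtain f where "\<And>n. f n \<in> S" "f \<longlonglongrightarrow> x" unfolding closure_sequential by blast
  then show "c *\<^sub>R x \<in> closure S" unfolding closure_sequential
    by (intro exI[of _ "\<lambda>n. c *\<^sub>R f n"] conjI allI subspace_scale[OF assms] tendsto_scaleR tendsto_const) auto
qed

lemma norm_add3_le: "norm (x + y + z) \<le> norm x + norm y + norm (z :: 'a::real_normed_vector)"
  by (intro norm_triangle_le add_mono norm_triangle_ineq order_refl)

text \<open>The vectors \<open>v n\<close> play the role of iterates of the limit generator on
  \<open>a\<close>. The relation uses \<open>closure G0\<close> because \<open>v 1\<close> is in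
  general no longer local. \<open>K\<close> is common to all \<open>a\<close>, while
  \<open>C\<close> may vary, so that one time step suits all local elements.\<close>

locale analytic_net = dissipative_net X A
  for X :: "(int^'d) set \<Rightarrow> 'a::banach set" and A +
  fixes K :: real
  assumes K: "0 < K"
    and analytic: "a \<in> qlD X \<Longrightarrow> \<exists>v C. v 0 = a \<and> (\<forall>n. (v n, v (Suc n)) \<in> closure G0)
      \<and> (\<forall>n. norm (v n) \<le> C * fact n * K ^ n)"
begin

abbreviation E :: "(int^'d) set \<Rightarrow> real \<Rightarrow> 'a \<Rightarrow> 'a" where
  "E L \<equiv> dissipative_operator.exp_op (A L)"

lemmas E_S = dissipative_operator.exp_op_S[OF dissipative_operator]
  and E_diff = dissipative_operator.exp_op_diff[OF dissipative_operator]
  and E_add = dissipative_operator.exp_op_add[OF dissipative_operator]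
  and norm_E = dissipative_operator.norm_exp_op_le[OF dissipative_operator]
  and E_plus = dissipative_operator.exp_op_plus[OF dissipative_operator]
  and E_commute = dissipative_operator.exp_op_commute[OF dissipative_operator]
  and E_0 = dissipative_operator.exp_op_0[OF dissipative_operator]
  and A_X = dissipative_operator.D_S[OF dissipative_operator]

lemma E_contraction:
  "finite L \<Longrightarrow> x \<in> X L \<Longrightarrow> y \<in> X L \<Longrightarrow> 0 \<le> t \<Longrightarrow> dist (E L t x) (E L t y) \<le> dist x y"
  using norm_E[of L "x - y" t] by (simp add: E_diff dist_norm subspace_diff[OF subspace_X])

lemma closure_G0_GI: "closure G0 \<subseteq> GI"
  by (rule closure_minimal[OF G0_GI closed_GI])

definition analytic_vec :: "(nat \<Rightarrow> 'a) \<Rightarrow> bool" where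
  "analytic_vec v \<longleftrightarrow> (\<forall>n. (v n, v (Suc n)) \<in> closure G0) \<and> (\<exists>C. \<forall>n. norm (v n) \<le> C * fact n * K ^ n)"

definition U :: "(nat \<Rightarrow> 'a) \<Rightarrow> real \<Rightarrow> 'a" where
  "U v t = (\<Sum>n. (t ^ n / fact n) *\<^sub>R v n)"

text \<open>The exponential series of \<open>v\<close> converges for \<open>t * K < 1\<close>. The
  extra factor 4 leaves room for the shifted series, where a factor \<open>Suc n \<le> 2 ^ n\<close>
  appears.\<close>

definition radius :: real where "radius = 1 / (4 * K)"

lemma radius: "0 < radius" using K by (simp add: radius_def)

lemma analytic_vec_summable:
  assumes v: "analytic_vec v" and t: "0 \<le> t" "t \<le> radius"
  shows "summable (\<lambda>n. t ^ n / fact n * norm (v n))"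
    and "summable (\<lambda>n. t ^ n / fact n * norm (v (Suc n)))"
proof -
  obtain C where C: "\<And>n. norm (v n) \<le> C * fact n * K ^ n"
    using v unfolding analytic_vec_def by blast
  have C0: "0 \<le> C" using order_trans[OF norm_ge_zero C[of 0]] by simp
  have tK: "t ^ n * K ^ n \<le> (1/4) ^ n" for n
    unfolding power_mult_distrib[symmetric]
    using t K by (intro power_mono) (auto simp: radius_def field_simps)
  have "summable (\<lambda>n. C * (1/4::real) ^ n)" by (intro summable_mult summable_geometric) auto
  then show "summable (\<lambda>n. t ^ n / fact n * norm (v n))"
  proof (rule summable_comparison_test'[of _ 0])
    fix n
    have "t ^ n / fact n * norm (v n) \<le> t ^ n / fact n * (C * fact n * K ^ n)"
      using t by (intro mult_left_mono C) auto
    also have "\<dots> = C * (t ^ n * K ^ n)" by simp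
    also have "\<dots> \<le> C * (1/4) ^ n" by (intro mult_left_mono tK C0)
    finally show "norm (t ^ n / fact n * norm (v n)) \<le> C * (1/4) ^ n" using t by simp
  qed
  have "summable (\<lambda>n. C * K * (1/2::real) ^ n)" by (intro summable_mult summable_geometric) auto
  then show "summable (\<lambda>n. t ^ n / fact n * norm (v (Suc n)))"
  proof (rule summable_comparison_test'[of _ 0])
    fix n
    have "real (Suc n) \<le> 2 ^ n" using Suc_le_eq less_exp by (metis of_nat_le_iff of_nat_numeral of_nat_power)
    then have "real (Suc n) * (1/4) ^ n \<le> 2 ^ n * (1/4) ^ n" by (intro mult_right_mono) auto
    also have "\<dots> = (1/2::real) ^ n" by (simp flip: power_mult_distrib)
    finally have half: "real (Suc n) * (1/4) ^ n \<le> (1/2) ^ n" .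
    have "t ^ n / fact n * norm (v (Suc n)) \<le> t ^ n / fact n * (C * fact (Suc n) * K ^ Suc n)"
      using t by (intro mult_left_mono C) auto
    also have "\<dots> = C * K * real (Suc n) * (t ^ n * K ^ n)" by (simp add: fact_Suc)
    also have "\<dots> \<le> C * K * real (Suc n) * (1/4) ^ n"
      using C0 K by (intro mult_left_mono tK) auto
    also have "\<dots> \<le> C * K * (1/2) ^ n"
      unfolding mult.assoc using half C0 K by (intro mult_left_mono) (auto simp: mult.assoc)
    finally show "norm (t ^ n / fact n * norm (v (Suc n))) \<le> C * K * (1/2) ^ n" using t by simp
  qed
qed

lemma analytic_vec_sums:
  assumes "analytic_vec v" "0 \<le> t" "t \<le> radius"
  shows "(\<lambda>n. (t ^ n / fact n) *\<^sub>R v n) sums U v t"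
    and "(\<lambda>n. (t ^ n / fact n) *\<^sub>R v (Suc n)) sums U (v \<circ> Suc) t"
  unfolding U_def using analytic_vec_summable[OF assms] assms(2)
  by (auto intro!: summable_sums intro: summable_norm_cancel simp: power_abs)

text \<open>Because the limit graph is single-valued, \<open>G0\<close> is exactly its part over the
  local elements and inherits linearity.\<close>

lemma subspace_G0: "subspace G0"
proof -
  have "G0 = GI \<inter> (qlD X \<times> UNIV)"
  proof
    show "GI \<inter> (qlD X \<times> UNIV) \<subseteq> G0"
    proof
      fix p assume p: "p \<in> GI \<inter> (qlD X \<times> UNIV)"
      then have "(fst p, netlim (\<lambda>L. A L (fst p))) \<in> GI" using G0_GI by (auto simp: G0_def)
      moreover have "(fst p, snd p) \<in> GI" using p by simp
      ultimately have "snd p = netlim (\<lambda>L. A L (fst p))"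
        using well_defined_GI unfolding well_defined_def by blast
      then show "p \<in> G0" using p by (cases p) (auto simp: G0_def)
    qed
  qed (use G0_GI in \<open>auto simp: G0_def\<close>)
  moreover have "subspace (qlD X \<times> (UNIV :: 'a set))"
    by (intro subspace_Times subspace_qlD subspace_UNIV)
  ultimately show ?thesis using subspace_inter[OF subspace_GI] by simp
qed

lemma subspace_closure_G0: "subspace (closure G0)"
  by (rule subspace_closure[OF subspace_G0])

lemma U_closure_G0:
  assumes "analytic_vec v" "0 \<le> t" "t \<le> radius"
  shows "(U v t, U (v \<circ> Suc) t) \<in> closure G0"
proof -
  have "(\<lambda>N. (\<Sum>n<N. (t ^ n / fact n) *\<^sub>R v n, \<Sum>n<N. (t ^ n / fact n) *\<^sub>R v (Suc n))) \<longlonglongrightarrow> (U v t, U (v \<circ> Suc) t)"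
    using analytic_vec_sums[OF assms] unfolding sums_def by (rule tendsto_Pair)
  moreover have "(\<Sum>n<N. (t ^ n / fact n) *\<^sub>R v n, \<Sum>n<N. (t ^ n / fact n) *\<^sub>R v (Suc n)) \<in> closure G0" for N
  proof -
    have "(\<Sum>n<N. (t ^ n / fact n) *\<^sub>R (v n, v (Suc n))) \<in> closure G0"
      using assms(1) unfolding analytic_vec_def
      by (intro subspace_sum[OF subspace_closure_G0] subspace_scale[OF subspace_closure_G0]) auto
    then show ?thesis by (simp add: sum_prod scaleR_Pair)
  qed
  ultimately show ?thesis by (rule closed_sequentially[OF closed_closure, rotated])
qed

text \<open>The truncated exponential series of a net representing \<open>v\<close> solves the evolution equation
  at \<open>L\<close> up to its last term and up to an error vanishing along the net.\<close>
lemma E_analytic_tendsto: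
  assumes v: "analytic_vec v" and t: "0 \<le> t" "t \<le> radius"
    and a: "local_net a" "(a \<longlongrightarrow> v 0) netF"
  shows "((\<lambda>L. E L t (a L)) \<longlongrightarrow> U v t) netF"
proof -
  have "(v n, v (Suc n)) \<in> GI" for n using v closure_G0_GI unfolding analytic_vec_def by blast
  \<comment> \<open>These nets depend on the operators \<open>A L\<close> and need not be iterates
    of each other: only in the limit does \<open>A L (w n L)\<close> agree with
    \<open>w (Suc n) L\<close>.\<close>
  then have "\<exists>w. local_net w \<and> (w \<longlongrightarrow> v n) netF \<and> ((\<lambda>L. A L (w L)) \<longlongrightarrow> v (Suc n)) netF" for n
    using GI_E by metis
  then obtain w where w: "\<And>n. local_net (w n)" "\<And>n. (w n \<longlongrightarrow> v n) netF"
     "\<And>n. ((\<lambda>L. A L (w n L)) \<longlongrightarrow> v (Suc n)) netF" by metis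
  define p where "p N L s = (\<Sum>n<Suc N. (s ^ n / fact n) *\<^sub>R w n L)" for N L and s :: real
  define p' where "p' N L s = (\<Sum>n<N. (s ^ n / fact n) *\<^sub>R w (Suc n) L)" for N L and s :: real
  define e where "e N L = (\<Sum>n<N. t ^ n / fact n * norm (w (Suc n) L - A L (w n L))) + t ^ N / fact N * norm (A L (w N L))" for N L
  define T where "T N = (\<Sum>n<Suc N. (t ^ n / fact n) *\<^sub>R v n)" for N
  have p_deriv: "(p N L has_vector_derivative p' N L s) (at s within S)" for N L s S
  proof -
    have "((\<lambda>s. w 0 L + (\<Sum>n<N. (s ^ Suc n / fact (Suc n)) *\<^sub>R w (Suc n) L)) has_vector_derivative
      0 + (\<Sum>n<N. (s ^ n / fact n) *\<^sub>R w (Suc n) L)) (at s within S)"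
    proof (intro has_vector_derivative_add has_vector_derivative_const has_vector_derivative_sum)
      fix n
      have "((\<lambda>s. s ^ Suc n / fact (Suc n)) has_real_derivative s ^ n / fact n) (at s within S)"
        by (auto intro!: derivative_eq_intros simp del: power_Suc simp: divide_simps)
      then show "((\<lambda>s. (s ^ Suc n / fact (Suc n)) *\<^sub>R w (Suc n) L) has_vector_derivative
        (s ^ n / fact n) *\<^sub>R w (Suc n) L) (at s within S)"
        using has_vector_derivative_scaleR[OF _ has_vector_derivative_const, of _ "s ^ n / fact n" s S "w (Suc n) L"]
        by simp
    qed
    moreover have "p N L = (\<lambda>s. w 0 L + (\<Sum>n<N. (s ^ Suc n / fact (Suc n)) *\<^sub>R w (Suc n) L))"
      unfolding p_def by (subst sum.lessThan_Suc_shift) simp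
    ultimately show ?thesis unfolding p'_def by simp
  qed
  have main: "norm (E L t (w 0 L) - p N L t) \<le> e N L * t" if L: "finite L" for L N
  proof -
    interpret dissipative_operator "X L" "A L" by (rule dissipative_operator[OF L])
    have w_L: "w n L \<in> X L" for n using w(1) L by (simp add: local_net_def)
    have "norm (E L t (p N L 0) - p N L t) \<le> e N L * t"
    proof (rule approximate_solution[OF t(1) _ p_deriv])
      fix s assume s: "0 \<le> s" "s \<le> t"
      show "p N L s \<in> X L" unfolding p_def by (intro S_intros w_L)
      have "A L (p N L s) = (\<Sum>n<Suc N. (s ^ n / fact n) *\<^sub>R A L (w n L))"
        unfolding p_def by (simp add: D_sum D_scaleR D_add S_intros w_L)
      then have "p' N L s - A L (p N L s) =
        (\<Sum>n<N. (s ^ n / fact n) *\<^sub>R (w (Suc n) L - A L (w n L))) - (s ^ N / fact N) *\<^sub>R A L (w N L)"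
        unfolding p'_def by (simp add: scaleR_diff_right sum_subtractf)
      also have "norm \<dots> \<le> (\<Sum>n<N. norm ((s ^ n / fact n) *\<^sub>R (w (Suc n) L - A L (w n L)))) + norm ((s ^ N / fact N) *\<^sub>R A L (w N L))"
        by (intro order_trans[OF norm_triangle_ineq4] add_mono norm_sum order_refl)
      also have "\<dots> \<le> e N L"
        unfolding e_def norm_scaleR
        using s by (intro add_mono sum_mono mult_right_mono) (auto intro!: divide_right_mono power_mono)
      finally show "norm (p' N L s - A L (p N L s)) \<le> e N L" .
    qed
    moreover have "p N L 0 = w 0 L" unfolding p_def by (subst sum.lessThan_Suc_shift) simp
    ultimately show ?thesis by simp
  qed
  have T_lim: "T \<longlonglongrightarrow> U v t"
    using analytic_vec_sums(1)[OF v t] unfolding sums_def T_def by (subst (asm) filterlim_sequentially_Suc[symmetric])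
  have last_lim: "(\<lambda>N. t ^ N / fact N * norm (v (Suc N))) \<longlonglongrightarrow> 0"
    by (rule summable_LIMSEQ_zero[OF analytic_vec_summable(2)[OF v t]])
  show ?thesis
  proof (rule tendstoI)
    fix \<epsilon> :: real assume \<epsilon>: "0 < \<epsilon>"
    have "(\<lambda>N. (t ^ N / fact N * norm (v (Suc N))) * t + norm (T N - U v t)) \<longlonglongrightarrow> 0 * t + norm (U v t - U v t)"
      by (intro tendsto_intros T_lim last_lim)
    then have "\<forall>\<^sub>F N in sequentially. (t ^ N / fact N * norm (v (Suc N))) * t + norm (T N - U v t) < \<epsilon>"
      using \<epsilon> by (intro order_tendstoD(2)[where y="0 * t + norm (U v t - U v t)"]) auto
    then obtain N where N: "(t ^ N / fact N * norm (v (Suc N))) * t + norm (T N - U v t) < \<epsilon>"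
      using eventually_happens[of _ sequentially] by auto
    \<comment> \<open>\<open>N\<close> is fixed before the net moves. Along the net the mismatches
      vanish, and what remains is the quantity already made smaller than
      \<open>\<epsilon>\<close>.\<close>
    have "((\<lambda>L. norm (a L - w 0 L) + e N L * t + norm (p N L t - T N) + norm (T N - U v t)) \<longlongrightarrow>
      norm (v 0 - v 0) + ((\<Sum>n<N. t ^ n / fact n * norm (v (Suc n) - v (Suc n))) + t ^ N / fact N * norm (v (Suc N))) * t
       + norm (T N - T N) + norm (T N - U v t)) netF"
      unfolding p_def e_def T_def by (intro tendsto_intros a w)
    then have "\<forall>\<^sub>F L in netF. norm (a L - w 0 L) + e N L * t + norm (p N L t - T N) + norm (T N - U v t) < \<epsilon>"
      by (rule order_tendstoD(2)) (use N in simp)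
    then show "\<forall>\<^sub>F L in netF. dist (E L t (a L)) (U v t) < \<epsilon>"
      using eventually_local[OF a(1)] eventually_local[OF w(1)[of 0]]
    proof eventually_elim
      case (elim L)
      have "dist (E L t (a L)) (U v t) \<le> dist (E L t (a L)) (E L t (w 0 L)) + norm (E L t (w 0 L) - p N L t)
         + norm (p N L t - T N) + norm (T N - U v t)"
        using dist_triangle[of "E L t (a L)" "U v t" "E L t (w 0 L)"]
          norm_add3_le[of "E L t (w 0 L) - p N L t" "p N L t - T N" "T N - U v t"]
        by (simp add: dist_norm)
      moreover have "dist (E L t (a L)) (E L t (w 0 L)) \<le> norm (a L - w 0 L)"
        using E_contraction elim t by (simp add: dist_norm)
      moreover have "norm (E L t (w 0 L) - p N L t) \<le> e N L * t" using main elim by blast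
      ultimately show ?case using elim(1) by linarith
    qed
  qed
qed

lemma analytic_vecE:
  assumes "a \<in> qlD X"
  obtains v where "analytic_vec v" "v 0 = a"
  using analytic[OF assms] unfolding analytic_vec_def by blast

lemma local_net_E: "local_net a \<Longrightarrow> local_net (\<lambda>L. E L t (a L))"
  by (simp add: local_net_def E_S)

text \<open>Density of the local elements: contractivity uniform in \<open>L\<close> carries
  convergence over from the orbits of a nearby local element.\<close>

lemma conv_net_E_small:
  assumes a: "local_net a" "conv_net a" and t: "0 \<le> t" "t \<le> radius"
  shows "conv_net (\<lambda>L. E L t (a L))"
proof (rule conv_net_approxI)
  fix \<epsilon> :: real assume \<epsilon>: "0 < \<epsilon>"
  have "netlim a \<in> closure (qlD X)" using local_net_limit[OF a(1) conv_net_tendsto[OF a(2)]] by (simp add: qlA_def)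
  then obtain d where d: "d \<in> qlD X" "dist d (netlim a) < \<epsilon>" using \<epsilon> unfolding closure_approachable by blast
  obtain v where v: "analytic_vec v" "v 0 = d" using analytic_vecE[OF d(1)] .
  have "conv_net (\<lambda>L. E L t (const_net d L))"
    using E_analytic_tendsto[OF v(1) t local_const_net[of d]] const_net_tendsto[OF d(1)] v(2)
    unfolding conv_net_def by blast
  moreover have "\<forall>\<^sub>F L in netF. dist (a L) (const_net d L) < \<epsilon>"
    using d(2) by (intro order_tendstoD(2)[OF tendsto_dist[OF conv_net_tendsto[OF a(2)] const_net_tendsto[OF d(1)]]])
      (simp add: dist_commute)
  then have "\<forall>\<^sub>F L in netF. dist (E L t (a L)) (E L t (const_net d L)) < \<epsilon>"
    using eventually_local[OF a(1)] eventually_local[OF local_const_net[of d]]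
    by eventually_elim (use E_contraction t in \<open>meson order_le_less_trans\<close>)
  ultimately show "\<exists>b. conv_net b \<and> (\<forall>\<^sub>F L in netF. dist (E L t (a L)) (b L) < \<epsilon>)" by blast
qed

lemma conv_net_cong: "(\<And>L. finite L \<Longrightarrow> f L = g L) \<Longrightarrow> conv_net f \<Longrightarrow> conv_net g"
  unfolding conv_net_def
  by (metis (mono_tags, lifting) Lim_transform_eventually eventually_mono[OF eventually_netF_finite])

lemma conv_net_E:
  assumes a: "local_net a" "conv_net a" and t: "0 \<le> t"
  shows "conv_net (\<lambda>L. E L t (a L))"
proof -
  have multiple: "conv_net (\<lambda>L. E L (real k * s) (a L))" if s: "0 \<le> s" "s \<le> radius" for k s
  proof (induction k)
    case 0
    show ?case by (rule conv_net_cong[OF _ a(2)]) (simp add: E_0)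
  next
    case (Suc k)
    have "conv_net (\<lambda>L. E L s (E L (real k * s) (a L)))"
      by (rule conv_net_E_small[OF local_net_E[OF a(1)] Suc s])
    then show ?case
      using a(1) s by (rule_tac conv_net_cong) (simp add: local_net_def distrib_right E_plus)
  qed
  obtain k :: nat where k: "t / radius \<le> real k" using real_arch_simple by blast
  \<comment> \<open>\<open>Suc k\<close> keeps the number of steps positive, also when
    \<open>t = 0\<close>.\<close>
  have "conv_net (\<lambda>L. E L (real (Suc k) * (t / real (Suc k))) (a L))"
    using k t radius by (intro multiple) (auto simp: field_simps)
  then show ?thesis by simp
qed

section \<open>The limit semigroup\<close>

definition T :: "real \<Rightarrow> 'a \<Rightarrow> 'a" where
  "T t x = netlim (\<lambda>L. E L t ((SOME a. local_net a \<and> (a \<longlongrightarrow> x) netF) L))"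

text \<open>Shows that the net chosen in the definition of \<open>T\<close> does not matter: two
  nets with the same limit have asymptotically equal orbits by contractivity.\<close>

lemma T_lim:
  assumes "local_net a" "(a \<longlongrightarrow> x) netF" "0 \<le> t"
  shows "((\<lambda>L. E L t (a L)) \<longlongrightarrow> T t x) netF"
proof -
  define b where "b = (SOME a. local_net a \<and> (a \<longlongrightarrow> x) netF)"
  have b: "local_net b" "(b \<longlongrightarrow> x) netF"
    unfolding b_def using someI[of "\<lambda>a. local_net a \<and> (a \<longlongrightarrow> x) netF" a] assms by auto
  have "((\<lambda>L. E L t (b L)) \<longlongrightarrow> T t x) netF"
    unfolding T_def b_def[symmetric] using b assms by (intro conv_net_tendsto conv_net_E) (auto simp: conv_net_def)
  moreover have "((\<lambda>L. E L t (a L) - E L t (b L)) \<longlongrightarrow> 0) netF"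
  proof (rule tendsto_0_le[where K=1])
    show "((\<lambda>L. a L - b L) \<longlongrightarrow> 0) netF"
      using tendsto_diff[OF assms(2) b(2)] by simp
    show "\<forall>\<^sub>F L in netF. norm (E L t (a L) - E L t (b L)) \<le> norm (a L - b L) * 1"
      using eventually_local[OF assms(1)] eventually_local[OF b(1)]
      by eventually_elim (use E_contraction assms in \<open>simp add: dist_norm\<close>)
  qed
  ultimately show ?thesis by (rule Lim_transform)
qed

lemma T_eqI:
  assumes "local_net a" "(a \<longlongrightarrow> x) netF" "0 \<le> t" "((\<lambda>L. E L t (a L)) \<longlongrightarrow> y) netF"
  shows "T t x = y"
  using tendsto_unique[OF _ T_lim[OF assms(1-3)] assms(4)] by simp

lemma T_qlA: "x \<in> qlA X \<Longrightarrow> 0 \<le> t \<Longrightarrow> T t x \<in> qlA X"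
  by (metis qlA_local_net T_lim local_net_E local_net_limit)

lemma norm_T:
  assumes "x \<in> qlA X" "0 \<le> t"
  shows "norm (T t x) \<le> norm x"
proof -
  obtain a where a: "local_net a" "(a \<longlongrightarrow> x) netF" using qlA_local_net[OF assms(1)] .
  show ?thesis
    using eventually_local[OF a(1)]
    by (intro tendsto_le[OF _ tendsto_norm[OF a(2)] tendsto_norm[OF T_lim[OF a assms(2)]]])
       (auto elim!: eventually_mono simp: norm_E assms)
qed

lemma subspace_qlA: "subspace (qlA X)"
  unfolding qlA_def by (rule subspace_closure[OF subspace_qlD])

lemma T_add:
  assumes "x \<in> qlA X" "y \<in> qlA X" "0 \<le> t"
  shows "T t (x + y) = T t x + T t y"
proof -
  obtain a where a: "local_net a" "(a \<longlongrightarrow> x) netF" using qlA_local_net[OF assms(1)] .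
  obtain b where b: "local_net b" "(b \<longlongrightarrow> y) netF" using qlA_local_net[OF assms(2)] .
  have "\<forall>\<^sub>F L in netF. E L t (a L) + E L t (b L) = E L t (a L + b L)"
    using eventually_local[OF a(1)] eventually_local[OF b(1)] by eventually_elim (simp add: E_add)
  then show ?thesis
    by (intro T_eqI[OF local_net_add[OF a(1) b(1)] tendsto_add[OF a(2) b(2)] assms(3)]
         Lim_transform_eventually[OF tendsto_add[OF T_lim[OF a assms(3)] T_lim[OF b assms(3)]]])
qed

text \<open>Stated for a general operator \<open>B\<close> so that real and complex scalars are both
  covered.\<close>

lemma T_commute:
  assumes B: "bounded_linear B" "\<And>L y. finite L \<Longrightarrow> y \<in> X L \<Longrightarrow> B y \<in> X L \<and> A L (B y) = B (A L y)"
    and "x \<in> qlA X" "0 \<le> t"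
  shows "T t (B x) = B (T t x)"
proof -
  obtain a where a: "local_net a" "(a \<longlongrightarrow> x) netF" using qlA_local_net[OF assms(3)] .
  have "\<forall>\<^sub>F L in netF. B (E L t (a L)) = E L t (B (a L))"
    using eventually_local[OF a(1)] by eventually_elim (simp add: E_commute B)
  then show ?thesis
    using a(1) B(2)
    by (intro T_eqI[OF _ bounded_linear.tendsto[OF B(1) a(2)] assms(4)]
         Lim_transform_eventually[OF bounded_linear.tendsto[OF B(1) T_lim[OF a assms(4)]]])
       (auto simp: local_net_def)
qed

lemma T_scaleR: "x \<in> qlA X \<Longrightarrow> 0 \<le> t \<Longrightarrow> T t (r *\<^sub>R x) = r *\<^sub>R T t x"
  by (rule T_commute)
     (auto intro: bounded_linear_scaleR_right subspace_scale[OF subspace_X]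
       simp: dissipative_operator.D_scaleR[OF dissipative_operator])

lemma T_diff: "x \<in> qlA X \<Longrightarrow> y \<in> qlA X \<Longrightarrow> 0 \<le> t \<Longrightarrow> T t (x - y) = T t x - T t y"
  using T_add[of x "(-1) *\<^sub>R y" t] T_scaleR[of y t "-1"] subspace_scale[OF subspace_qlA, of y "-1"] by simp

lemma T_0:
  assumes "x \<in> qlA X"
  shows "T 0 x = x"
proof -
  obtain a where a: "local_net a" "(a \<longlongrightarrow> x) netF" using qlA_local_net[OF assms] .
  have "\<forall>\<^sub>F L in netF. a L = E L 0 (a L)"
    using eventually_netF_finite by eventually_elim (simp add: E_0)
  then show ?thesis by (intro T_eqI[OF a] Lim_transform_eventually[OF a(2)]) auto
qed

lemma T_plus:
  assumes "x \<in> qlA X" "0 \<le> s" "0 \<le> t"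
  shows "T (s + t) x = T s (T t x)"
proof -
  obtain a where a: "local_net a" "(a \<longlongrightarrow> x) netF" using qlA_local_net[OF assms(1)] .
  have "((\<lambda>L. E L s (E L t (a L))) \<longlongrightarrow> T s (T t x)) netF"
    by (intro T_lim local_net_E a assms)
  then have "((\<lambda>L. E L (s + t) (a L)) \<longlongrightarrow> T s (T t x)) netF"
    by (rule Lim_transform_eventually)
       (use eventually_local[OF a(1)] assms in \<open>auto elim!: eventually_mono simp: E_plus\<close>)
  then show ?thesis using assms by (intro T_eqI[OF a]) auto
qed

lemma T_contraction: "x \<in> qlA X \<Longrightarrow> y \<in> qlA X \<Longrightarrow> 0 \<le> t \<Longrightarrow> norm (T t x - T t y) \<le> norm (x - y)"
  using norm_T[of "x - y" t] by (simp add: T_diff subspace_diff[OF subspace_qlA])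

lemma GI_qlA: "(x, y) \<in> GI \<Longrightarrow> x \<in> qlA X" "(x, y) \<in> GI \<Longrightarrow> y \<in> qlA X"
proof -
  assume "(x, y) \<in> GI"
  then obtain a where a: "local_net a" "(a \<longlongrightarrow> x) netF" "((\<lambda>L. A L (a L)) \<longlongrightarrow> y) netF" by (rule GI_E)
  show "x \<in> qlA X" by (rule local_net_limit[OF a(1,2)])
  show "y \<in> qlA X" by (rule local_net_limit[OF _ a(3)]) (use a(1) A_X in \<open>auto simp: local_net_def\<close>)
qed

lemma norm_T_minus_id:
  assumes "(x, y) \<in> GI" "0 \<le> t"
  shows "norm (T t x - x) \<le> norm y * t"
proof -
  obtain a where a: "local_net a" "(a \<longlongrightarrow> x) netF" "((\<lambda>L. A L (a L)) \<longlongrightarrow> y) netF" using GI_E[OF assms(1)] .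
  show ?thesis
  proof (rule tendsto_le[of netF])
    show "((\<lambda>L. norm (E L t (a L) - a L)) \<longlongrightarrow> norm (T t x - x)) netF"
      by (intro tendsto_intros T_lim a assms)
    show "((\<lambda>L. norm (A L (a L)) * t) \<longlongrightarrow> norm y * t) netF" by (intro tendsto_intros a)
    show "\<forall>\<^sub>F L in netF. norm (E L t (a L) - a L) \<le> norm (A L (a L)) * t"
      using eventually_local[OF a(1)]
      by eventually_elim (auto intro: dissipative_operator.norm_exp_op_minus_id_le[OF dissipative_operator] assms)
  qed simp
qed

lemma qlA_approx:
  assumes "x \<in> qlA X" "0 < \<epsilon>"
  obtains d where "d \<in> qlD X" "norm (d - x) < \<epsilon>"
  using assms unfolding qlA_def closure_approachable dist_norm by blast

lemma qlD_GI: "d \<in> qlD X \<Longrightarrow> (d, netlim (\<lambda>L. A L d)) \<in> GI"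
  using G0_GI by (auto simp: G0_def)

lemma T_continuous_0:
  assumes "x \<in> qlA X" "0 < \<epsilon>"
  shows "\<exists>\<delta>>0. \<forall>t. 0 \<le> t \<and> t \<le> \<delta> \<longrightarrow> norm (T t x - x) < \<epsilon>"
proof -
  obtain d where d: "d \<in> qlD X" "norm (d - x) < \<epsilon> / 4" using qlA_approx[OF assms(1), of "\<epsilon> / 4"] assms(2) by auto
  define M where "M = norm (netlim (\<lambda>L. A L d))"
  \<comment> \<open>Gives \<open>M * \<delta> \<le> \<epsilon> / 2\<close>; the summand 1 covers
    \<open>M = 0\<close>.\<close>
  define \<delta> where "\<delta> = \<epsilon> / (2 * (M + 1))"
  have M: "0 \<le> M" by (simp add: M_def)
  have d_A: "d \<in> qlA X" using GI_qlA(1)[OF qlD_GI[OF d(1)]] .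
  have "norm (T t x - x) < \<epsilon>" if t: "0 \<le> t" "t \<le> \<delta>" for t
  proof -
    have "norm (T t d - d) \<le> M * t" unfolding M_def by (rule norm_T_minus_id[OF qlD_GI[OF d(1)] t(1)])
    also have "\<dots> \<le> M * \<delta>" using t M by (intro mult_left_mono)
    also have "\<dots> \<le> \<epsilon> / 2"
    proof -
      have "M / (M + 1) \<le> 1" using M by simp
      from mult_left_le[OF this, of "\<epsilon> / 2"] assms(2) show ?thesis by (simp add: \<delta>_def mult_ac)
    qed
    finally have 1: "norm (T t d - d) \<le> \<epsilon> / 2" .
    have 2: "norm (T t x - T t d) \<le> norm (d - x)" using T_contraction[OF assms(1) d_A t(1)] by (simp add: norm_minus_commute)
    have "T t x - x = (T t x - T t d) + (T t d - d) + (d - x)" by simp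
    then have "norm (T t x - x) \<le> norm (T t x - T t d) + norm (T t d - d) + norm (d - x)"
      by (metis norm_add3_le)
    with 1 2 d(2) show ?thesis by linarith
  qed
  moreover have "0 < \<delta>" using M assms(2) by (simp add: \<delta>_def)
  ultimately show ?thesis by blast
qed

lemma T_continuous_on:
  assumes x: "x \<in> qlA X"
  shows "continuous_on {0..} (\<lambda>t. T t x)"
  unfolding continuous_on_iff
proof (intro ballI allI impI)
  fix s \<epsilon> :: real assume s: "s \<in> {0..}" and \<epsilon>: "0 < \<epsilon>"
  obtain \<delta> where \<delta>: "\<delta> > 0" "\<And>t. 0 \<le> t \<Longrightarrow> t \<le> \<delta> \<Longrightarrow> norm (T t x - x) < \<epsilon>"
    using T_continuous_0[OF x \<epsilon>] by blast
  have *: "norm (T (u + h) x - T u x) < \<epsilon>" if "0 \<le> u" "0 \<le> h" "h < \<delta>" for u h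
    using T_contraction[OF T_qlA[OF x that(2)] x that(1)] \<delta>(2)[of h] that by (simp add: T_plus[OF x])
  show "\<exists>d>0. \<forall>t\<in>{0..}. dist t s < d \<longrightarrow> dist (T t x) (T s x) < \<epsilon>"
  proof (intro exI[of _ \<delta>] conjI \<delta> ballI impI)
    fix t assume t: "t \<in> {0..}" "dist t s < \<delta>"
    show "dist (T t x) (T s x) < \<epsilon>"
      using *[of s "t - s"] *[of t "s - t"] t s
      by (cases "s \<le> t") (auto simp: dist_norm norm_minus_commute)
  qed
qed

section \<open>The generator and its core\<close>

lemma GI_generator: "GI \<subseteq> generator (qlA X) T"
proof
  fix p assume "p \<in> GI"
  then obtain x y where p: "p = (x, y)" "(x, y) \<in> GI" by (metis surj_pair)
  obtain a where a: "local_net a" "(a \<longlongrightarrow> x) netF" "((\<lambda>L. A L (a L)) \<longlongrightarrow> y) netF" using GI_E[OF p(2)] .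
  \<comment> \<open>The first-order remainder depends on how far the orbit of
    \<open>A L (a L)\<close> moves, and \<open>A L (A L (a L))\<close> has no uniform bound.
    Replacing \<open>A L (a L)\<close> by a nearby net \<open>c L\<close> whose image does converge
    costs \<open>2 * norm (y - b)\<close> and makes the rest linear in \<open>h\<close>.\<close>
  have key: "norm (T h x - x - h *\<^sub>R y) \<le> (2 * norm (y - b) + norm b' * h) * h"
    if bb: "(b, b') \<in> GI" and h: "0 \<le> h" for b b' h
  proof -
    obtain c where c: "local_net c" "(c \<longlongrightarrow> b) netF" "((\<lambda>L. A L (c L)) \<longlongrightarrow> b') netF" using GI_E[OF bb] .
    show ?thesis
    proof (rule tendsto_le[of netF])
      show "((\<lambda>L. norm (E L h (a L) - a L - h *\<^sub>R A L (a L))) \<longlongrightarrow> norm (T h x - x - h *\<^sub>R y)) netF"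
        by (intro tendsto_intros T_lim a h)
      show "((\<lambda>L. (2 * norm (A L (a L) - c L) + norm (A L (c L)) * h) * h) \<longlongrightarrow> (2 * norm (y - b) + norm b' * h) * h) netF"
        by (intro tendsto_intros a c)
      show "\<forall>\<^sub>F L in netF. norm (E L h (a L) - a L - h *\<^sub>R A L (a L)) \<le> (2 * norm (A L (a L) - c L) + norm (A L (c L)) * h) * h"
        using eventually_local[OF a(1)] eventually_local[OF c(1)]
      proof eventually_elim
        case (elim L)
        interpret dissipative_operator "X L" "A L" using dissipative_operator elim by blast
        show ?case
        proof (rule norm_exp_op_first_order)
          fix s assume s: "0 \<le> s" "s \<le> h"
          have "norm (exp_op s (A L (a L)) - exp_op s (c L)) \<le> norm (A L (a L) - c L)"
            using norm_exp_op_le[of "A L (a L) - c L" s] elim s by (simp add: exp_op_diff S_intros)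
          moreover have "norm (exp_op s (c L) - c L) \<le> norm (A L (c L)) * h"
            using norm_exp_op_minus_id_le[of "c L" s] elim s mult_left_mono[OF s(2), of "norm (A L (c L))"] by simp
          moreover have "norm (exp_op s (A L (a L)) - A L (a L)) \<le> norm (exp_op s (A L (a L)) - exp_op s (c L)) + norm (exp_op s (c L) - c L) + norm (A L (a L) - c L)"
            using norm_add3_le[of "exp_op s (A L (a L)) - exp_op s (c L)" "exp_op s (c L) - c L" "- (A L (a L) - c L)"]
            by (simp add: norm_minus_commute)
          ultimately show "norm (exp_op s (A L (a L)) - A L (a L)) \<le> 2 * norm (A L (a L) - c L) + norm (A L (c L)) * h"
            by linarith
        qed (use elim h in auto)
      qed
    qed simp
  qed
  have "((\<lambda>h. (1 / h) *\<^sub>R (T h x - x)) \<longlongrightarrow> y) (at_right 0)"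
  proof (rule tendstoI)
    fix \<epsilon> :: real assume \<epsilon>: "0 < \<epsilon>"
    obtain b where b: "b \<in> qlD X" "norm (b - y) < \<epsilon> / 4" using qlA_approx[OF GI_qlA(2)[OF p(2)], of "\<epsilon> / 4"] \<epsilon> by auto
    define b' where "b' = netlim (\<lambda>L. A L b)"
    have bb: "(b, b') \<in> GI" unfolding b'_def by (rule qlD_GI[OF b(1)])
    define \<delta> where "\<delta> = \<epsilon> / (2 * (norm b' + 1))"
    have \<delta>: "0 < \<delta>" using \<epsilon> by (simp add: \<delta>_def add_nonneg_pos)
    have "dist ((1 / h) *\<^sub>R (T h x - x)) y < \<epsilon>" if h: "0 < h" "h < \<delta>" for h
    proof -
      have "(1 / h) *\<^sub>R (T h x - x) - y = (1 / h) *\<^sub>R (T h x - x - h *\<^sub>R y)"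
        using h by (simp add: algebra_simps)
      then have "dist ((1 / h) *\<^sub>R (T h x - x)) y = (1 / h) * norm (T h x - x - h *\<^sub>R y)"
        using h by (simp add: dist_norm)
      also have "\<dots> \<le> (1 / h) * ((2 * norm (y - b) + norm b' * h) * h)"
        using key[OF bb, of h] h by (intro mult_left_mono) auto
      also have "\<dots> = 2 * norm (y - b) + norm b' * h" using h by simp
      also have "norm b' * h \<le> norm b' * \<delta>" using h by (intro mult_left_mono) auto
      also have "norm b' * \<delta> \<le> \<epsilon> / 2"
      proof -
        have "norm b' / (norm b' + 1) \<le> 1" by (simp add: divide_le_eq_1 add_nonneg_pos)
        from mult_left_le[OF this, of "\<epsilon> / 2"] \<epsilon> show ?thesis by (simp add: \<delta>_def mult_ac)
      qed
      finally show ?thesis using b(2) by (simp add: norm_minus_commute)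
    qed
    then show "\<forall>\<^sub>F h in at_right 0. dist ((1 / h) *\<^sub>R (T h x - x)) y < \<epsilon>"
      unfolding eventually_at_right_field using \<delta> by blast
  qed
  then show "p \<in> generator (qlA X) T"
    using GI_qlA(1)[OF p(2)] by (simp add: generator_def p)
qed

lemma generator_T:
  assumes "(x, y) \<in> generator (qlA X) T" "0 \<le> s" and y: "y \<in> qlA X"
  shows "(T s x, T s y) \<in> generator (qlA X) T"
proof -
  have x: "x \<in> qlA X" and lim: "((\<lambda>h. (1 / h) *\<^sub>R (T h x - x)) \<longlongrightarrow> y) (at_right 0)"
    using assms by (auto simp: generator_def)
  have "((\<lambda>h. (1 / h) *\<^sub>R (T h (T s x) - T s x) - T s y) \<longlongrightarrow> 0) (at_right 0)"
  proof (rule tendsto_0_le[where K=1])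
    show "((\<lambda>h. (1 / h) *\<^sub>R (T h x - x) - y) \<longlongrightarrow> 0) (at_right 0)"
      using lim by (simp add: LIM_zero_iff)
    show "\<forall>\<^sub>F h in at_right 0. norm ((1 / h) *\<^sub>R (T h (T s x) - T s x) - T s y) \<le> norm ((1 / h) *\<^sub>R (T h x - x) - y) * 1"
    proof (rule eventually_mono[OF eventually_at_right_less])
      fix h :: real assume h: "0 < h"
      have "T h (T s x) = T s (T h x)"
        using T_plus[OF x, of h s] T_plus[OF x, of s h] h assms by (simp add: add.commute)
      then have "(1 / h) *\<^sub>R (T h (T s x) - T s x) = T s ((1 / h) *\<^sub>R (T h x - x))"
        using x h assms(2) by (simp add: T_scaleR T_diff T_qlA subspace_diff[OF subspace_qlA])
      then show "norm ((1 / h) *\<^sub>R (T h (T s x) - T s x) - T s y) \<le> norm ((1 / h) *\<^sub>R (T h x - x) - y) * 1"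
        using x h assms(2) y
        by (simp add: T_contraction T_qlA subspace_diff[OF subspace_qlA] subspace_scale[OF subspace_qlA])
    qed
  qed
  then show ?thesis using T_qlA[OF x assms(2)] by (simp add: generator_def LIM_zero_iff)
qed

lemma generator_unique:
  "(x, y) \<in> generator (qlA X) T \<Longrightarrow> (x, z) \<in> generator (qlA X) T \<Longrightarrow> y = z"
  unfolding generator_def using tendsto_unique[of "at_right (0::real)"] by auto

text \<open>The series puts the orbit into the domain of the closure, with image
  \<open>U (v \<circ> Suc) s\<close>. The shifted sequence satisfies the analytic bound only up to a
  factor \<open>Suc n\<close>, so this image is identified with \<open>T s (v 1)\<close> through
  uniqueness of the generator's values.\<close>

lemma T_qlD_closure_G0:
  assumes v: "analytic_vec v" and a: "v 0 \<in> qlD X" and s: "0 \<le> s" "s \<le> radius"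
  shows "(T s (v 0), T s (v 1)) \<in> closure G0"
proof -
  have "T s (v 0) = U v s"
    by (rule T_eqI[OF local_const_net const_net_tendsto[OF a] s(1)])
       (rule E_analytic_tendsto[OF v s local_const_net const_net_tendsto[OF a]])
  then have mem: "(T s (v 0), U (v \<circ> Suc) s) \<in> closure G0"
    using U_closure_G0[OF v s] by simp
  have v1: "(v 0, v 1) \<in> GI" using v closure_G0_GI unfolding analytic_vec_def One_nat_def by blast
  have "(T s (v 0), T s (v 1)) \<in> generator (qlA X) T"
    by (rule generator_T[OF subsetD[OF GI_generator v1] s(1) GI_qlA(2)[OF v1]])
  moreover have "(T s (v 0), U (v \<circ> Suc) s) \<in> generator (qlA X) T"
    by (rule subsetD[OF GI_generator subsetD[OF closure_G0_GI mem]])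
  ultimately have "T s (v 1) = U (v \<circ> Suc) s" by (rule generator_unique)
  with mem show ?thesis by simp
qed

text \<open>The averages \<open>1/k \<Sum> T (j h / k) a\<close> lie in the domain of the closure of \<open>G0\<close>, and their
  images are close to the difference quotient \<open>(T h a - a) / h\<close>.\<close>
lemma generator_closure_G0: "generator (qlA X) T \<subseteq> closure G0"
proof
  fix p assume "p \<in> generator (qlA X) T"
  then obtain x y where p: "p = (x, y)" and x: "x \<in> qlA X"
    and lim: "((\<lambda>h. (1 / h) *\<^sub>R (T h x - x)) \<longlongrightarrow> y) (at_right 0)"
    by (auto simp: generator_def)
  have "\<exists>q\<in>closure G0. dist q p < \<epsilon>" if \<epsilon>: "0 < \<epsilon>" for \<epsilon>
  proof -
    define \<eta> where "\<eta> = \<epsilon> / 4"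
    have \<eta>: "0 < \<eta>" using \<epsilon> by (simp add: \<eta>_def)
    obtain \<delta> where \<delta>: "\<delta> > 0" "\<And>t. 0 \<le> t \<Longrightarrow> t \<le> \<delta> \<Longrightarrow> norm (T t x - x) < \<eta>"
      using T_continuous_0[OF x \<eta>] by blast
    obtain \<delta>' where \<delta>': "\<delta>' > 0" "\<And>h. 0 < h \<Longrightarrow> h < \<delta>' \<Longrightarrow> dist ((1 / h) *\<^sub>R (T h x - x)) y < \<eta> / 3"
      using tendstoD[OF lim, of "\<eta> / 3"] \<eta> unfolding eventually_at_right_field by auto
    \<comment> \<open>The choices are nested: \<open>h\<close> first, keeping the orbit near
      \<open>x\<close>, the quotient near \<open>y\<close> and all times within the analytic radius;
      then \<open>a\<close>, with error small compared with \<open>h\<close> because it is divided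
      by \<open>h\<close>; then \<open>m\<close>, fine enough for the derivative at
      \<open>a\<close>.\<close>
    define h where "h = Min {\<delta>, \<delta>' / 2, radius}"
    have h: "0 < h" "h \<le> \<delta>" "h < \<delta>'" "h \<le> radius" using \<delta> \<delta>' radius by (auto simp: h_def min_def)
    obtain a where a: "a \<in> qlD X" "norm (a - x) < min \<eta> (h * \<eta> / 6)"
      using qlA_approx[OF x, of "min \<eta> (h * \<eta> / 6)"] h \<eta> by auto
    obtain v where v: "analytic_vec v" "v 0 = a" using analytic_vecE[OF a(1)] .
    have "(a, v 1) \<in> closure G0" using v unfolding analytic_vec_def by (metis One_nat_def)
    then have av: "(a, v 1) \<in> generator (qlA X) T" "a \<in> qlA X" "v 1 \<in> qlA X"
      using closure_G0_GI GI_generator GI_qlA by blast+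
    then have lim_a: "((\<lambda>u. (1 / u) *\<^sub>R (T u a - a)) \<longlongrightarrow> v 1) (at_right 0)" by (simp add: generator_def)
    obtain \<delta>'' where \<delta>'': "\<delta>'' > 0" "\<And>u. 0 < u \<Longrightarrow> u < \<delta>'' \<Longrightarrow> dist ((1 / u) *\<^sub>R (T u a - a)) (v 1) < \<eta> / 3"
      using tendstoD[OF lim_a, of "\<eta> / 3"] \<eta> unfolding eventually_at_right_field by auto
    obtain m :: nat where m: "h / \<delta>'' < real m" using reals_Archimedean2 by blast
    then have m0: "0 < real m" using h \<delta>'' by (smt (verit) divide_pos_pos)
    define u where "u = h / real m"
    have u: "0 < u" "u < \<delta>''" using h m m0 \<delta>'' by (auto simp: u_def field_simps)
    have ju: "0 \<le> real j * u" "real j * u \<le> h" if "j < m" for j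
      using u that m0 h by (auto simp: u_def field_simps)
    define P where "P = (1 / real m) *\<^sub>R (\<Sum>j<m. T (real j * u) a)"
    define Q where "Q = (1 / real m) *\<^sub>R (\<Sum>j<m. T (real j * u) (v 1))"
    have avg: "norm ((1 / real m) *\<^sub>R (\<Sum>j<m. f j)) \<le> c" if "\<And>j. j < m \<Longrightarrow> norm (f j) \<le> c" for f :: "nat \<Rightarrow> 'a" and c
    proof -
      have "norm (\<Sum>j<m. f j) \<le> (\<Sum>j<m. c)" by (rule sum_norm_le) (use that in auto)
      then show ?thesis using m0 by (simp add: field_simps)
    qed
    have "(1 / real m) *\<^sub>R (\<Sum>j<m. (T (real j * u) a, T (real j * u) (v 1))) \<in> closure G0"
      using T_qlD_closure_G0[OF v(1)] v(2) a(1) ju h(4)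
      by (intro subspace_scale[OF subspace_closure_G0] subspace_sum[OF subspace_closure_G0]) (force intro: order_trans)
    then have PQ: "(P, Q) \<in> closure G0" by (simp add: P_def Q_def sum_prod scaleR_Pair)
    have const: "(1 / real m) *\<^sub>R (\<Sum>j<m. z) = z" for z :: 'a using m0 by (simp add: sum_constant_scaleR)
    have Px: "norm (P - x) \<le> 2 * \<eta>"
    proof -
      have "P - x = (1 / real m) *\<^sub>R (\<Sum>j<m. T (real j * u) a - x)"
        unfolding P_def sum_subtractf scaleR_diff_right const ..
      also have "norm \<dots> \<le> 2 * \<eta>"
      proof (rule avg)
        fix j assume j: "j < m"
        have "norm (T (real j * u) a - T (real j * u) x) \<le> norm (a - x)"
          by (rule T_contraction[OF av(2) x ju(1)[OF j]])
        moreover have "norm (T (real j * u) x - x) < \<eta>" using \<delta>(2) ju[OF j] h by simp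
        ultimately show "norm (T (real j * u) a - x) \<le> 2 * \<eta>"
          using norm_triangle_ineq[of "T (real j * u) a - T (real j * u) x" "T (real j * u) x - x"] a(2) by simp
      qed
      finally show ?thesis .
    qed
    have Qy: "norm (Q - y) \<le> \<eta>"
    proof -
      let ?R = "(1 / h) *\<^sub>R (T h a - a)"
      have mu: "real m * u = h" using m0 by (simp add: u_def)
      \<comment> \<open>By the semigroup law the difference quotients along the grid telescope, so
        their average is exactly the quotient of step \<open>h\<close>. \<open>Q\<close> differs
        from it only by the error of replacing each quotient by the derivative.\<close>
      have step: "T (real (Suc j) * u) a - T (real j * u) a = T (real j * u) (T u a - a)" for j
        using u av(2) by (simp add: T_diff T_qlA T_plus[symmetric] distrib_right add.commute)
      have "(\<Sum>j<m. T (real j * u) (T u a - a)) = (\<Sum>j<m. T (real (Suc j) * u) a - T (real j * u) a)"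
        unfolding step ..
      also have "\<dots> = T h a - a"
        by (subst sum_lessThan_telescope) (simp add: mu T_0 av)
      finally have sum_step: "(\<Sum>j<m. T (real j * u) (T u a - a)) = T h a - a" .
      have "Q - ?R = (1 / real m) *\<^sub>R (\<Sum>j<m. T (real j * u) (v 1) - (1 / u) *\<^sub>R T (real j * u) (T u a - a))"
        unfolding Q_def sum_subtractf scaleR_diff_right scaleR_sum_right[symmetric] sum_step
        using m0 by (simp add: u_def)
      also have "norm \<dots> \<le> \<eta> / 3"
      proof (rule avg)
        fix j assume j: "j < m"
        have d: "T u a - a \<in> qlA X" using av u by (intro subspace_diff[OF subspace_qlA] T_qlA) auto
        have "norm (T (real j * u) (v 1) - T (real j * u) ((1 / u) *\<^sub>R (T u a - a))) \<le> norm (v 1 - (1 / u) *\<^sub>R (T u a - a))"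
          by (intro T_contraction av subspace_scale[OF subspace_qlA] d ju j)
        also have "\<dots> < \<eta> / 3" using \<delta>''(2)[OF u] by (simp add: dist_norm norm_minus_commute)
        finally show "norm (T (real j * u) (v 1) - (1 / u) *\<^sub>R T (real j * u) (T u a - a)) \<le> \<eta> / 3"
          using T_scaleR[OF d ju(1)[OF j]] by simp
      qed
      finally have 1: "norm (Q - ?R) \<le> \<eta> / 3" .
      have "?R - (1 / h) *\<^sub>R (T h x - x) = (1 / h) *\<^sub>R ((T h a - T h x) - (a - x))"
        by (simp add: algebra_simps)
      also have "norm \<dots> \<le> (1 / h) * (2 * norm (a - x))"
        using norm_triangle_ineq4[of "T h a - T h x" "a - x"] T_contraction[OF av(2) x, of h] h
        by (simp add: divide_right_mono)
      also have "\<dots> \<le> (1 / h) * (2 * (h * \<eta> / 6))" using a(2) h by (intro mult_left_mono) auto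
      also have "\<dots> = \<eta> / 3" using h by simp
      finally have 2: "norm (?R - (1 / h) *\<^sub>R (T h x - x)) \<le> \<eta> / 3" .
      have 3: "norm ((1 / h) *\<^sub>R (T h x - x) - y) < \<eta> / 3" using \<delta>'(2) h by (simp add: dist_norm)
      have "Q - y = (Q - ?R) + (?R - (1 / h) *\<^sub>R (T h x - x)) + ((1 / h) *\<^sub>R (T h x - x) - y)" by simp
      then have "norm (Q - y) \<le> norm (Q - ?R) + norm (?R - (1 / h) *\<^sub>R (T h x - x)) + norm ((1 / h) *\<^sub>R (T h x - x) - y)"
        by (metis norm_add3_le)
      with 1 2 3 show ?thesis by linarith
    qed
    have "dist (P, Q) p \<le> norm (P - x) + norm (Q - y)"
      unfolding p dist_Pair_Pair by (simp add: dist_norm sqrt_sum_squares_le_sum)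
    also have "\<dots> < \<epsilon>" using Px Qy \<eta> by (simp add: \<eta>_def)
    finally show ?thesis using PQ by blast
  qed
  then have "p \<in> closure (closure G0)" unfolding closure_approachable by blast
  then show "p \<in> closure G0" by simp
qed

theorem GI_eq: "GI = closure G0" "GI = generator (qlA X) T"
  using closure_G0_GI GI_generator generator_closure_G0 by blast+

end

section \<open>Quantum spin systems\<close>

locale spin_system = cstar_algebra star ii
  for star :: "'a::{real_normed_algebra_1,banach} \<Rightarrow> 'a" and ii :: 'a +
  fixes alg :: "(int^'d) set \<Rightarrow> 'a set" and Phi :: "(int^'d) set \<Rightarrow> 'a"
  assumes quasi_local: "quasi_local star ii alg"
    and interaction: "interaction star alg Phi"
    and summable_Phi: "\<And>x. (\<lambda>L. norm (Phi L)) summable_on {L. finite L \<and> x \<in> L}"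
begin

lemma subalgebra_alg: "finite L \<Longrightarrow> cstar_subalgebra star ii (alg L)"
  and alg_mono: "finite L' \<Longrightarrow> L \<subseteq> L' \<Longrightarrow> alg L \<subseteq> alg L'"
  using quasi_local unfolding quasi_local_def
  by (simp_all add: cstar_subalgebra_def cstar_subalgebra_axioms_def cstar_algebra_axioms)

lemma alg_commute:
  "finite L \<Longrightarrow> finite L' \<Longrightarrow> L \<inter> L' = {} \<Longrightarrow> x \<in> alg L \<Longrightarrow> y \<in> alg L' \<Longrightarrow> x * y = y * x"
  using quasi_local unfolding quasi_local_def by blast

lemma Phi_alg: "finite L \<Longrightarrow> Phi L \<in> alg L" and star_Phi: "finite L \<Longrightarrow> star (Phi L) = Phi L"
  using interaction unfolding interaction_def by auto

lemma subspace_alg: "finite L \<Longrightarrow> subspace (alg L)"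
  using cstar_subalgebra.subspace_S[OF subalgebra_alg] .

lemma bounded_linear_cs: "bounded_linear (cs ii c)"
proof (rule bounded_linear_intro[where K="cmod c"])
  show "norm (cs ii c x) \<le> norm x * cmod c" for x by (simp add: norm_cs mult.commute)
qed (auto simp: cs_def algebra_simps)

lemmas cs_add = linear_add[OF bounded_linear.linear[OF bounded_linear_cs]]
  and cs_diff = linear_diff[OF bounded_linear.linear[OF bounded_linear_cs]]
  and cs_sum = linear_sum[OF bounded_linear.linear[OF bounded_linear_cs]]

lemma norm_cs_i: "norm (cs ii \<i> x) = norm x"
  by (simp add: norm_cs)

lemma norm_comm_le: "norm (comm x y) \<le> 2 * norm x * norm (y :: 'a)"
proof -
  have "norm (comm x y) \<le> norm x * norm y + norm y * norm x"
    unfolding comm_def by (intro order_trans[OF norm_triangle_ineq4] add_mono norm_mult_ineq)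
  then show ?thesis by simp
qed

lemma comm_add: "comm x (y + z) = comm x y + comm x (z :: 'a)"
  by (simp add: comm_def algebra_simps)

text \<open>An arbitrary family of regions is allowed so that the difference of two local
  derivations, a sum over \<open>Pow M - Pow L\<close>, has the same form.\<close>

definition dF :: "(int^'d) set set \<Rightarrow> 'a \<Rightarrow> 'a" where
  "dF F a = cs ii \<i> (\<Sum>L\<in>F. comm (Phi L) a)"

lemma dloc_eq_dF: "dloc ii Phi L a = dF (Pow L) a"
  by (simp add: dloc_def dF_def Hloc_def comm_def sum_distrib_left sum_distrib_right sum_subtractf)

lemma dF_add: "dF F (x + y) = dF F x + dF F y"
  by (simp add: dF_def comm_add sum.distrib cs_add)

lemma comm_disjoint:
  "finite L \<Longrightarrow> finite L' \<Longrightarrow> L' \<inter> L = {} \<Longrightarrow> a \<in> alg L \<Longrightarrow> comm (Phi L') a = 0"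
  using alg_commute[of L' L "Phi L'" a] Phi_alg by (simp add: comm_def)

lemma dF_restrict:
  assumes "finite F" "\<And>L'. L' \<in> F \<Longrightarrow> finite L'" "finite L" "a \<in> alg L"
  shows "dF F a = dF {L' \<in> F. L' \<inter> L \<noteq> {}} a"
  unfolding dF_def using assms comm_disjoint[of L _ a]
  by (intro arg_cong[of _ _ "cs ii \<i>"] sum.mono_neutral_right) auto

lemma comm_alg: "finite L \<Longrightarrow> x \<in> alg L \<Longrightarrow> y \<in> alg L \<Longrightarrow> comm x y \<in> alg L"
  unfolding comm_def
  by (intro subspace_diff[OF subspace_alg] cstar_subalgebra.mult_S[OF subalgebra_alg])

lemma cs_alg: "finite L \<Longrightarrow> x \<in> alg L \<Longrightarrow> cs ii c x \<in> alg L"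
  by (rule cstar_subalgebra.cs_S[OF subalgebra_alg])

lemma Hloc_alg: "finite L \<Longrightarrow> Hloc Phi L \<in> alg L"
  unfolding Hloc_def
  by (intro subspace_sum[OF subspace_alg]) (meson PowD Phi_alg alg_mono finite_subset subsetD)+

lemma star_Hloc: "finite L \<Longrightarrow> star (Hloc Phi L) = Hloc Phi L"
  unfolding Hloc_def linear_sum[OF bounded_linear.linear[OF bounded_linear_star]]
  by (intro sum.cong) (auto intro: star_Phi finite_subset)

lemma star_derivation_dloc:
  assumes L: "finite L"
  shows "star_derivation star ii (alg L) (dloc ii Phi L)"
proof -
  define H where "H = Hloc Phi L"
  have H: "H \<in> alg L" "star H = H" using Hloc_alg[OF L] star_Hloc[OF L] by (auto simp: H_def)
  have comm_mult: "comm H (x * y) = comm H x * y + x * comm H y" for x y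
    by (simp add: comm_def algebra_simps)
  have cs_mult: "cs ii c x * y = cs ii c (x * y)" "x * cs ii c y = cs ii c (x * y)" for c x y
  proof -
    show "cs ii c x * y = cs ii c (x * y)" by (simp add: cs_def distrib_right mult.assoc)
    have "x * (ii * y) = ii * (x * y)" by (metis ii_central mult.assoc)
    then show "x * cs ii c y = cs ii c (x * y)" by (simp add: cs_def distrib_left)
  qed
  have cs_cs: "cs ii \<i> (cs ii c x) = cs ii c (cs ii \<i> x)" for c x
    by (simp add: cs_def distrib_left)
  have comm_cs: "comm H (cs ii c x) = cs ii c (comm H x)" for c x
    by (simp add: comm_def cs_mult cs_diff)
  \<comment> \<open>The involution reverses the commutator and changes the sign of
    \<open>ii\<close>; the two signs cancel.\<close>
  have star_comm: "star (cs ii \<i> (comm H x)) = cs ii \<i> (comm H (star x))" for x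
  proof -
    have "star (cs ii \<i> (comm H x)) = (star x * H - H * star x) * (- ii)"
      by (simp add: cs_i comm_def star_mult star_diff star_ii H)
    also have "\<dots> = (H * star x - star x * H) * ii" by (simp add: algebra_simps)
    also have "\<dots> = cs ii \<i> (comm H (star x))" unfolding cs_i comm_def by (rule ii_central[symmetric])
    finally show ?thesis .
  qed
  show ?thesis
    unfolding star_derivation_def dloc_def H_def[symmetric]
    using H by (auto simp: cs_alg comm_alg L comm_add cs_add comm_mult cs_mult cs_cs comm_cs star_comm)
qed

lemma summable_Phi_finite:
  assumes "finite L"
  shows "(\<lambda>L'. norm (Phi L')) summable_on {L'. finite L' \<and> L' \<inter> L \<noteq> {}}"
  using assms
proof (induction L)
  case (insert x L)
  have eq: "{L'. finite L' \<and> L' \<inter> insert x L \<noteq> {}} = {L'. finite L' \<and> x \<in> L'} \<union>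
     ({L'. finite L' \<and> L' \<inter> L \<noteq> {}} - {L'. finite L' \<and> x \<in> L'})" by auto
  show ?case unfolding eq
  proof (rule summable_on_Un_disjoint[OF summable_Phi])
    show "(\<lambda>L'. norm (Phi L')) summable_on ({L'. finite L' \<and> L' \<inter> L \<noteq> {}} - {L'. finite L' \<and> x \<in> L'})"
      by (rule summable_on_subset_banach[OF insert.IH]) auto
  qed auto
qed simp

definition delta :: "(int^'d) set \<Rightarrow> 'a \<Rightarrow> 'a" where
  "delta L a = cs ii \<i> (infsum (\<lambda>L'. comm (Phi L') a) {L'. finite L' \<and> L' \<inter> L \<noteq> {}})"

lemma dloc_tendsto:
  assumes L: "finite L" and a: "a \<in> alg L"
  shows "((\<lambda>M. dloc ii Phi M a) \<longlongrightarrow> delta L a) netF"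
proof -
  let ?S = "{L'. finite L' \<and> L' \<inter> L \<noteq> {}}"
  have "(\<lambda>L'. 2 * norm a * norm (Phi L')) summable_on ?S"
    by (intro summable_on_cmult_right summable_Phi_finite L)
  then have "(\<lambda>L'. norm (comm (Phi L') a)) summable_on ?S"
  proof (rule summable_on_comparison_test)
    show "norm (comm (Phi L') a) \<le> 2 * norm a * norm (Phi L')" for L'
      using norm_comm_le[of "Phi L'" a] by (simp add: mult_ac)
  qed auto
  then have "((\<lambda>L'. comm (Phi L') a) has_sum (infsum (\<lambda>L'. comm (Phi L') a) ?S)) ?S"
    by (rule has_sum_infsum[OF abs_summable_summable])
  then have "(sum (\<lambda>L'. comm (Phi L') a) \<longlongrightarrow> infsum (\<lambda>L'. comm (Phi L') a) ?S) (finite_subsets_at_top ?S)"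
    by (simp add: has_sum_def)
  \<comment> \<open>Summation over the subsets of \<open>M\<close> that meet \<open>L\<close> is a
    reindexing of the unconditional sum: any finite family \<open>F\<close> is included as soon as
    \<open>M\<close> contains its union.\<close>
  moreover have "filterlim (\<lambda>M. {L' \<in> Pow M. L' \<inter> L \<noteq> {}}) (finite_subsets_at_top ?S) netF"
    unfolding filterlim_finite_subsets_at_top
  proof (intro allI impI)
    fix F assume F: "finite F \<and> F \<subseteq> ?S"
    then have "finite (\<Union>F)" by auto
    from eventually_netF_superset[OF this]
    show "\<forall>\<^sub>F M in netF. finite {L' \<in> Pow M. L' \<inter> L \<noteq> {}} \<and> F \<subseteq> {L' \<in> Pow M. L' \<inter> L \<noteq> {}}
        \<and> {L' \<in> Pow M. L' \<inter> L \<noteq> {}} \<subseteq> ?S"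
      by eventually_elim (use F in \<open>auto intro: finite_subset\<close>)
  qed
  ultimately have "((\<lambda>M. \<Sum>L'\<in>{L' \<in> Pow M. L' \<inter> L \<noteq> {}}. comm (Phi L') a) \<longlongrightarrow> infsum (\<lambda>L'. comm (Phi L') a) ?S) netF"
    by (rule filterlim_compose)
  then have "((\<lambda>M. dF {L' \<in> Pow M. L' \<inter> L \<noteq> {}} a) \<longlongrightarrow> delta L a) netF"
    unfolding dF_def delta_def by (rule bounded_linear.tendsto[OF bounded_linear_cs])
  then show ?thesis
  proof (rule Lim_transform_eventually)
    show "\<forall>\<^sub>F M in netF. dF {L' \<in> Pow M. L' \<inter> L \<noteq> {}} a = dloc ii Phi M a"
      using eventually_netF_finite
    proof eventually_elim
      case (elim M)
      have "dF (Pow M) a = dF {L' \<in> Pow M. L' \<inter> L \<noteq> {}} a"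
        by (rule dF_restrict[OF _ _ L a]) (use elim finite_subset in auto)
      then show ?case by (simp add: dloc_eq_dF)
    qed
  qed
qed

end

locale spin_system_boundary = spin_system star ii alg Phi
  for star :: "'a::{real_normed_algebra_1,banach} \<Rightarrow> 'a" and ii :: 'a
    and alg :: "(int^'d) set \<Rightarrow> 'a set" and Phi +
  fixes beta :: "(int^'d) set \<Rightarrow> 'a \<Rightarrow> 'a"
  assumes boundary: "boundary_net star ii alg beta"
begin

abbreviation gen :: "(int^'d) set \<Rightarrow> 'a \<Rightarrow> 'a" where
  "gen \<equiv> \<lambda>L a. dloc ii Phi L a + beta L a"

lemma star_derivation_gen:
  assumes "finite L"
  shows "star_derivation star ii (alg L) (gen L)"
proof -
  have "star_derivation star ii (alg L) (beta L)" using boundary assms unfolding boundary_net_def by blast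
  then show ?thesis
    using star_derivation_dloc[OF assms] subspace_add[OF subspace_alg[OF assms]]
    unfolding star_derivation_def
    by (simp add: cs_add star_add) (simp add: algebra_simps)
qed

lemma cstar_derivation_gen: "finite L \<Longrightarrow> cstar_derivation star ii (alg L) (gen L)"
  using subalgebra_alg star_derivation_gen
  by (simp add: cstar_derivation_def cstar_derivation_axioms_def)

lemma gen_tendsto:
  assumes L: "finite L" and a: "a \<in> alg L"
  shows "((\<lambda>M. gen M a) \<longlongrightarrow> delta L a) netF"
proof -
  have "((\<lambda>M. beta M a) \<longlongrightarrow> 0) netF"
    using boundary L a unfolding boundary_net_def qlD_def by blast
  from tendsto_add[OF dloc_tendsto[OF L a] this] show ?thesis by simp
qed

sublocale dissipative_net alg gen
proof (rule dissipative_net.intro)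
  fix L :: "(int^'d) set" assume L: "finite L"
  interpret cstar_derivation star ii "alg L" "gen L" by (rule cstar_derivation_gen[OF L])
  show "dissipative_operator (alg L) (gen L)"
    by unfold_locales (use closed_S subspace_S D_S D_add D_scaleR dissipative in auto)
next
  fix L L' :: "(int^'d) set" assume "finite L'" "L \<subseteq> L'"
  then show "alg L \<subseteq> alg L'" by (rule alg_mono)
next
  fix a assume "a \<in> qlD alg"
  then show "conv_net (\<lambda>L. gen L a)"
    using gen_tendsto unfolding qlD_def conv_net_def by blast
qed

lemma netlim_gen: "finite L \<Longrightarrow> a \<in> alg L \<Longrightarrow> netlim (\<lambda>M. gen M a) = delta L a"
  by (rule netlim_eqI[OF gen_tendsto])

lemma delta_graph_eq: "delta_graph ii alg Phi = G0"
proof -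
  have "G0 = {(a, netlim (\<lambda>M. gen M a)) | a L. finite L \<and> a \<in> alg L}"
    unfolding G0_def qlD_def by blast
  also have "\<dots> = {(a, delta L a) | a L. finite L \<and> a \<in> alg L}"
    using netlim_gen by (metis (no_types, lifting))
  finally show ?thesis by (simp add: delta_graph_def delta_def)
qed

end

section \<open>Exponentially decaying interactions\<close>

locale short_range_spin_system = spin_system star ii alg Phi
  for star :: "'a::{real_normed_algebra_1,banach} \<Rightarrow> 'a" and ii :: 'a
    and alg :: "(int^'d) set \<Rightarrow> 'a set" and Phi +
  fixes lam N :: real
  assumes lam: "0 < lam" and N: "0 < N"
    and weight_bound: "\<And>F x. finite F \<Longrightarrow> F \<subseteq> {L. finite L \<and> x \<in> L} \<Longrightarrow>
      (\<Sum>L\<in>F. exp (lam * real (card L - 1)) * norm (Phi L)) \<le> N"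
begin

text \<open>The exponent \<open>card L - 1\<close> is the largest number of sites that a commutator
  with \<open>Phi L\<close> can add to a region meeting \<open>L\<close>; the weight pays for this
  growth.\<close>

definition weight :: "(int^'d) set \<Rightarrow> real" where
  "weight L = exp (lam * real (card L - 1)) * norm (Phi L)"

lemma weight_nonneg: "0 \<le> weight L"
  by (simp add: weight_def)

text \<open>A union bound: a region meeting \<open>L\<close> contains at least one of its sites and
  is counted there.\<close>

lemma weight_sum_le:
  assumes "finite F" "\<And>L'. L' \<in> F \<Longrightarrow> finite L'" "finite L"
  shows "(\<Sum>L'\<in>{L' \<in> F. L' \<inter> L \<noteq> {}}. weight L') \<le> real (card L) * N"
proof -
  have "(\<Sum>L'\<in>{L' \<in> F. L' \<inter> L \<noteq> {}}. weight L') = (\<Sum>L'\<in>F. if L' \<inter> L \<noteq> {} then weight L' else 0)"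
    using assms by (simp add: sum.inter_filter)
  also have "\<dots> \<le> (\<Sum>L'\<in>F. \<Sum>x\<in>L. if x \<in> L' then weight L' else 0)"
  proof (rule sum_mono)
    fix L' 
    show "(if L' \<inter> L \<noteq> {} then weight L' else 0) \<le> (\<Sum>x\<in>L. if x \<in> L' then weight L' else 0)"
    proof (cases "L' \<inter> L = {}")
      case False
      then obtain x where "x \<in> L" "x \<in> L'" by blast
      then show ?thesis
        using member_le_sum[of x L "\<lambda>x. if x \<in> L' then weight L' else 0"] assms weight_nonneg by auto
    qed (simp add: sum_nonneg weight_nonneg)
  qed
  also have "\<dots> = (\<Sum>x\<in>L. \<Sum>L'\<in>F. if x \<in> L' then weight L' else 0)" by (rule sum.swap)
  also have "\<dots> = (\<Sum>x\<in>L. \<Sum>L'\<in>{L' \<in> F. x \<in> L'}. weight L')"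
    using assms by (simp add: sum.inter_filter)
  also have "\<dots> \<le> (\<Sum>x\<in>L. N)"
    unfolding weight_def using assms by (intro sum_mono weight_bound) auto
  finally show ?thesis by simp
qed

text \<open>\<open>decomp \<sigma> x c\<close>: \<open>x\<close> is a finite sum of local elements \<open>a\<^sub>j \<in> alg L\<^sub>j\<close> with
  \<open>\<Sum> e\<^bsup>\<sigma>|L\<^sub>j|\<^esup> \<parallel>a\<^sub>j\<parallel> \<le> c\<close>. The infima of such \<open>c\<close> form a scale of norms in which a local
  Hamiltonian loses an arbitrarily small part of the exponent.\<close>
inductive decomp :: "real \<Rightarrow> 'a \<Rightarrow> real \<Rightarrow> bool" for \<sigma> where
  base: "finite L \<Longrightarrow> a \<in> alg L \<Longrightarrow> exp (\<sigma> * real (card L)) * norm a \<le> c \<Longrightarrow> decomp \<sigma> a c"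
| add: "decomp \<sigma> x c \<Longrightarrow> decomp \<sigma> y d \<Longrightarrow> decomp \<sigma> (x + y) (c + d)"

lemma decomp_0: "0 \<le> c \<Longrightarrow> decomp \<sigma> 0 c"
  by (rule base[of "{}"]) (auto simp: subspace_0[OF subspace_alg])

lemma decomp_mono: "decomp \<sigma> x c \<Longrightarrow> c \<le> d \<Longrightarrow> decomp \<sigma> x d"
  using add[of \<sigma> x c 0 "d - c"] decomp_0[of "d - c" \<sigma>] by simp

lemma decomp_sum:
  "(\<And>i. i \<in> I \<Longrightarrow> decomp \<sigma> (f i) (c i)) \<Longrightarrow> decomp \<sigma> (\<Sum>i\<in>I. f i) (\<Sum>i\<in>I. c i)"
  by (induction I rule: infinite_finite_induct) (auto simp: decomp_0 add)

lemma decomp_norm: "decomp \<sigma> x c \<Longrightarrow> 0 \<le> \<sigma> \<Longrightarrow> norm x \<le> c"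
proof (induction rule: decomp.induct)
  case (base L a c)
  have "1 * norm a \<le> exp (\<sigma> * real (card L)) * norm a"
    using base by (intro mult_right_mono) auto
  with base show ?case by simp
next
  case (add x c y d)
  then show ?case using norm_triangle_ineq[of x y] by simp
qed

text \<open>Overlapping regions satisfy
  \<open>card (L \<union> L') \<le> card L + (card L' - 1)\<close>. As
  \<open>\<sigma> \<le> lam\<close>, the enlarged support is absorbed by \<open>weight L'\<close>,
  and the factor 2 comes from the commutator.\<close>

lemma local_decomp:
  assumes L: "finite L" "a \<in> alg L" and F: "finite F" "\<And>L'. L' \<in> F \<Longrightarrow> finite L'"
    and \<sigma>: "0 \<le> \<sigma>" "\<sigma> \<le> lam"
  shows "decomp \<sigma> (dF F a) (2 * norm a * exp (\<sigma> * real (card L)) * (\<Sum>L'\<in>{L' \<in> F. L' \<inter> L \<noteq> {}}. weight L'))"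
proof -
  have "dF F a = (\<Sum>L'\<in>{L' \<in> F. L' \<inter> L \<noteq> {}}. cs ii \<i> (comm (Phi L') a))"
    by (subst dF_restrict[OF F L]) (simp_all add: dF_def cs_sum)
  moreover have "decomp \<sigma> (cs ii \<i> (comm (Phi L') a)) (2 * norm a * exp (\<sigma> * real (card L)) * weight L')"
    if L': "L' \<in> {L' \<in> F. L' \<inter> L \<noteq> {}}" for L'
  proof (rule base)
    have fin: "finite L'" "finite (L \<union> L')" using L' F L by auto
    show "finite (L \<union> L')" by (rule fin)
    have "Phi L' \<in> alg (L \<union> L')" "a \<in> alg (L \<union> L')"
      using Phi_alg[OF fin(1)] L(2) alg_mono[OF fin(2), of L] alg_mono[OF fin(2), of L'] by auto
    then show "cs ii \<i> (comm (Phi L') a) \<in> alg (L \<union> L')"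
      by (intro cs_alg comm_alg fin)
    have "card (L' \<inter> L) > 0" using L' fin(1) by (simp add: card_gt_0_iff)
    then have "card (L \<union> L') \<le> card L + (card L' - 1)"
      using card_Un_Int[OF L(1) fin(1)] by (simp add: Int_commute)
    then have "real (card (L \<union> L')) \<le> real (card L) + real (card L' - 1)"
      by (metis of_nat_add of_nat_le_iff)
    then have "\<sigma> * real (card (L \<union> L')) \<le> \<sigma> * (real (card L) + real (card L' - 1))"
      using \<sigma> by (intro mult_left_mono)
    also have "\<dots> \<le> \<sigma> * real (card L) + lam * real (card L' - 1)"
      using \<sigma> by (simp add: distrib_left mult_right_mono)
    finally have "exp (\<sigma> * real (card (L \<union> L'))) \<le> exp (\<sigma> * real (card L)) * exp (lam * real (card L' - 1))"
      by (simp flip: exp_add)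
    then have "exp (\<sigma> * real (card (L \<union> L'))) * norm (cs ii \<i> (comm (Phi L') a))
       \<le> (exp (\<sigma> * real (card L)) * exp (lam * real (card L' - 1))) * (2 * norm (Phi L') * norm a)"
      unfolding norm_cs_i by (intro mult_mono norm_comm_le) auto
    then show "exp (\<sigma> * real (card (L \<union> L'))) * norm (cs ii \<i> (comm (Phi L') a))
       \<le> 2 * norm a * exp (\<sigma> * real (card L)) * weight L'"
      by (simp add: weight_def mult_ac)
  qed
  ultimately show ?thesis
    using decomp_sum[of "{L' \<in> F. L' \<inter> L \<noteq> {}}" \<sigma> "\<lambda>L'. cs ii \<i> (comm (Phi L') a)"
        "\<lambda>L'. 2 * norm a * exp (\<sigma> * real (card L)) * weight L'"]
    by (simp add: sum_distrib_left)
qed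

text \<open>The number of sites where a region can attach contributes a factor
  \<open>card L\<close>, which no fixed exponent controls. Giving up
  \<open>\<sigma> - \<sigma>'\<close> pays for it, by \<open>n \<le> exp ((\<sigma> - \<sigma>') *
  n) / (\<sigma> - \<sigma>')\<close>.\<close>

lemma decomp_dF:
  assumes "decomp \<sigma> x c" and \<sigma>: "0 \<le> \<sigma>'" "\<sigma>' < \<sigma>" "\<sigma> \<le> lam"
    and F: "finite F" "\<And>L'. L' \<in> F \<Longrightarrow> finite L'"
  shows "decomp \<sigma>' (dF F x) (2 * N / (\<sigma> - \<sigma>') * c)"
  using assms(1)
proof (induction rule: decomp.induct)
  case (base L a c)
  let ?n = "real (card L)"
  have n: "?n \<le> exp ((\<sigma> - \<sigma>') * ?n) / (\<sigma> - \<sigma>')"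
    using exp_ge_add_one_self[of "(\<sigma> - \<sigma>') * ?n"] \<sigma> by (simp add: field_simps)
  have "2 * norm a * exp (\<sigma>' * ?n) * (\<Sum>L'\<in>{L' \<in> F. L' \<inter> L \<noteq> {}}. weight L')
      \<le> 2 * norm a * exp (\<sigma>' * ?n) * (?n * N)"
    by (intro mult_left_mono weight_sum_le F base) auto
  also have "\<dots> \<le> 2 * norm a * exp (\<sigma>' * ?n) * (exp ((\<sigma> - \<sigma>') * ?n) / (\<sigma> - \<sigma>') * N)"
    using N by (intro mult_left_mono mult_right_mono n) auto
  also have "\<dots> = 2 * N / (\<sigma> - \<sigma>') * ((exp (\<sigma>' * ?n) * exp ((\<sigma> - \<sigma>') * ?n)) * norm a)"
    by simp
  also have "exp (\<sigma>' * ?n) * exp ((\<sigma> - \<sigma>') * ?n) = exp (\<sigma> * ?n)"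
    by (simp add: algebra_simps flip: exp_add)
  also have "2 * N / (\<sigma> - \<sigma>') * (exp (\<sigma> * ?n) * norm a) \<le> 2 * N / (\<sigma> - \<sigma>') * c"
    using base N \<sigma> by (intro mult_left_mono) auto
  finally show ?case
    using decomp_mono[OF local_decomp[OF base(1,2) F \<sigma>(1)]] \<sigma> by simp
next
  case (add x c y d)
  show ?case unfolding dF_add distrib_left by (rule decomp.add[OF add.IH])
qed

text \<open>The weights of regions meeting \<open>L\<close> are summable. If \<open>F1\<close>
  nearly exhausts the sum, a region not inside \<open>\<Union>F1\<close> cannot belong to
  \<open>F1\<close>, so such regions lie in the tail.\<close>

lemma weight_tail:
  assumes "finite L" "0 < \<epsilon>"
  shows "\<exists>L1. finite L1 \<and> (\<forall>F. finite F \<and> (\<forall>L'\<in>F. finite L' \<and> \<not> L' \<subseteq> L1) \<longrightarrow>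
    (\<Sum>L'\<in>{L' \<in> F. L' \<inter> L \<noteq> {}}. weight L') < \<epsilon>)"
proof -
  let ?S = "{L'. finite L' \<and> L' \<inter> L \<noteq> {}}"
  have "weight summable_on ?S"
  proof (rule nonneg_bdd_above_summable_on[OF weight_nonneg])
    show "bdd_above (sum weight ` {F. F \<subseteq> ?S \<and> finite F})"
    proof (rule bdd_aboveI2[where M="real (card L) * N"])
      fix F assume F: "F \<in> {F. F \<subseteq> ?S \<and> finite F}"
      then have "{L' \<in> F. L' \<inter> L \<noteq> {}} = F" by auto
      with weight_sum_le[of F L] F assms show "sum weight F \<le> real (card L) * N" by auto
    qed
  qed
  then have "(sum weight \<longlongrightarrow> infsum weight ?S) (finite_subsets_at_top ?S)"
    using has_sum_infsum unfolding has_sum_def by blast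
  from tendstoD[OF this half_gt_zero[OF assms(2)]]
  have "\<exists>F1. finite F1 \<and> F1 \<subseteq> ?S \<and>
    (\<forall>F. finite F \<and> F1 \<subseteq> F \<and> F \<subseteq> ?S \<longrightarrow> dist (sum weight F) (infsum weight ?S) < \<epsilon> / 2)"
    unfolding eventually_finite_subsets_at_top .
  then obtain F1 where F1: "finite F1" "F1 \<subseteq> ?S" and near:
    "\<forall>F. finite F \<and> F1 \<subseteq> F \<and> F \<subseteq> ?S \<longrightarrow> dist (sum weight F) (infsum weight ?S) < \<epsilon> / 2"
    by (elim exE conjE)
  show ?thesis
  proof (intro exI[of _ "\<Union>F1"] conjI allI impI)
    show "finite (\<Union>F1)" using F1 by auto
    fix F assume F: "finite F \<and> (\<forall>L'\<in>F. finite L' \<and> \<not> L' \<subseteq> \<Union>F1)"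
    define F2 where "F2 = {L' \<in> F. L' \<inter> L \<noteq> {}}"
    have F2: "finite F2" "F2 \<subseteq> ?S" "F1 \<inter> F2 = {}" using F by (auto simp: F2_def)
    have "sum weight (F1 \<union> F2) = sum weight F1 + sum weight F2"
      using F1 F2 by (intro sum.union_disjoint) auto
    moreover have "dist (sum weight (F1 \<union> F2)) (infsum weight ?S) < \<epsilon> / 2"
      using F1 F2 by (intro near[rule_format]) auto
    moreover have "dist (sum weight F1) (infsum weight ?S) < \<epsilon> / 2" using F1 by (intro near[rule_format]) auto
    ultimately show "(\<Sum>L'\<in>{L' \<in> F. L' \<inter> L \<noteq> {}}. weight L') < \<epsilon>"
      unfolding F2_def[symmetric] dist_real_def by linarith
  qed
qed

lemma decomp_dF_tail:
  assumes x: "x \<in> qlD alg" and \<sigma>: "0 \<le> \<sigma>" "\<sigma> \<le> lam" and \<epsilon>: "0 < \<epsilon>"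
  shows "\<exists>L1. finite L1 \<and> (\<forall>F. finite F \<and> (\<forall>L'\<in>F. finite L' \<and> \<not> L' \<subseteq> L1) \<longrightarrow> decomp \<sigma> (dF F x) \<epsilon>)"
proof -
  obtain L where L: "finite L" "x \<in> alg L" using x by (auto simp: qlD_def)
  define C where "C = 2 * norm x * exp (\<sigma> * real (card L)) + 1"
  have C: "1 \<le> C" by (simp add: C_def)
  obtain L1 where L1: "finite L1" "\<And>F. finite F \<Longrightarrow> \<forall>L'\<in>F. finite L' \<and> \<not> L' \<subseteq> L1 \<Longrightarrow>
    (\<Sum>L'\<in>{L' \<in> F. L' \<inter> L \<noteq> {}}. weight L') < \<epsilon> / C"
    using weight_tail[OF L(1), of "\<epsilon> / C"] C \<epsilon> by auto
  show ?thesis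
  proof (intro exI[of _ L1] conjI L1(1) allI impI)
    fix F assume F: "finite F \<and> (\<forall>L'\<in>F. finite L' \<and> \<not> L' \<subseteq> L1)"
    let ?w = "\<Sum>L'\<in>{L' \<in> F. L' \<inter> L \<noteq> {}}. weight L'"
    have "2 * norm x * exp (\<sigma> * real (card L)) * ?w \<le> C * ?w"
      by (intro mult_right_mono sum_nonneg weight_nonneg) (simp add: C_def)
    also have "\<dots> \<le> C * (\<epsilon> / C)" using L1(2)[of F] F C by (intro mult_left_mono) auto
    finally have "2 * norm x * exp (\<sigma> * real (card L)) * ?w \<le> \<epsilon>" using C by simp
    then show "decomp \<sigma> (dF F x) \<epsilon>"
      using decomp_mono[OF local_decomp[OF L _ _ \<sigma>]] F by blast
  qed
qed

section \<open>Iterated local commutators\<close>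

abbreviation dl :: "(int^'d) set \<Rightarrow> 'a \<Rightarrow> 'a" where "dl L \<equiv> dF (Pow L)"

lemma dl_qlD: "finite L \<Longrightarrow> a \<in> qlD alg \<Longrightarrow> dl L a \<in> qlD alg"
proof -
  assume L: "finite L" and "a \<in> qlD alg"
  then obtain L0 where L0: "finite L0" "a \<in> alg L0" by (auto simp: qlD_def)
  have a: "a \<in> alg (L \<union> L0)" using L0 L alg_mono[of "L \<union> L0" L0] by auto
  have "(\<Sum>L'\<in>Pow L. comm (Phi L') a) \<in> alg (L \<union> L0)"
  proof (rule subspace_sum[OF subspace_alg])
    fix L' assume "L' \<in> Pow L"
    then have "Phi L' \<in> alg (L \<union> L0)"
      using Phi_alg[of L'] alg_mono[of "L \<union> L0" L'] L L0 finite_subset[of L' L] by auto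
    then show "comm (Phi L') a \<in> alg (L \<union> L0)" using a L L0 by (intro comm_alg) auto
  qed (use L L0 in auto)
  then have "dl L a \<in> alg (L \<union> L0)" unfolding dF_def using L L0 by (intro cs_alg) auto
  then show ?thesis using L L0 by (auto simp: qlD_def intro!: exI[of _ "L \<union> L0"])
qed

lemma dl_pow_qlD: "finite L \<Longrightarrow> a \<in> qlD alg \<Longrightarrow> (dl L ^^ n) a \<in> qlD alg"
  by (induction n) (auto intro: dl_qlD)

text \<open>The exponent \<open>lam\<close> is spent in \<open>n\<close> equal portions: each
  commutator lowers it by \<open>lam / n\<close> at the price of a factor
  \<open>q = 2 * N * n / lam\<close>. After \<open>n\<close> steps it is 0, where
  \<open>decomp\<close> bounds the norm, and \<open>n ^ n \<le> exp n * fact n\<close> gives the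
  factorial growth. The bound is uniform in \<open>L\<close>.\<close>

lemma dl_pow_bound:
  assumes L: "finite L" and L0: "finite L0" "a \<in> alg L0"
  shows "norm ((dl L ^^ n) a) \<le> (exp (lam * real (card L0)) * norm a) * fact n * (2 * N * exp 1 / lam) ^ n"
proof (cases "n = 0")
  case True
  have "1 * norm a \<le> exp (lam * real (card L0)) * norm a"
    using lam by (intro mult_right_mono) auto
  then show ?thesis using True by simp
next
  case False
  define c where "c = exp (lam * real (card L0)) * norm a"
  define q where "q = 2 * N * real n / lam"
  have "decomp (lam * (1 - real k / real n)) ((dl L ^^ k) a) (q ^ k * c)" if "k \<le> n" for k
    using that
  proof (induction k)
    case 0
    show ?case by (simp add: c_def) (rule base[OF L0], simp)
  next
    case (Suc k)
    let ?s = "lam * (1 - real k / real n)" and ?s' = "lam * (1 - real (Suc k) / real n)"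
    have diff: "?s - ?s' = lam / real n" using False by (simp add: field_simps)
    have "decomp ?s' (dl L ((dl L ^^ k) a)) (2 * N / (?s - ?s') * (q ^ k * c))"
    proof (rule decomp_dF)
      show "decomp ?s ((dl L ^^ k) a) (q ^ k * c)" using Suc by simp
      show "0 \<le> ?s'" using Suc.prems False lam by simp
      show "?s' < ?s" using lam False by (intro mult_strict_left_mono) (auto simp: divide_strict_right_mono)
      show "?s \<le> lam" using lam False by (simp add: mult_left_le)
    qed (use L in \<open>auto intro: finite_subset\<close>)
    then show ?case unfolding diff by (simp add: q_def mult_ac)
  qed
  from this[of n] have "norm ((dl L ^^ n) a) \<le> q ^ n * c"
    using False by (auto dest: decomp_norm)
  also have "q ^ n = (2 * N / lam) ^ n * real n ^ n"
    by (simp add: q_def power_mult_distrib power_divide)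
  also have "real n ^ n \<le> exp (real n) * fact n"
  proof -
    have "(\<lambda>k. real n ^ k / fact k) sums exp (real n)"
      using exp_converges[of "real n"] by (simp add: divide_inverse mult.commute)
    then have "(\<Sum>k\<in>{n}. real n ^ k / fact k) \<le> exp (real n)"
      by (intro sum_le_suminf[of "\<lambda>k. real n ^ k / fact k", THEN order_trans]) (auto simp: sums_iff)
    then show ?thesis by (simp add: divide_le_eq)
  qed
  also have "exp (real n) = exp 1 ^ n" by (simp flip: exp_of_nat_mult)
  finally have "norm ((dl L ^^ n) a) \<le> (2 * N / lam) ^ n * (exp 1 ^ n * fact n) * c"
    using N lam by (simp add: c_def mult_left_mono mult_right_mono)
  also have "\<dots> = c * fact n * (2 * N * exp 1 / lam) ^ n"
    by (simp add: power_mult_distrib power_divide)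
  finally show ?thesis by (simp add: c_def)
qed

lemma dl_diff: "finite M \<Longrightarrow> L \<subseteq> M \<Longrightarrow> dl M y - dl L y = dF (Pow M - Pow L) y"
  unfolding dF_def cs_diff[symmetric] by (subst sum_diff) auto

lemma dF_diff: "dF F (x - y) = dF F x - dF F y"
  using dF_add[of F "x - y" y] by simp

text \<open>These are the two terms of the next difference of iterates. The tail estimate needs a
  fixed local element, but \<open>(dl L ^^ n) a\<close> moves with \<open>L\<close>; it is therefore
  compared with the iterate at \<open>L1\<close>, and \<open>\<eta>\<close> compensates the loss
  from the intermediate exponent \<open>s\<close> down to \<open>\<sigma>\<close>.\<close>

lemma dl_pow_cauchy_step:
  assumes a: "a \<in> qlD alg"
    and P: "\<And>\<sigma> \<epsilon>. 0 \<le> \<sigma> \<Longrightarrow> \<sigma> < lam \<Longrightarrow> 0 < \<epsilon> \<Longrightarrow> \<exists>L1. finite L1 \<and>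
      (\<forall>L M. finite M \<and> L1 \<subseteq> L \<and> L \<subseteq> M \<longrightarrow> decomp \<sigma> ((dl M ^^ n) a - (dl L ^^ n) a) \<epsilon>)"
    and \<sigma>: "0 \<le> \<sigma>" "\<sigma> < lam" and \<epsilon>: "0 < \<epsilon>"
  shows "\<exists>L1. finite L1 \<and> (\<forall>L M. finite M \<and> L1 \<subseteq> L \<and> L \<subseteq> M \<longrightarrow>
      decomp \<sigma> (dF (Pow M - Pow L) ((dl L ^^ n) a)) \<epsilon> \<and>
      decomp \<sigma> (dl M ((dl M ^^ n) a - (dl L ^^ n) a)) \<epsilon>)"
proof -
  define s where "s = (\<sigma> + lam) / 2"
  have s: "0 \<le> s" "\<sigma> < s" "s < lam" using \<sigma> by (auto simp: s_def)
  define \<eta> where "\<eta> = (\<epsilon> / 2) * (s - \<sigma>) / (2 * N)"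
  have \<eta>: "0 < \<eta>" using \<epsilon> s N by (simp add: \<eta>_def)
  have \<eta>_eq: "2 * N / (s - \<sigma>) * \<eta> = \<epsilon> / 2" using N s by (simp add: \<eta>_def)
  obtain L1 where L1: "finite L1"
    "\<And>L M. finite M \<and> L1 \<subseteq> L \<and> L \<subseteq> M \<Longrightarrow> decomp s ((dl M ^^ n) a - (dl L ^^ n) a) \<eta>"
    using P[OF s(1,3) \<eta>] by iprover
  have "(dl L1 ^^ n) a \<in> qlD alg" using dl_pow_qlD[OF L1(1) a] .
  from decomp_dF_tail[OF this \<sigma>(1) less_imp_le[OF \<sigma>(2)] half_gt_zero[OF \<epsilon>]]
  obtain L2 where L2: "finite L2"
    "\<And>F. finite F \<and> (\<forall>L'\<in>F. finite L' \<and> \<not> L' \<subseteq> L2) \<Longrightarrow> decomp \<sigma> (dF F ((dl L1 ^^ n) a)) (\<epsilon> / 2)"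
    by iprover
  show ?thesis
  proof (intro exI[of _ "L1 \<union> L2"] conjI allI impI)
    show "finite (L1 \<union> L2)" using L1 L2 by simp
    fix L M assume LM: "finite M \<and> L1 \<union> L2 \<subseteq> L \<and> L \<subseteq> M"
    then have L: "finite L" using finite_subset by blast
    have fin: "finite L'" if "L' \<in> Pow M" for L' using that LM finite_subset by blast
    have "decomp \<sigma> (dF (Pow M - Pow L) ((dl L ^^ n) a - (dl L1 ^^ n) a)) (\<epsilon> / 2)"
      unfolding \<eta>_eq[symmetric] using s \<sigma> L1 L LM fin by (intro decomp_dF[of s]) auto
    moreover have "decomp \<sigma> (dF (Pow M - Pow L) ((dl L1 ^^ n) a)) (\<epsilon> / 2)"
      using LM fin by (intro L2(2)) auto
    ultimately have "decomp \<sigma> (dF (Pow M - Pow L) ((dl L ^^ n) a - (dl L1 ^^ n) a) + dF (Pow M - Pow L) ((dl L1 ^^ n) a)) (\<epsilon> / 2 + \<epsilon> / 2)"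
      by (rule add)
    then show "decomp \<sigma> (dF (Pow M - Pow L) ((dl L ^^ n) a)) \<epsilon>" by (simp add: dF_diff)
    have "decomp \<sigma> (dl M ((dl M ^^ n) a - (dl L ^^ n) a)) (\<epsilon> / 2)"
      unfolding \<eta>_eq[symmetric] using s \<sigma> L1 LM fin by (intro decomp_dF[of s]) auto
    then show "decomp \<sigma> (dl M ((dl M ^^ n) a - (dl L ^^ n) a)) \<epsilon>"
      by (rule decomp_mono) (use \<epsilon> in simp)
  qed
qed

text \<open>The induction runs over all exponents below \<open>lam\<close> simultaneously, because
  each step consumes part of the exponent.\<close>

lemma dl_pow_cauchy:
  assumes a: "a \<in> qlD alg" and "0 \<le> \<sigma>" "\<sigma> < lam" "0 < \<epsilon>"
  shows "\<exists>L1. finite L1 \<and>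
      (\<forall>L M. finite M \<and> L1 \<subseteq> L \<and> L \<subseteq> M \<longrightarrow> decomp \<sigma> ((dl M ^^ n) a - (dl L ^^ n) a) \<epsilon>)"
  using assms(2-)
proof (induction n arbitrary: \<sigma> \<epsilon>)
  case 0
  then show ?case by (intro exI[of _ "{}"]) (auto intro: decomp_0)
next
  case (Suc n)
  obtain L1 where L1: "finite L1" "\<And>L M. finite M \<and> L1 \<subseteq> L \<and> L \<subseteq> M \<Longrightarrow>
      decomp \<sigma> (dF (Pow M - Pow L) ((dl L ^^ n) a)) (\<epsilon> / 2) \<and>
      decomp \<sigma> (dl M ((dl M ^^ n) a - (dl L ^^ n) a)) (\<epsilon> / 2)"
    using dl_pow_cauchy_step[OF a Suc.IH Suc.prems(1,2) half_gt_zero[OF Suc.prems(3)]] by iprover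
  show ?case
  proof (intro exI[of _ L1] conjI L1(1) allI impI)
    fix L M assume LM: "finite M \<and> L1 \<subseteq> L \<and> L \<subseteq> M"
    have "(dl M ^^ Suc n) a - (dl L ^^ Suc n) a
        = dl M ((dl M ^^ n) a - (dl L ^^ n) a) + dF (Pow M - Pow L) ((dl L ^^ n) a)"
      using LM by (simp add: dF_diff flip: dl_diff)
    moreover have "decomp \<sigma> (dl M ((dl M ^^ n) a - (dl L ^^ n) a) + dF (Pow M - Pow L) ((dl L ^^ n) a)) (\<epsilon> / 2 + \<epsilon> / 2)"
      using L1(2)[OF LM] by (intro add) simp_all
    ultimately show "decomp \<sigma> ((dl M ^^ Suc n) a - (dl L ^^ Suc n) a) \<epsilon>" by simp
  qed
qed

lemma conv_net_dl_pow:
  assumes a: "a \<in> qlD alg"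
  shows "conv_net (\<lambda>L. (dl L ^^ n) a)"
proof (rule conv_net_approxI)
  fix \<epsilon> :: real assume \<epsilon>: "0 < \<epsilon>"
  obtain L1 where L1: "finite L1"
    "\<And>L M. finite M \<and> L1 \<subseteq> L \<and> L \<subseteq> M \<Longrightarrow> decomp 0 ((dl M ^^ n) a - (dl L ^^ n) a) (\<epsilon> / 2)"
    using dl_pow_cauchy[OF a order_refl lam half_gt_zero[OF \<epsilon>]] by iprover
  show "\<exists>b. conv_net b \<and> (\<forall>\<^sub>F L in netF. dist ((dl L ^^ n) a) (b L) < \<epsilon>)"
  proof (intro exI conjI)
    show "conv_net (\<lambda>_. (dl L1 ^^ n) a)" unfolding conv_net_def using tendsto_const by blast
    show "\<forall>\<^sub>F L in netF. dist ((dl L ^^ n) a) ((dl L1 ^^ n) a) < \<epsilon>"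
      using eventually_netF_superset[OF L1(1)]
    proof eventually_elim
      case (elim L)
      then show ?case using decomp_norm[OF L1(2)[of L L1]] \<epsilon> by (simp add: dist_norm)
    qed
  qed
qed

text \<open>At a late \<open>L\<close> the iterate \<open>b\<close> is local, so
  \<open>(b, delta L0 b)\<close> lies in the graph. Its image is the limit of \<open>dl M b\<close>,
  and \<open>dl M b - dl L b\<close> is a tail that is small uniformly in \<open>M\<close>; hence it
  is close to \<open>dl L b\<close>, the next iterate.\<close>

lemma dl_pow_limit_graph:
  assumes a: "a \<in> qlD alg"
  shows "(netlim (\<lambda>L. (dl L ^^ n) a), netlim (\<lambda>L. (dl L ^^ Suc n) a)) \<in> closure (delta_graph ii alg Phi)"
  unfolding closure_approachable
proof (intro allI impI)
  fix \<epsilon> :: real assume \<epsilon>: "0 < \<epsilon>"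
  let ?x = "netlim (\<lambda>L. (dl L ^^ n) a)" and ?y = "netlim (\<lambda>L. (dl L ^^ Suc n) a)"
  have P: "\<exists>L1. finite L1 \<and>
      (\<forall>L M. finite M \<and> L1 \<subseteq> L \<and> L \<subseteq> M \<longrightarrow> decomp \<sigma> ((dl M ^^ n) a - (dl L ^^ n) a) \<epsilon>)"
    if "0 \<le> \<sigma>" "\<sigma> < lam" "0 < \<epsilon>" for \<sigma> \<epsilon> using dl_pow_cauchy[OF a that] .
  have "0 < \<epsilon> / 4" using \<epsilon> by simp
  from dl_pow_cauchy_step[OF a P order_refl lam this]
  obtain L1 where L1: "finite L1" "\<And>L M. finite M \<and> L1 \<subseteq> L \<and> L \<subseteq> M \<Longrightarrow>
      decomp 0 (dF (Pow M - Pow L) ((dl L ^^ n) a)) (\<epsilon> / 4)"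
    by iprover
  have "\<forall>\<^sub>F L in netF. dist ((dl L ^^ n) a) ?x < \<epsilon> / 4"
    using \<epsilon> by (intro tendstoD conv_net_tendsto conv_net_dl_pow a) auto
  moreover have "\<forall>\<^sub>F L in netF. dist ((dl L ^^ Suc n) a) ?y < \<epsilon> / 4"
    using \<epsilon> by (intro tendstoD conv_net_tendsto conv_net_dl_pow a) auto
  moreover note eventually_netF_superset[OF L1(1)]
  ultimately have "\<forall>\<^sub>F L in netF. dist ((dl L ^^ n) a) ?x < \<epsilon> / 4 \<and> dist ((dl L ^^ Suc n) a) ?y < \<epsilon> / 4 \<and> finite L \<and> L1 \<subseteq> L"
    by eventually_elim auto
  then obtain L where L: "dist ((dl L ^^ n) a) ?x < \<epsilon> / 4" "dist ((dl L ^^ Suc n) a) ?y < \<epsilon> / 4" "finite L" "L1 \<subseteq> L"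
    using eventually_happens[of _ netF] by auto
  define b where "b = (dl L ^^ n) a"
  obtain L0 where L0: "finite L0" "b \<in> alg L0"
    using dl_pow_qlD[OF L(3) a] unfolding b_def qlD_def by auto
  have "dist (delta L0 b) (dl L b) \<le> \<epsilon> / 4"
  proof (rule tendsto_upperbound)
    show "((\<lambda>M. dist (dl M b) (dl L b)) \<longlongrightarrow> dist (delta L0 b) (dl L b)) netF"
      using dloc_tendsto[OF L0] unfolding dloc_eq_dF by (intro tendsto_dist tendsto_const)
    show "\<forall>\<^sub>F M in netF. dist (dl M b) (dl L b) \<le> \<epsilon> / 4"
      using eventually_netF_superset[OF L(3)]
    proof eventually_elim
      case (elim M)
      then show ?case
        using decomp_norm[OF L1(2)[of M L]] L(4) dl_diff[of M L b] by (simp add: dist_norm b_def)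
    qed
  qed simp
  then have "dist (delta L0 b) ?y \<le> \<epsilon> / 4 + \<epsilon> / 4"
    using L(2) dist_triangle[of "delta L0 b" ?y "dl L b"] by (simp add: b_def)
  moreover have "dist (b, delta L0 b) (?x, ?y) \<le> dist b ?x + dist (delta L0 b) ?y"
    unfolding dist_Pair_Pair by (rule sqrt_sum_squares_le_sum) auto
  ultimately have "dist (b, delta L0 b) (?x, ?y) < \<epsilon>" using L(1) \<epsilon> by (simp add: b_def)
  moreover have "(b, delta L0 b) \<in> delta_graph ii alg Phi"
    unfolding delta_graph_def delta_def using L0 by blast
  ultimately show "\<exists>p\<in>delta_graph ii alg Phi. dist p (?x, ?y) < \<epsilon>" by blast
qed

lemma analytic_vectors:
  assumes a: "a \<in> qlD alg"
  shows "\<exists>v C. v 0 = a \<and> (\<forall>n. (v n, v (Suc n)) \<in> closure (delta_graph ii alg Phi))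
      \<and> (\<forall>n. norm (v n) \<le> C * fact n * (2 * N * exp 1 / lam) ^ n)"
proof -
  obtain L0 where L0: "finite L0" "a \<in> alg L0" using a by (auto simp: qlD_def)
  show ?thesis
  proof (intro exI[of _ "\<lambda>n. netlim (\<lambda>L. (dl L ^^ n) a)"] exI[of _ "exp (lam * real (card L0)) * norm a"] conjI allI)
    show "netlim (\<lambda>L. (dl L ^^ 0) a) = a" by (simp add: netlim_eqI[OF tendsto_const])
    fix n
    show "(netlim (\<lambda>L. (dl L ^^ n) a), netlim (\<lambda>L. (dl L ^^ Suc n) a)) \<in> closure (delta_graph ii alg Phi)"
      by (rule dl_pow_limit_graph[OF a])
    show "norm (netlim (\<lambda>L. (dl L ^^ n) a)) \<le> exp (lam * real (card L0)) * norm a * fact n * (2 * N * exp 1 / lam) ^ n"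
    proof (rule tendsto_upperbound[OF tendsto_norm[OF conv_net_tendsto[OF conv_net_dl_pow[OF a]]]])
      show "\<forall>\<^sub>F L in netF. norm ((dl L ^^ n) a) \<le> exp (lam * real (card L0)) * norm a * fact n * (2 * N * exp 1 / lam) ^ n"
        using eventually_netF_finite by eventually_elim (rule dl_pow_bound[OF _ L0])
    qed simp
  qed
qed

end

section \<open>Convergence of the dynamics\<close>

locale short_range_spin_system_boundary =
  spin_system_boundary star ii alg Phi beta + short_range_spin_system star ii alg Phi lam N
  for star :: "'a::{real_normed_algebra_1,banach} \<Rightarrow> 'a" and ii :: 'a
    and alg :: "(int^'d) set \<Rightarrow> 'a set" and Phi beta and lam N :: real
begin

sublocale analytic_net alg gen "2 * N * exp 1 / lam"
proof (rule analytic_net.intro[OF dissipative_net_axioms analytic_net_axioms.intro])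
  show "0 < 2 * N * exp 1 / lam" using N lam by simp
  fix a assume "a \<in> qlD alg"
  then show "\<exists>v C. v 0 = a \<and> (\<forall>n. (v n, v (Suc n)) \<in> closure G0)
      \<and> (\<forall>n. norm (v n) \<le> C * fact n * (2 * N * exp 1 / lam) ^ n)"
    using analytic_vectors unfolding delta_graph_eq by blast
qed

lemma dyn_eq: "finite L \<Longrightarrow> dyn ii Phi beta L t = E L t"
  by (rule ext) (simp add: dyn_def dissipative_operator.exp_op_def[OF dissipative_operator])

lemma gen_cs:
  assumes "finite L" "y \<in> alg L"
  shows "cs ii c y \<in> alg L \<and> gen L (cs ii c y) = cs ii c (gen L y)"
  using star_derivation_gen[OF assms(1)] assms cs_alg unfolding star_derivation_def by blast

lemma c0_contraction_T: "c0_contraction ii (qlA alg) T"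
  unfolding c0_contraction_def
  using T_qlA norm_T T_add T_0 T_plus T_continuous_on T_commute[OF bounded_linear_cs gen_cs]
  by auto

lemma dyn_tendsto:
  assumes "local_net a" "(a \<longlongrightarrow> x) netF" "0 \<le> t"
  shows "((\<lambda>L. dyn ii Phi beta L t (a L)) \<longlongrightarrow> T t x) netF"
  by (rule Lim_transform_eventually[OF T_lim[OF assms]])
     (auto intro!: eventually_mono[OF eventually_netF_finite] simp: dyn_eq)

lemma evolution: "evolution_conditions ii alg Phi beta"
proof -
  have lim: "((\<lambda>L. dyn ii Phi beta L t (a L)) \<longlongrightarrow> T t (netlim a)) netF"
    if "0 \<le> t" "(\<forall>L. finite L \<longrightarrow> a L \<in> alg L) \<and> conv_net a" for t a
    using that by (intro dyn_tendsto conv_net_tendsto) (auto simp: local_net_def)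
  show ?thesis
    unfolding evolution_conditions_def delta_inf_def
  proof (intro conjI exI[of _ T] allI impI)
    show "conv_net (\<lambda>L. dyn ii Phi beta L t (a L))"
      if "0 \<le> t" "(\<forall>L. finite L \<longrightarrow> a L \<in> alg L) \<and> conv_net a" for t a
      using lim[OF that] unfolding conv_net_def by blast
    show "netlim (\<lambda>L. dyn ii Phi beta L t (a L)) = T t (netlim a)"
      if "0 \<le> t" "(\<forall>L. finite L \<longrightarrow> a L \<in> alg L) \<and> conv_net a" for t a
      by (rule netlim_eqI[OF lim[OF that]])
  qed (rule c0_contraction_T well_defined_GI GI_eq(2))+
qed

lemma delta_inf_eq: "delta_inf ii alg Phi beta = closure (delta_graph ii alg Phi)"
  unfolding delta_inf_def delta_graph_eq by (rule GI_eq(1))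

end

text \<open>A finite sum is grouped by cardinality, and each group is bounded by its supremum over
  sites. Extended reals let suprema and series be formed before finiteness is known.\<close>

lemma exponential_weight_bound:
  fixes Phi :: "(int^'d) set \<Rightarrow> 'a::real_normed_vector"
  assumes summ: "\<And>x. (\<lambda>L. norm (Phi L)) summable_on {L. finite L \<and> x \<in> L}"
    and fin: "(\<Sum>n. ennreal (exp (real n * lam)) *
      (SUP x. ennreal (infsum (\<lambda>L. norm (Phi L)) {L. finite L \<and> x \<in> L \<and> card L = n + 1}))) < top"
  shows "\<exists>N>0. \<forall>F x. finite F \<longrightarrow> F \<subseteq> {L. finite L \<and> x \<in> L} \<longrightarrow>
      (\<Sum>L\<in>F. exp (lam * real (card L - 1)) * norm (Phi L)) \<le> N"
proof -
  define I where "I n x = infsum (\<lambda>L. norm (Phi L)) {L. finite L \<and> x \<in> L \<and> card L = n + 1}" for n x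
  define tot where "tot = (\<Sum>n. ennreal (exp (real n * lam)) * (SUP x. ennreal (I n x)))"
  have tot: "tot < top" using fin by (simp add: tot_def I_def)
  have I_nonneg: "0 \<le> I n x" for n x unfolding I_def by (rule infsum_nonneg) simp
  have bound: "(\<Sum>L\<in>F. exp (lam * real (card L - 1)) * norm (Phi L)) \<le> enn2real tot"
    if F: "finite F" "F \<subseteq> {L. finite L \<and> x \<in> L}" for F x
  proof -
    \<comment> \<open>Inserting 0 keeps the maximum meaningful for empty \<open>F\<close>.\<close>
    define m where "m = Max (insert 0 ((\<lambda>L. card L - 1) ` F))"
    have "(\<Sum>L\<in>F. exp (lam * real (card L - 1)) * norm (Phi L))
        = (\<Sum>n\<in>{..m}. \<Sum>L\<in>{L \<in> F. card L - 1 = n}. exp (lam * real (card L - 1)) * norm (Phi L))"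
      using F by (intro sum.group[symmetric]) (auto simp: m_def)
    also have "\<dots> = (\<Sum>n\<in>{..m}. exp (real n * lam) * (\<Sum>L\<in>{L \<in> F. card L - 1 = n}. norm (Phi L)))"
      unfolding sum_distrib_left by (intro sum.cong) (auto simp: mult.commute)
    also have "\<dots> \<le> (\<Sum>n\<in>{..m}. exp (real n * lam) * I n x)"
    proof (intro sum_mono mult_left_mono)
      fix n
      show "(\<Sum>L\<in>{L \<in> F. card L - 1 = n}. norm (Phi L)) \<le> I n x"
        unfolding I_def
      proof (rule finite_sum_le_infsum)
        show "(\<lambda>L. norm (Phi L)) summable_on {L. finite L \<and> x \<in> L \<and> card L = n + 1}"
          by (rule summable_on_subset_banach[OF summ[of x]]) auto
        show "{L \<in> F. card L - 1 = n} \<subseteq> {L. finite L \<and> x \<in> L \<and> card L = n + 1}"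
        proof
          fix L assume L: "L \<in> {L \<in> F. card L - 1 = n}"
          then have "finite L" "x \<in> L" using F by auto
          then have "card L > 0" by (auto simp: card_gt_0_iff)
          with L \<open>finite L\<close> \<open>x \<in> L\<close> show "L \<in> {L. finite L \<and> x \<in> L \<and> card L = n + 1}" by auto
        qed
      qed (use F in auto)
    qed simp
    finally have "ennreal (\<Sum>L\<in>F. exp (lam * real (card L - 1)) * norm (Phi L))
        \<le> ennreal (\<Sum>n\<in>{..m}. exp (real n * lam) * I n x)" by (rule ennreal_leI)
    also have "\<dots> = (\<Sum>n\<in>{..m}. ennreal (exp (real n * lam)) * ennreal (I n x))"
      using I_nonneg by (simp add: ennreal_mult sum_ennreal[symmetric])
    also have "\<dots> \<le> (\<Sum>n\<in>{..m}. ennreal (exp (real n * lam)) * (SUP x. ennreal (I n x)))"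
      by (intro sum_mono mult_left_mono SUP_upper) auto
    also have "\<dots> \<le> tot" unfolding tot_def by (intro sum_le_suminf) auto
    finally have "enn2real (ennreal (\<Sum>L\<in>F. exp (lam * real (card L - 1)) * norm (Phi L))) \<le> enn2real tot"
      using tot by (rule enn2real_mono)
    then show ?thesis by (simp add: sum_nonneg)
  qed
  show ?thesis
  \<comment> \<open>The summand 1 gives a strictly positive constant even for a vanishing
    interaction.\<close>
  proof (intro exI[of _ "enn2real tot + 1"] conjI allI impI)
    show "0 < enn2real tot + 1" by (simp add: add_nonneg_pos)
    show "(\<Sum>L\<in>F. exp (lam * real (card L - 1)) * norm (Phi L)) \<le> enn2real tot + 1"
      if "finite F" "F \<subseteq> {L. finite L \<and> x \<in> L}" for F x
      using bound[OF that] by linarith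
  qed
qed

theorem theorem7:
  fixes star :: "'a::{real_normed_algebra_1,banach} \<Rightarrow> 'a"
    and ii :: 'a
    and alg :: "(int^'d) set \<Rightarrow> 'a set"
    and Phi :: "(int^'d) set \<Rightarrow> 'a"
    and beta :: "(int^'d) set \<Rightarrow> 'a \<Rightarrow> 'a"
  assumes "quasi_local star ii alg"
    and "interaction star alg Phi"
    and "\<forall>x. (\<lambda>L. norm (Phi L)) summable_on {L. finite L \<and> x \<in> L}"
    and "boundary_net star ii alg beta"
  shows "(\<forall>(a, b) \<in> delta_graph ii alg Phi. ((\<lambda>L. dloc ii Phi L a + beta L a) \<longlongrightarrow> b) netF)
    \<and> well_defined (delta_inf ii alg Phi beta)
    \<and> closed (delta_inf ii alg Phi beta)
    \<and> delta_graph ii alg Phi \<subseteq> delta_inf ii alg Phi beta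
    \<and> ((\<exists>lam>0. (\<Sum>n. ennreal (exp (real n * lam)) *
            (SUP x. ennreal (infsum (\<lambda>L. norm (Phi L)) {L. finite L \<and> x \<in> L \<and> card L = n + 1}))) < top)
       \<longrightarrow> evolution_conditions ii alg Phi beta
         \<and> closure (delta_graph ii alg Phi) = delta_inf ii alg Phi beta
         \<and> (\<forall>beta'. boundary_net star ii alg beta' \<longrightarrow>
               delta_inf ii alg Phi beta' = delta_inf ii alg Phi beta))"
proof -
  have cstar: "cstar_algebra star ii"
    using assms(1) unfolding quasi_local_def cstar_algebra_def by blast
  have spin: "spin_system star ii alg Phi"
    by (rule spin_system.intro[OF cstar spin_system_axioms.intro]) (use assms in auto)
  interpret spin_system_boundary star ii alg Phi beta
    by (rule spin_system_boundary.intro[OF spin spin_system_boundary_axioms.intro[OF assms(4)]])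
  have "((\<lambda>L. dloc ii Phi L a + beta L a) \<longlongrightarrow> b) netF" if "(a, b) \<in> delta_graph ii alg Phi" for a b
    using that tendsto_netlim_A unfolding delta_graph_eq G0_def by blast
  moreover have "evolution_conditions ii alg Phi beta
         \<and> closure (delta_graph ii alg Phi) = delta_inf ii alg Phi beta
         \<and> (\<forall>beta'. boundary_net star ii alg beta' \<longrightarrow>
               delta_inf ii alg Phi beta' = delta_inf ii alg Phi beta)"
    if "lam > 0" and fin: "(\<Sum>n. ennreal (exp (real n * lam)) *
            (SUP x. ennreal (infsum (\<lambda>L. norm (Phi L)) {L. finite L \<and> x \<in> L \<and> card L = n + 1}))) < top" for lam
  proof -
    obtain N where "N > 0" "\<And>F x. finite F \<Longrightarrow> F \<subseteq> {L. finite L \<and> x \<in> L} \<Longrightarrow>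
      (\<Sum>L\<in>F. exp (lam * real (card L - 1)) * norm (Phi L)) \<le> N"
      using exponential_weight_bound[OF summable_Phi fin] by blast
    then have range: "short_range_spin_system star ii alg Phi lam N"
      by (intro short_range_spin_system.intro[OF spin short_range_spin_system_axioms.intro]) (use \<open>lam > 0\<close> in auto)
    have *: "short_range_spin_system_boundary star ii alg Phi beta' lam N"
      if "boundary_net star ii alg beta'" for beta'
      by (intro short_range_spin_system_boundary.intro spin_system_boundary.intro[OF spin]
           spin_system_boundary_axioms.intro that range)
    show ?thesis
      \<comment> \<open>\<open>delta_inf_eq\<close> equates the limit graph of every boundary net
        with the same closure, which gives both the core property and independence.\<close>
      using short_range_spin_system_boundary.evolution[OF *[OF assms(4)]]
        short_range_spin_system_boundary.delta_inf_eq[OF *] assms(4) by auto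
  qed
  ultimately show ?thesis
    using well_defined_GI closed_GI G0_GI unfolding delta_inf_def delta_graph_eq by blast
qed

end
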